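(* Let $n\ge1$, $D\in\mathcal D^n$, let $X\in\mathcal X^n_D$ with Weierstrass data $(G,H)$. The second-order equation $(E)$ having $(G,H)$ as a fundamental system of solutions is a real Fuchsian equation on the Riemann sphere $\mathbb P^1$.
   Context: Directions and polygons: indices are taken modulo $n+3$; an oriented direction of $\mathbb R^3$ is identified with a unit vector. $\mathcal D^n$ is the set of $(n+3)$-tuples $D=(D_1,\dots,D_{n+3})$ of oriented directions such that no two $D_i,D_j$ ($i\ne j$) are collinear and, for every $i\notin\{n+1,n+2\}$, $D_i,D_{n+1},D_{n+2}$ are not coplanar. A polygon with $n+3$ distinct vertices and oriented directions $D$ consists of points $a_1,\dots,a_{n+2}\in\mathbb R^3$ with $D_i=(a_{i+1}-a_i)/\|a_{i+1}-a_i\|$ for $1\le i\le n+1$, together with $D_{n+2},D_{n+3}$; if the half-line from $a_{n+2}$ directed by $D_{n+2}$ and the half-line from $a_1$ directed by $-D_{n+3}$ meet, the intersection is the last vertex $a_{n+3}\in\mathbb R^3$, otherwise $a_{n+3}=\infty$ and the last two sides are these half-lines. $\mathcal P^n_D$ is the set of such polygons modulo translations and homotheties of positive ratio. $\theta_i\pi$, $0<\theta_i<1$, is the angle between $D_{i-1}$ and $D_i$. Immersions: $\mathcal X^n_D$ is the set, modulo translations and homotheties of positive ratio, of conformal minimal immersions $X:\mathbb C_+\to\mathbb R^3$ of the upper half-plane such that: $X$ extends continuously to $\overline{\mathbb R}=\mathbb R\cup\{\infty\}$ (with value $\infty$ at a vertex at infinity), $X|_{\overline{\mathbb R}}$ represents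 a polygon $P\in\mathcal P^n_D$, and $X$ has no boundary branch point except possibly at the vertices; $X$ has at $a_i$ ($1\le i\le n+2$) an angle $(1-\varepsilon_i\theta_i)\pi$ with $\varepsilon_i=\pm1$, and at $a_{n+3}$ an angle $(1-\theta_{n+3})\pi$; if $a_{n+3}=\infty$ then $X$ has a helicoidal end there (it is asymptotic to a helicoid); if $a_{n+3}\in\mathbb R^3$ then the surface is bounded. The preimages $t_1<\dots<t_{n+3}$ in $\overline{\mathbb R}$ of the vertices are normalized by $t_{n+1}=0$, $t_{n+2}=1$, $t_{n+3}=\infty$. The Weierstrass data of $X$ is the pair $(G,H)$ (unique up to sign) of holomorphic functions on $\mathbb C_+$ without common zero such that, up to translation, $X(x)=\operatorname{Re}\int_{x_0}^x (i(G^2-H^2),\,G^2+H^2,\,2iGH)\,d\xi$. $G,H$ are linearly independent, and $(E)$ is the unique equation $y''+p(x)y'+q(x)y=0$ with solutions $G,H$. The equation is Fuchsian on $\mathbb P^1$ if its coefficients extend meromorphically to $\mathbb P^1$ and all its singularities are Fuchsian: at finite points $p$ has poles of order $\le1$ and $q$ of order $\le2$, and $w^{-1}p(1/w)$, $w^{-2}q(1/w)$ are holomorphic at $w=0$ (or have no singularity at $\infty$). It is real if $p$ and $q$ are real-valued on the real axis. *)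

theory Defs
  imports "HOL-Complex_Analysis.Complex_Analysis"
begin

section \<open>Directions and polygons\<close>

text \<open>
  Families indexed by \<open>1, \<dots>, n + 3\<close> are functions on \<^typ>\<open>nat\<close>; values at other indices are
  irrelevant. Indices are cyclic modulo \<open>n + 3\<close>, which only matters for the predecessor of \<open>1\<close>.
\<close>

definition direction_tuples :: "nat \<Rightarrow> (nat \<Rightarrow> real^3) set" where
  "direction_tuples n = {D.
     (\<forall>i\<in>{1..n+3}. norm (D i) = 1) \<and>
     (\<forall>i\<in>{1..n+3}. \<forall>j\<in>{1..n+3}. i \<noteq> j \<longrightarrow> \<not> collinear {0, D i, D j}) \<and>
     (\<forall>i\<in>{1..n+3} - {n+1, n+2}. \<not> coplanar {0, D i, D (n+1), D (n+2)})}"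

definition cyc_pred :: "nat \<Rightarrow> nat \<Rightarrow> nat" where
  "cyc_pred n i = (if i = 1 then n + 3 else i - 1)"

definition angle_coeff :: "nat \<Rightarrow> (nat \<Rightarrow> real^3) \<Rightarrow> nat \<Rightarrow> real" where
  "angle_coeff n D i = arccos (D (cyc_pred n i) \<bullet> D i) / pi"

definition half_line :: "real^3 \<Rightarrow> real^3 \<Rightarrow> (real^3) set" where
  "half_line p d = {p + s *\<^sub>R d | s. 0 \<le> s}"

text \<open>
  The vertices \<open>a\<^sub>1, \<dots>, a\<^sub>n\<^sub>+\<^sub>2\<close> are given by \<open>a\<close>; the last vertex \<open>v\<close> is \<^term>\<open>None\<close> when it is
  the point at infinity. The two half-lines below meet in at most one point, because their
  directions are not collinear.
\<close>

definition is_polygon ::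
    "nat \<Rightarrow> (nat \<Rightarrow> real^3) \<Rightarrow> (nat \<Rightarrow> real^3) \<Rightarrow> (real^3) option \<Rightarrow> bool" where
  "is_polygon n D a v \<longleftrightarrow>
     inj_on a {1..n+2} \<and>
     (\<forall>i\<in>{1..n+1}. D i = (1 / norm (a (i+1) - a i)) *\<^sub>R (a (i+1) - a i)) \<and>
     (let R = half_line (a (n+2)) (D (n+2)); R' = half_line (a 1) (- D (n+3)) in
        case v of
          None \<Rightarrow> R \<inter> R' = {}
        | Some b \<Rightarrow> b \<in> R \<inter> R' \<and> b \<notin> a ` {1..n+2})"

section \<open>Conformal minimal immersions of the upper half-plane\<close>

definition upper_hp :: "complex set" where
  "upper_hp = {z. Im z > 0}"

definition closed_upper_hp :: "complex set" where
  "closed_upper_hp = {z. Im z \<ge> 0}"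

definition at_infinity_upper :: "complex filter" where
  "at_infinity_upper = inf at_infinity (principal closed_upper_hp)"

text \<open>
  \<open>dir_deriv 1\<close> and \<open>dir_deriv \<i>\<close> are the partial derivatives with respect to the real
  coordinates \<open>u\<close> and \<open>v\<close> of \<open>u + \<i>v\<close>.
\<close>

definition dir_deriv :: "complex \<Rightarrow> (complex \<Rightarrow> real^3) \<Rightarrow> complex \<Rightarrow> real^3" where
  "dir_deriv d X z = frechet_derivative X (at z) d"

definition smooth_on_upper_hp :: "(complex \<Rightarrow> real^3) \<Rightarrow> bool" where
  "smooth_on_upper_hp X \<longleftrightarrow>
     (\<forall>ds. set ds \<subseteq> {1, \<i>} \<longrightarrow> foldr dir_deriv ds X differentiable_on upper_hp)"

definition unit_normal :: "(complex \<Rightarrow> real^3) \<Rightarrow> complex \<Rightarrow> real^3" where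
  "unit_normal X z = sgn (cross3 (dir_deriv 1 X z) (dir_deriv \<i> X z))"

text \<open>\<open>E, F, G\<close> and \<open>L, M, N\<close> are the coefficients of the two fundamental forms.\<close>

definition mean_curvature :: "(complex \<Rightarrow> real^3) \<Rightarrow> complex \<Rightarrow> real" where
  "mean_curvature X z =
     (let E = dir_deriv 1 X z \<bullet> dir_deriv 1 X z;
          F = dir_deriv 1 X z \<bullet> dir_deriv \<i> X z;
          G = dir_deriv \<i> X z \<bullet> dir_deriv \<i> X z;
          L = dir_deriv 1 (dir_deriv 1 X) z \<bullet> unit_normal X z;
          M = dir_deriv 1 (dir_deriv \<i> X) z \<bullet> unit_normal X z;
          N = dir_deriv \<i> (dir_deriv \<i> X) z \<bullet> unit_normal X z
      in (E * N - 2 * F * M + G * L) / (2 * (E * G - F\<^sup>2)))"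

definition conformal_minimal_immersion :: "(complex \<Rightarrow> real^3) \<Rightarrow> bool" where
  "conformal_minimal_immersion X \<longleftrightarrow>
     smooth_on_upper_hp X \<and>
     (\<forall>z\<in>upper_hp.
        inj (frechet_derivative X (at z)) \<and>
        norm (dir_deriv 1 X z) = norm (dir_deriv \<i> X z) \<and>
        dir_deriv 1 X z \<bullet> dir_deriv \<i> X z = 0 \<and>
        mean_curvature X z = 0)"

section \<open>Boundary behaviour\<close>

text \<open>
  A map \<open>X\<close> on the open half-plane that extends continuously to the real axis is represented
  together with its extension, so its values on the real axis are the boundary values. The
  extension to the boundary point \<open>\<infinity>\<close> is expressed by a limit.
\<close>

definition extends_continuously :: "(complex \<Rightarrow> real^3) \<Rightarrow> (real^3) option \<Rightarrow> bool" where
  "extends_continuously X v \<longleftrightarrow>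
     continuous_on closed_upper_hp X \<and>
     (case v of
        None \<Rightarrow> filterlim X at_infinity at_infinity_upper
      | Some b \<Rightarrow> (X \<longlongrightarrow> b) at_infinity_upper)"

text \<open>
  The preimage of the last vertex is the boundary point \<open>\<infinity>\<close>, so the last two sides are
  parametrized by \<open>[t\<^sub>n\<^sub>+\<^sub>2, \<infinity>)\<close> and \<open>(-\<infinity>, t\<^sub>1]\<close>.
\<close>

definition represents_polygon ::
    "nat \<Rightarrow> (nat \<Rightarrow> real^3) \<Rightarrow> (complex \<Rightarrow> real^3) \<Rightarrow> (nat \<Rightarrow> real) \<Rightarrow>
       (nat \<Rightarrow> real^3) \<Rightarrow> (real^3) option \<Rightarrow> bool" where
  "represents_polygon n D X t a v \<longleftrightarrow>
     (\<forall>i\<in>{1..n+2}. X (of_real (t i)) = a i) \<and>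
     (\<forall>i\<in>{1..n+1}.
        bij_betw (\<lambda>s. X (of_real s)) {t i..t (i+1)} (closed_segment (a i) (a (i+1)))) \<and>
     (case v of
        None \<Rightarrow>
          bij_betw (\<lambda>s. X (of_real s)) {t (n+2)..} (half_line (a (n+2)) (D (n+2))) \<and>
          bij_betw (\<lambda>s. X (of_real s)) {..t 1} (half_line (a 1) (- D (n+3)))
      | Some b \<Rightarrow>
          bij_betw (\<lambda>s. X (of_real s)) {t (n+2)..} (closed_segment (a (n+2)) b - {b}) \<and>
          bij_betw (\<lambda>s. X (of_real s)) {..t 1} (closed_segment b (a 1) - {b}))"

definition boundary_branch_point :: "(complex \<Rightarrow> real^3) \<Rightarrow> real \<Rightarrow> bool" where
  "boundary_branch_point X s \<longleftrightarrow>
     (X has_derivative (\<lambda>_. 0)) (at (of_real s) within closed_upper_hp)"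

definition orthonormal_frame :: "real^3 \<Rightarrow> real^3 \<Rightarrow> real^3 \<Rightarrow> bool" where
  "orthonormal_frame e1 e2 e3 \<longleftrightarrow>
     norm e1 = 1 \<and> norm e2 = 1 \<and> norm e3 = 1 \<and> e1 \<bullet> e2 = 0 \<and> e1 \<bullet> e3 = 0 \<and> e2 \<bullet> e3 = 0"

text \<open>
  The angle of \<open>X\<close> at the vertex \<open>p = X(s)\<close> is \<open>\<alpha>\<pi>\<close>: there is a tangent plane at \<open>p\<close>, in which
  the direction from \<open>p\<close> to the surface turns by \<open>\<alpha>\<pi>\<close> from one side to the other, that is, as the
  argument \<open>\<phi>\<close> of \<open>z - s\<close> goes from \<open>0\<close> to \<open>\<pi>\<close>. By conformality the direction at argument \<open>\<phi>\<close>
  makes the angle \<open>\<alpha>\<phi>\<close> with the side at argument \<open>0\<close>. The angle is counted in the surface, so it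
  can exceed \<open>\<pi>\<close>.
\<close>

definition has_vertex_angle :: "(complex \<Rightarrow> real^3) \<Rightarrow> real \<Rightarrow> real^3 \<Rightarrow> real \<Rightarrow> bool" where
  "has_vertex_angle X s p \<alpha> \<longleftrightarrow>
     (\<exists>e1 e2 e3. orthonormal_frame e1 e2 e3 \<and>
        ((\<lambda>z. sgn (X z - p) -
            (cos (\<alpha> * Arg (z - of_real s)) *\<^sub>R e1 + sin (\<alpha> * Arg (z - of_real s)) *\<^sub>R e2))
         \<longlongrightarrow> 0) (at (of_real s) within closed_upper_hp))"

text \<open>
  The complete helicoid with axis \<open>c + \<real> e3\<close> and pitch \<open>2\<pi>k\<close>, in its standard isothermal
  coordinate \<open>w\<close>. The frame may have either orientation, so helicoids of both
  handednesses are obtained with \<open>k > 0\<close>.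
\<close>

definition helicoid ::
    "real^3 \<Rightarrow> real^3 \<Rightarrow> real^3 \<Rightarrow> real^3 \<Rightarrow> real \<Rightarrow> complex \<Rightarrow> real^3" where
  "helicoid c e1 e2 e3 k w =
     c + k *\<^sub>R ((sinh (Re w) * cos (Im w)) *\<^sub>R e1 + (sinh (Re w) * sin (Im w)) *\<^sub>R e2 + Im w *\<^sub>R e3)"

text \<open>
  Near \<open>\<infinity>\<close>, \<open>w = \<alpha> Ln z + \<mu>\<close> maps the half-plane conformally onto an end of the strip
  \<open>0 < Im w < \<alpha>\<pi>\<close>, which \<open>helicoid\<close> maps to a helicoidal sector that is bounded by two half-lines
  and turns by \<open>\<alpha>\<pi>\<close>. For \<open>\<alpha> < 1\<close>, any other conformal parametrization of this sector on a
  neighbourhood of \<open>\<infinity>\<close> in the half-plane has, for a suitable \<open>\<mu>\<close>, the same limit behaviour up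
  to a term that tends to \<open>0\<close>.
\<close>

definition has_helicoidal_end :: "(complex \<Rightarrow> real^3) \<Rightarrow> real \<Rightarrow> bool" where
  "has_helicoidal_end X \<alpha> \<longleftrightarrow>
     (\<exists>c e1 e2 e3 k \<mu>. orthonormal_frame e1 e2 e3 \<and> k > 0 \<and>
        ((\<lambda>z. X z - helicoid c e1 e2 e3 k (of_real \<alpha> * Ln z + of_real \<mu>)) \<longlongrightarrow> 0) at_infinity_upper)"

section \<open>Minimal disks with polygonal boundary\<close>

text \<open>
  These are the representatives of the classes modulo translations and homotheties of positive
  ratio; the set is invariant under both. At a finite vertex with preimage \<open>\<infinity>\<close>, the angle is
  measured in the coordinate \<open>w = -1/z\<close>, which preserves the half-plane and sends \<open>\<infinity>\<close> to \<open>0\<close>.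
\<close>

definition polygonal_minimal_disks :: "nat \<Rightarrow> (nat \<Rightarrow> real^3) \<Rightarrow> (complex \<Rightarrow> real^3) set" where
  "polygonal_minimal_disks n D = {X.
     conformal_minimal_immersion X \<and>
     (\<exists>a v t.
        is_polygon n D a v \<and>
        strict_mono_on {1..n+2} t \<and> t (n+1) = 0 \<and> t (n+2) = 1 \<and>
        extends_continuously X v \<and>
        represents_polygon n D X t a v \<and>
        (\<forall>s. s \<notin> t ` {1..n+2} \<longrightarrow> \<not> boundary_branch_point X s) \<and>
        (\<exists>\<epsilon> :: nat \<Rightarrow> real. \<forall>i\<in>{1..n+2}.
           \<epsilon> i \<in> {1, -1} \<and>
           has_vertex_angle X (t i) (a i) (1 - \<epsilon> i * angle_coeff n D i)) \<and>
        (case v of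
           None \<Rightarrow> has_helicoidal_end X (1 - angle_coeff n D (n+3))
         | Some b \<Rightarrow>
             has_vertex_angle (\<lambda>w. X (- 1 / w)) 0 b (1 - angle_coeff n D (n+3)) \<and>
             bounded (X ` upper_hp)))}"

definition weierstrass_data ::
    "(complex \<Rightarrow> real^3) \<Rightarrow> (complex \<Rightarrow> complex) \<Rightarrow> (complex \<Rightarrow> complex) \<Rightarrow> bool" where
  "weierstrass_data X G H \<longleftrightarrow>
     G holomorphic_on upper_hp \<and> H holomorphic_on upper_hp \<and>
     (\<forall>z\<in>upper_hp. \<not> (G z = 0 \<and> H z = 0)) \<and>
     (\<exists>x0\<in>upper_hp. \<exists>c. \<forall>x\<in>upper_hp.
        X x = c + vector
          [Re (contour_integral (linepath x0 x) (\<lambda>\<xi>. \<i> * ((G \<xi>)\<^sup>2 - (H \<xi>)\<^sup>2))),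
           Re (contour_integral (linepath x0 x) (\<lambda>\<xi>. (G \<xi>)\<^sup>2 + (H \<xi>)\<^sup>2)),
           Re (contour_integral (linepath x0 x) (\<lambda>\<xi>. 2 * \<i> * G \<xi> * H \<xi>))])"

section \<open>Second-order equations\<close>

text \<open>
  The equation \<open>y'' + p y' + q y = 0\<close> is represented by \<open>(p, q)\<close>. Values of a meromorphic function
  at its poles (and at removable singularities) are arbitrary, so pointwise conditions are only
  imposed where the coefficients are analytic.
\<close>

definition fundamental_system ::
    "complex set \<Rightarrow> (complex \<Rightarrow> complex) \<Rightarrow> (complex \<Rightarrow> complex) \<Rightarrow>
       (complex \<Rightarrow> complex) \<Rightarrow> (complex \<Rightarrow> complex) \<Rightarrow> bool" where
  "fundamental_system S p q y1 y2 \<longleftrightarrow>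
     p meromorphic_on S \<and> q meromorphic_on S \<and>
     y1 holomorphic_on S \<and> y2 holomorphic_on S \<and>
     (\<forall>c d. (\<forall>x\<in>S. c * y1 x + d * y2 x = 0) \<longrightarrow> c = 0 \<and> d = 0) \<and>
     (\<forall>y\<in>{y1, y2}. \<forall>x\<in>S. p analytic_on {x} \<and> q analytic_on {x} \<longrightarrow>
        deriv (deriv y) x + p x * deriv y x + q x * y x = 0)"

definition extends_holomorphically_at :: "(complex \<Rightarrow> complex) \<Rightarrow> complex \<Rightarrow> bool" where
  "extends_holomorphically_at f z \<longleftrightarrow>
     (\<exists>h. h analytic_on {z} \<and> (\<forall>\<^sub>F w in at z. f w = h w))"

definition pole_order_le :: "(complex \<Rightarrow> complex) \<Rightarrow> complex \<Rightarrow> nat \<Rightarrow> bool" where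
  "pole_order_le f z m \<longleftrightarrow> extends_holomorphically_at (\<lambda>w. (w - z) ^ m * f w) z"

text \<open>
  The condition at \<open>\<infinity>\<close> also covers the case where \<open>\<infinity>\<close> is not a singularity: then
  \<open>2/w - p(1/w)/w\<^sup>2\<close> and \<open>q(1/w)/w\<^sup>4\<close> are holomorphic at \<open>w = 0\<close>, hence so are \<open>p(1/w)/w\<close> and
  \<open>q(1/w)/w\<^sup>2\<close>.
\<close>

definition fuchsian_on_sphere :: "(complex \<Rightarrow> complex) \<Rightarrow> (complex \<Rightarrow> complex) \<Rightarrow> bool" where
  "fuchsian_on_sphere p q \<longleftrightarrow>
     p meromorphic_on UNIV \<and> (\<lambda>w. p (1 / w)) meromorphic_on {0} \<and>
     q meromorphic_on UNIV \<and> (\<lambda>w. q (1 / w)) meromorphic_on {0} \<and>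
     (\<forall>z. pole_order_le p z 1 \<and> pole_order_le q z 2) \<and>
     extends_holomorphically_at (\<lambda>w. p (1 / w) / w) 0 \<and>
     extends_holomorphically_at (\<lambda>w. q (1 / w) / w\<^sup>2) 0"

definition real_on_real_axis :: "(complex \<Rightarrow> complex) \<Rightarrow> bool" where
  "real_on_real_axis f \<longleftrightarrow> (\<forall>x\<in>\<real>. f analytic_on {x} \<longrightarrow> f x \<in> \<real>)"

definition is_real_fuchsian_equation ::
    "complex set \<Rightarrow> (complex \<Rightarrow> complex) \<Rightarrow> (complex \<Rightarrow> complex) \<Rightarrow> bool" where
  "is_real_fuchsian_equation S p q \<longleftrightarrow>
     (\<exists>P Q. (\<forall>\<^sub>\<approx>x\<in>S. P x = p x \<and> Q x = q x) \<and>
        fuchsian_on_sphere P Q \<and> real_on_real_axis P \<and> real_on_real_axis Q)"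

end

theory Submission
  imports Defs
begin

text \<open>
  For \<open>v \<in> \<real>\<^sup>3\<close> let \<open>\<Phi> v\<close> be the quadratic form in \<open>G, H\<close> whose primitives have real part \<open>X \<bullet> v\<close>, up
  to a constant. The squares of \<open>\<Phi>\<close> along an orthonormal frame add up to \<open>0\<close>, because the
  coordinates of \<open>X\<close> are conformal.

  Let \<open>X\<close> map an open interval of the real axis into a line of direction \<open>d\<close>. For \<open>v\<close> orthogonal to \<open>d\<close>
  the function \<open>X \<bullet> v\<close> is constant on the interval, so by the reflection principle \<open>\<Phi> v\<close> continues
  holomorphically across it, with imaginary values on it; hence \<open>(\<Phi> d)\<^sup>2\<close> continues with values
  \<open>\<ge> 0\<close>, and \<open>\<Phi> d\<close> has real boundary values (\<open>side_limits\<close>). The same reflection gives an estimate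
  of \<open>\<Phi>\<close> by \<open>X\<close>, uniform up to the sides (\<open>form_growth\<close>): \<open>\<Phi>\<close> is at most of order \<open>1/\<bar>z - t\<bar>\<close> at
  a finite boundary point \<open>t\<close>, where \<open>X\<close> is continuous, and of polynomial growth at \<open>\<infinity>\<close>, where \<open>X\<close>
  is bounded or close to a helicoid.

  At a boundary point let \<open>d\<close> and \<open>d'\<close> be the directions of the two adjacent sides, and choose a unit
  vector \<open>e\<close> orthogonal to \<open>d\<close> with \<open>d' = cos \<beta> d + sin \<beta> e\<close>. The vectors \<open>d \<plusminus> \<i>e\<close> are isotropic,
  so \<open>\<Phi> d \<plusminus> \<i>\<Phi> e\<close> are the squares of two linearly independent combinations \<open>y\<^sub>1, y\<^sub>2\<close> of \<open>G, H\<close>. On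
  one side these squares are real; on the other side they are real up to the constant phases
  \<open>exp (\<plusminus>\<i>\<beta>)\<close>, because passing from \<open>d, e\<close> to \<open>d'\<close> is a rotation of their plane. A real power of the
  local coordinate absorbs the phase; the product is real on both sides, continues by reflection to a
  punctured disk, and has a pole at worst by the growth estimate. Therefore the logarithmic
  derivatives of \<open>y\<^sub>1, y\<^sub>2\<close> continue with simple poles and real coefficients
  (\<open>boundary_exponent\<close>). Both coefficients of the equation are rational expressions in these
  logarithmic derivatives and their derivatives, and have poles of the order that a
  Fuchsian singularity allows (\<open>fuchsian_in_local_coordinate\<close>). Inside the half-plane the same
  expressions in the logarithmic derivatives of \<open>G\<close> and \<open>H\<close> do it. At \<open>\<infinity>\<close> the coordinate \<open>-1/z\<close> is
  used. So the coefficients, continued to the lower half-plane by reflection, are those of a real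
  Fuchsian equation.

  Finally \<open>G, H\<close> are linearly independent: a linear relation between them would produce a nonzero real
  vector \<open>e\<close> with \<open>\<Phi> e = 0\<close> (\<open>independent_unless_planar\<close>). Then \<open>X\<close> would lie in a plane orthogonal to
  \<open>e\<close>, and three directions that are not coplanar would be parallel to this plane.
\<close>

section \<open>The reflection principle\<close>

lemma open_upper_hp: "open upper_hp"
  by (simp add: upper_hp_def open_halfspace_Im_gt)

lemma convex_upper_hp: "convex upper_hp"
  by (simp add: upper_hp_def convex_halfspace_Im_gt)

lemma upper_hp_subset_closed: "upper_hp \<subseteq> closed_upper_hp"
  by (auto simp: upper_hp_def closed_upper_hp_def)

lemma real_at_within_upper_hp_neq_bot: "at (of_real x) within upper_hp \<noteq> bot"
proof -
  have "of_real x \<in> closure upper_hp"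
  proof (subst closure_approachable, intro allI impI)
    fix e :: real assume "e > 0"
    then show "\<exists>y\<in>upper_hp. dist y (of_real x) < e"
      by (intro bexI[of _ "of_real x + of_real (e/2) * \<i>"]) (auto simp: upper_hp_def dist_norm norm_mult)
  qed
  moreover have "of_real x \<notin> upper_hp" by (simp add: upper_hp_def)
  ultimately show ?thesis
    by (simp add: at_within_eq_bot_iff)
qed

lemma upper_point_in_ball:
  assumes "r > 0"
  shows "of_real x0 + of_real (r/2) * \<i> \<in> ball (of_real x0) r \<inter> upper_hp"
  using assms by (auto simp: upper_hp_def dist_norm norm_mult)

lemma cnj_in_real_ball: "z \<in> ball (of_real x0) r \<Longrightarrow> cnj z \<in> ball (of_real x0) r"
  by (metis complex_cnj_complex_of_real complex_cnj_diff complex_mod_cnj dist_norm mem_ball)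

text \<open>
  Both sides of \<open>K(cnj z) = cnj (K z)\<close> are holomorphic in \<open>cnj z\<close> and agree on the real axis; the proof
  compares \<open>K\<close> with its own Schwarz reflection.
\<close>

lemma holomorphic_real_on_reals_symmetric:
  assumes "K holomorphic_on ball (of_real x0) r" "\<And>x. complex_of_real x \<in> ball (of_real x0) r \<Longrightarrow> K (of_real x) \<in> \<real>"
    and z: "z \<in> ball (of_real x0) r"
  shows "K (cnj z) = cnj (K z)"
proof -
  let ?B = "ball (of_real x0 :: complex) r"
  let ?g = "\<lambda>z. if 0 \<le> Im z then K z else cnj (K (cnj z))"
  have cB: "cnj z \<in> ?B" if "z \<in> ?B" for z
    using that by (rule cnj_in_real_ball)
  have hg: "?g holomorphic_on ?B"
  proof (rule Schwarz_reflection)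
    show "K z \<in> \<real>" if "z \<in> ?B" "z \<in> \<real>" for z
    proof -
      from that(2) obtain x where "z = of_real x" by (rule Reals_cases)
      then show ?thesis using that(1) assms(2) by blast
    qed
    show "K holomorphic_on ?B \<inter> {z. 0 < Im z}"
      using assms(1) by (rule holomorphic_on_subset) auto
    show "continuous_on (?B \<inter> {z. 0 \<le> Im z}) K"
      using holomorphic_on_imp_continuous_on[OF assms(1)] by (rule continuous_on_subset) auto
  qed (use cB in auto)
  have r: "r > 0" using z by (metis ball_empty empty_iff not_le)
  have eq: "?g w = K w" if "w \<in> ?B" for w
  proof (rule analytic_continuation_open[where s = "?B \<inter> upper_hp" and s' = ?B and f = ?g and g = K])
    show "?B \<inter> upper_hp \<noteq> {}" using upper_point_in_ball[OF r] by blast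
  qed (use assms hg that open_upper_hp in \<open>auto simp: open_Int\<close>, simp add: upper_hp_def)
  show ?thesis
  proof (cases "0 < Im z")
    case True
    then show ?thesis using eq[OF cB[OF z]] by auto
  next
    case False
    show ?thesis
    proof (cases "Im z = 0")
      case True
      then have "z = of_real (Re z)" by (simp add: complex_eq_iff)
      then have "K z \<in> \<real>" using assms(2)[of "Re z"] z by metis
      moreover have "cnj z = z" using True by (simp add: complex_eq_iff)
      ultimately show ?thesis by (simp add: Reals_cnj_iff)
    next
      case neg: False
      then have "cnj (K (cnj z)) = K z" using eq[OF z] False by auto
      then show ?thesis by (metis complex_cnj_cnj)
    qed
  qed
qed

lemma holomorphic_on_isCont: "f holomorphic_on S \<Longrightarrow> open S \<Longrightarrow> x \<in> S \<Longrightarrow> isCont f x"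
  using holomorphic_on_imp_differentiable_at field_differentiable_imp_continuous_at by blast

lemma isCont_tendsto_within: "isCont f x \<Longrightarrow> (f \<longlongrightarrow> f x) (at x within S)"
  by (rule tendsto_within_subset[OF isContD]) auto

text \<open>
  A bound in the upper half-plane passes to the lower one by symmetry, and to the real axis by
  continuity. It is applied to reflected functions.
\<close>

lemma norm_bound_by_reflection:
  fixes f :: "complex \<Rightarrow> complex"
  assumes S: "open S" and cont: "continuous_on S f"
    and sym: "\<And>z. z \<in> S \<Longrightarrow> cnj z \<in> S \<and> norm (f (cnj z)) = norm (f z)"
    and bd: "\<And>z. z \<in> S \<inter> upper_hp \<Longrightarrow> norm (f z) \<le> B" and z: "z \<in> S"
  shows "norm (f z) \<le> B"
proof -
  consider "Im z > 0" | "Im z < 0" | "Im z = 0" by linarith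
  then show ?thesis
  proof cases
    case 1 then show ?thesis using bd z by (simp add: upper_hp_def)
  next
    case 2 then show ?thesis using bd[of "cnj z"] sym[OF z] by (simp add: upper_hp_def)
  next
    case 3
    then have zr: "of_real (Re z) = z" by (simp add: complex_eq_iff)
    have "isCont f z" using cont S z continuous_on_eq_continuous_at by blast
    then have "((\<lambda>w. norm (f w)) \<longlongrightarrow> norm (f z)) (at z within upper_hp)"
      by (intro tendsto_norm isCont_tendsto_within)
    moreover have "\<forall>\<^sub>F w in at z within upper_hp. norm (f w) \<le> B"
      using eventually_nhds_in_open[OF S z] unfolding eventually_at_filter
      by eventually_elim (use bd in auto)
    moreover have "at z within upper_hp \<noteq> bot" using real_at_within_upper_hp_neq_bot[of "Re z"] unfolding zr .
    ultimately show ?thesis using tendsto_upperbound by blast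
  qed
qed

lemma deriv_real_on_reals:
  assumes "K holomorphic_on S" "open S" "of_real x \<in> S" "\<And>y. of_real y \<in> S \<Longrightarrow> K (of_real y) \<in> \<real>"
  shows "deriv K (of_real x) \<in> \<real>"
proof -
  have "(K has_field_derivative deriv K (of_real x)) (at (of_real x))"
    using assms holomorphic_derivI by blast
  then have "((\<lambda>h. (K (of_real x + h) - K (of_real x)) / h) \<longlongrightarrow> deriv K (of_real x)) (at 0)"
    by (simp add: DERIV_def)
  moreover have "filterlim (of_real :: real \<Rightarrow> complex) (at 0) (at 0)"
  proof (rule filterlim_atI)
    show "((of_real :: real \<Rightarrow> complex) \<longlongrightarrow> 0) (at 0)"
      using tendsto_of_real[OF tendsto_ident_at, of 0 UNIV] by simp
  qed (auto simp: eventually_at_filter)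
  ultimately have lim: "((\<lambda>h::real. (K (of_real x + of_real h) - K (of_real x)) / of_real h) \<longlongrightarrow> deriv K (of_real x)) (at 0)"
    by (rule filterlim_compose)
  have "\<forall>\<^sub>F h::real in at 0. of_real (x + h) \<in> S"
  proof -
    have "((\<lambda>h. of_real (x + h) :: complex) \<longlongrightarrow> of_real (x + 0)) (at (0::real))"
      by (intro tendsto_intros)
    then show ?thesis using assms(2,3) topological_tendstoD by fastforce
  qed
  then have "\<forall>\<^sub>F h::real in at 0. (K (of_real x + of_real h) - K (of_real x)) / of_real h \<in> \<real>"
  proof eventually_elim
    case (elim h)
    then have "K (of_real x + of_real h) \<in> \<real>" using assms(4)[of "x+h"] by simp
    then show ?case using assms(3,4) by auto
  qed
  then show ?thesis
    by (rule Lim_in_closed_set[OF closed_complex_Reals _ _ lim]) auto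
qed

text \<open>
  The reflection principle for a bounded function of which only the imaginary part is known to have
  boundary values, namely \<open>0\<close>. A primitive is Lipschitz, so it does extend continuously to the real axis; its
  imaginary part is constant there, so the classical principle applies to the primitive, and
  differentiating gives the continuation of \<open>k\<close>.
\<close>

lemma schwarz_reflection_bounded:
  fixes x0 r B :: real
  defines "S \<equiv> ball (of_real x0 :: complex) r"
  assumes hol: "k holomorphic_on S \<inter> upper_hp"
    and bd: "\<And>z. z \<in> S \<inter> upper_hp \<Longrightarrow> norm (k z) \<le> B"
    and lim: "\<And>x. of_real x \<in> S \<Longrightarrow> ((\<lambda>z. Im (k z)) \<longlongrightarrow> 0) (at (of_real x) within upper_hp)"
  obtains K where "K holomorphic_on S" "\<And>z. z \<in> S \<inter> upper_hp \<Longrightarrow> K z = k z"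
    "\<And>x. of_real x \<in> S \<Longrightarrow> K (of_real x) \<in> \<real>" "\<And>z. z \<in> S \<Longrightarrow> norm (K z) \<le> B"
proof (cases "r > 0")
  case False
  then have "S = {}" by (simp add: S_def)
  then show ?thesis using that[of k] hol by simp
next
  case r: True
  define T where "T = S \<inter> upper_hp"
  have oT: "open T" "convex T" and oS: "open S"
    by (auto simp: T_def S_def open_Int open_upper_hp convex_Int convex_upper_hp)
  obtain A where A: "\<And>z. z \<in> T \<Longrightarrow> (A has_field_derivative k z) (at z)"
  proof -
    obtain A where "\<And>z. z \<in> T \<Longrightarrow> (A has_field_derivative k z) (at z within T)"
      using holomorphic_convex_primitive'[OF oT(2) oT(1)] hol T_def by blast
    then show ?thesis using that oT(1) at_within_open by metis
  qed
  have lip: "norm (A x - A y) \<le> B * norm (x - y)" if "x \<in> T" "y \<in> T" for x y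
    using field_differentiable_bound[of T A k B x y] oT(2) that A bd has_field_derivative_at_within
    unfolding T_def by blast
  have Bnn: "B \<ge> 0"
  proof -
    have "of_real x0 + of_real (r/2) * \<i> \<in> T"
      using upper_point_in_ball[OF r] by (simp add: T_def S_def)
    then show ?thesis using bd T_def norm_ge_zero order_trans by blast
  qed
  have uc: "uniformly_continuous_on T A"
    unfolding uniformly_continuous_on_def
  proof (intro allI impI)
    fix e :: real assume "e > 0"
    then have "dist (A x') (A x) < e" if "x \<in> T" "x' \<in> T" "dist x' x < e / (B + 1)" for x x'
    proof -
      have "dist (A x') (A x) \<le> B * dist x' x" using lip[OF that(2,1)] by (simp add: dist_norm)
      also have "\<dots> \<le> (B + 1) * dist x' x" by (simp add: mult_right_mono)
      also have "\<dots> < e" using that(3) Bnn by (simp add: field_simps)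
      finally show ?thesis .
    qed
    then show "\<exists>d>0. \<forall>x\<in>T. \<forall>x'\<in>T. dist x' x < d \<longrightarrow> dist (A x') (A x) < e"
      using \<open>e > 0\<close> Bnn by (intro exI[of _ "e/(B+1)"]) auto
  qed
  obtain A' where A': "uniformly_continuous_on (closure T) A'" "\<And>x. x \<in> T \<Longrightarrow> A x = A' x"
    by (rule uniformly_continuous_on_extension_on_closure[OF uc]) (rule that; assumption)
  have contA': "continuous_on (closure T) A'" using A'(1) uniformly_continuous_imp_continuous by blast
  have shift_T: "\<forall>\<^sub>F e in at_right 0. of_real y + of_real e * \<i> \<in> T" if "of_real y \<in> S" for y
  proof -
    have "((\<lambda>e. of_real y + of_real e * \<i>) \<longlongrightarrow> of_real y + of_real 0 * \<i>) (at_right (0::real))"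
      by (intro tendsto_intros)
    then have "\<forall>\<^sub>F e in at_right (0::real). of_real y + of_real e * \<i> \<in> S"
      using oS that topological_tendstoD by fastforce
    moreover have "\<forall>\<^sub>F e in at_right (0::real). e > 0" by (simp add: eventually_at_filter)
    ultimately show ?thesis by eventually_elim (auto simp: T_def upper_hp_def)
  qed
  have shift_lim: "((\<lambda>e. of_real y + of_real e * \<i>) \<longlongrightarrow> of_real y) (at_right (0::real))" for y
  proof -
    have "((\<lambda>e. of_real y + of_real e * \<i>) \<longlongrightarrow> of_real y + of_real 0 * \<i>) (at_right (0::real))"
      by (intro tendsto_intros)
    then show ?thesis by simp
  qed
  have clT: "of_real y \<in> closure T" if "of_real y \<in> S" for y
  proof (rule Lim_in_closed_set[OF closed_closure _ _ shift_lim])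
    show "\<forall>\<^sub>F e in at_right 0. of_real y + of_real e * \<i> \<in> closure T"
      using shift_T[OF that] by eventually_elim (use closure_subset in blast)
  qed auto
  have A'lim: "((\<lambda>e. A (of_real y + of_real e * \<i>)) \<longlongrightarrow> A' (of_real y)) (at_right 0)" if "of_real y \<in> S" for y
  proof -
    have "((\<lambda>e. A' (of_real y + of_real e * \<i>)) \<longlongrightarrow> A' (of_real y)) (at_right 0)"
    proof (rule continuous_on_tendsto_compose[OF contA' shift_lim clT[OF that]])
      show "\<forall>\<^sub>F e in at_right 0. of_real y + of_real e * \<i> \<in> closure T"
        using shift_T[OF that] by eventually_elim (use closure_subset in blast)
    qed
    then show ?thesis
    proof (rule Lim_transform_eventually)
      show "\<forall>\<^sub>F e in at_right 0. A' (of_real y + of_real e * \<i>) = A (of_real y + of_real e * \<i>)"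
        using shift_T[OF that] by eventually_elim (simp add: A'(2))
    qed
  qed
  let ?I = "{x. of_real x \<in> S}"
  have I: "?I = ball x0 r" by (auto simp: S_def dist_norm simp flip: of_real_diff)
  define d where "d x = Im (A' (of_real x))" for x :: real
  \<comment> \<open>Near a boundary point the imaginary part of \<open>k\<close> is at most \<open>e\<close>, so the increments of \<open>Im A\<close> on horizontal segments close to the axis are at most \<open>e\<close> times their length.\<close>
  have der0: "(d has_field_derivative 0) (at x within ?I)" if "x \<in> ?I" for x
  proof -
    have "\<exists>\<delta>>0. \<forall>y\<in>?I. \<bar>y - x\<bar> < \<delta> \<longrightarrow> \<bar>d y - d x\<bar> \<le> e * \<bar>y - x\<bar>" if e: "e > 0" for e
    proof -
      have "\<forall>\<^sub>F z in at (of_real x) within upper_hp. \<bar>Im (k z)\<bar> < e"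
        using tendstoD[OF lim, of x e] \<open>x \<in> ?I\<close> e by simp
      then obtain \<delta> where \<delta>: "\<delta> > 0" "\<And>z. z \<in> upper_hp \<Longrightarrow> dist z (of_real x) < \<delta> \<Longrightarrow> \<bar>Im (k z)\<bar> < e"
        unfolding eventually_at by (metis (no_types) Im_complex_of_real less_irrefl mem_Collect_eq upper_hp_def)
      have "\<bar>d y - d x\<bar> \<le> e * \<bar>y - x\<bar>" if y: "y \<in> ?I" "\<bar>y - x\<bar> < \<delta>" for y
      proof -
        have "\<forall>\<^sub>F \<epsilon> in at_right 0. dist (of_real y + of_real \<epsilon> * \<i>) (of_real x) < \<delta>"
        proof -
          have "((\<lambda>\<epsilon>. dist (of_real y + of_real \<epsilon> * \<i>) (of_real x::complex)) \<longlongrightarrow> dist (of_real y) (of_real x :: complex)) (at_right 0)"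
            by (intro tendsto_dist shift_lim tendsto_const)
          then show ?thesis
            using order_tendstoD(2) y(2) by (metis dist_of_real dist_real_def)
        qed
        moreover have "\<forall>\<^sub>F \<epsilon> in at_right 0. dist (of_real x + of_real \<epsilon> * \<i>) (of_real x) < \<delta>"
          using tendstoD[OF shift_lim \<delta>(1)] .
        moreover have "\<forall>\<^sub>F \<epsilon> in at_right 0. of_real x + of_real \<epsilon> * \<i> \<in> T"
          using shift_T \<open>x \<in> ?I\<close> by simp
        moreover have "\<forall>\<^sub>F \<epsilon> in at_right 0. of_real y + of_real \<epsilon> * \<i> \<in> T"
          using shift_T y(1) by simp
        ultimately have ev: "\<forall>\<^sub>F \<epsilon> in at_right 0. \<bar>Im (A (of_real y + of_real \<epsilon> * \<i>)) - Im (A (of_real x + of_real \<epsilon> * \<i>))\<bar> \<le> e * \<bar>y - x\<bar>"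
        proof eventually_elim
          case (elim \<epsilon>)
          let ?a = "of_real x + of_real \<epsilon> * \<i>" and ?b = "of_real y + of_real \<epsilon> * \<i>"
          let ?W = "T \<inter> ball (of_real x) \<delta>"
          have ab: "?a \<in> ?W" "?b \<in> ?W" using elim by (auto simp: dist_commute)
          have cW: "convex ?W" by (intro convex_Int oT convex_ball)
          let ?\<phi> = "\<lambda>s::real. Im (A (of_real s + of_real \<epsilon> * \<i>))"
          have seg: "of_real s + of_real \<epsilon> * \<i> \<in> ?W" if s: "s \<in> closed_segment x y" for s
          proof -
            obtain u where u: "0 \<le> u" "u \<le> 1" "s = (1 - u) * x + u * y"
              using s unfolding closed_segment_def by auto
            have "of_real s + of_real \<epsilon> * \<i> = (1 - u) *\<^sub>R ?a + u *\<^sub>R ?b"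
              by (simp add: u(3) scaleR_conv_of_real algebra_simps)
            also have "\<dots> \<in> ?W" by (rule convexD_alt[OF cW ab u(1,2)])
            finally show ?thesis .
          qed
          have "norm (?\<phi> y - ?\<phi> x) \<le> e * norm (y - x)"
          proof (rule field_differentiable_bound[where S = "closed_segment x y" and f' = "\<lambda>s. Im (k (of_real s + of_real \<epsilon> * \<i>))"])
            fix s assume s: "s \<in> closed_segment x y"
            have "(A has_field_derivative k (of_real s + of_real \<epsilon> * \<i>)) (at (of_real s + of_real \<epsilon> * \<i>))"
              using A seg[OF s] by blast
            moreover have "((\<lambda>s. of_real s + of_real \<epsilon> * \<i>) has_vector_derivative 1) (at s)"
              by (auto intro!: derivative_eq_intros simp: has_vector_derivative_def scaleR_conv_of_real)
            ultimately have "((\<lambda>s. A (of_real s + of_real \<epsilon> * \<i>)) has_vector_derivative k (of_real s + of_real \<epsilon> * \<i>)) (at s)"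
              using field_vector_diff_chain_at[of "\<lambda>s. of_real s + of_real \<epsilon> * \<i>" 1 s A]
              by (simp add: o_def)
            then have "(?\<phi> has_vector_derivative Im (k (of_real s + of_real \<epsilon> * \<i>))) (at s)"
              using bounded_linear.has_vector_derivative[OF bounded_linear_Im] by blast
            then show "(?\<phi> has_field_derivative Im (k (of_real s + of_real \<epsilon> * \<i>))) (at s within closed_segment x y)"
              using has_real_derivative_iff_has_vector_derivative has_field_derivative_at_within by blast
            have "of_real s + of_real \<epsilon> * \<i> \<in> upper_hp" "dist (of_real s + of_real \<epsilon> * \<i>) (of_real x) < \<delta>"
              using seg[OF s] by (auto simp: T_def dist_commute)
            from \<delta>(2)[OF this] show "norm (Im (k (of_real s + of_real \<epsilon> * \<i>))) \<le> e" by simp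
          qed auto
          then show ?case by simp
        qed
        have "((\<lambda>\<epsilon>. \<bar>Im (A (of_real y + of_real \<epsilon> * \<i>)) - Im (A (of_real x + of_real \<epsilon> * \<i>))\<bar>) \<longlongrightarrow> \<bar>d y - d x\<bar>) (at_right 0)"
          unfolding d_def using A'lim[of x] A'lim[of y] \<open>x \<in> ?I\<close> y(1) by (intro tendsto_intros) auto
        from tendsto_upperbound[OF this ev] show ?thesis by simp
      qed
      then show ?thesis using \<delta>(1) by blast
    qed
    then show ?thesis
      unfolding has_field_derivative_def has_derivative_within_alt by (simp add: bounded_linear_mult_right)
  qed
  have "\<exists>c. \<forall>x\<in>?I. d x = c"
    using has_field_derivative_zero_constant[of ?I d] der0 unfolding I by auto
  then obtain c where c: "\<And>x. of_real x \<in> S \<Longrightarrow> Im (A' (of_real x)) = c"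
    unfolding d_def by blast
  define f where "f z = A' z - of_real c * \<i>" for z
  let ?F = "\<lambda>z. if 0 \<le> Im z then f z else cnj (f (cnj z))"
  have sub: "S \<inter> {z. 0 \<le> Im z} \<subseteq> closure T"
  proof
    fix z assume z: "z \<in> S \<inter> {z. 0 \<le> Im z}"
    show "z \<in> closure T"
    proof (cases "Im z = 0")
      case True
      then have "z = of_real (Re z)" by (simp add: complex_eq_iff)
      then show ?thesis using clT z by (metis IntD1)
    next
      case False
      then show ?thesis using z closure_subset[of T] by (auto simp: T_def upper_hp_def)
    qed
  qed
  have F: "?F holomorphic_on S"
  proof (rule Schwarz_reflection)
    show "cnj ` S \<subseteq> S" unfolding S_def using cnj_in_real_ball by blast
    have "A' holomorphic_on T"
      by (rule holomorphic_transform[of A]) (use A A'(2) holomorphic_on_open oT(1) in blast)+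
    then show "f holomorphic_on S \<inter> {z. 0 < Im z}"
      unfolding f_def T_def upper_hp_def by (intro holomorphic_intros)
    show "continuous_on (S \<inter> {z. 0 \<le> Im z}) f"
      unfolding f_def by (intro continuous_intros continuous_on_subset[OF contA' sub])
    show "f z \<in> \<real>" if "z \<in> S" "z \<in> \<real>" for z
    proof -
      from that(2) obtain x where "z = of_real x" by (rule Reals_cases)
      then show ?thesis using c[of x] that(1) by (simp add: f_def complex_is_Real_iff)
    qed
  qed (use oS in auto)
  have Fr: "?F (of_real x) \<in> \<real>" if "of_real x \<in> S" for x
    using c[OF that] by (simp add: f_def complex_is_Real_iff)
  define K where "K = deriv ?F"
  have Khol: "K holomorphic_on S" unfolding K_def using F oS by (rule holomorphic_deriv)
  have Kk: "K z = k z" if "z \<in> S \<inter> upper_hp" for z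
  proof -
    have "((\<lambda>z. A z - of_real c * \<i>) has_field_derivative k z) (at z)"
      using A[of z] that by (auto intro!: derivative_eq_intros simp: T_def)
    moreover have "\<forall>\<^sub>F w in nhds z. A w - of_real c * \<i> = ?F w"
      using eventually_nhds_in_open[OF oT(1), of z] that
      by (auto simp: T_def f_def A'(2) upper_hp_def elim!: eventually_mono)
    ultimately have "(?F has_field_derivative k z) (at z)"
      by (subst DERIV_cong_ev[OF refl _ refl, symmetric])
    then show ?thesis unfolding K_def by (rule DERIV_imp_deriv)
  qed
  have Kr: "K (of_real x) \<in> \<real>" if "of_real x \<in> S" for x
    unfolding K_def by (rule deriv_real_on_reals[OF F oS that Fr])
  have Kb: "norm (K z) \<le> B" if "z \<in> S" for z
  proof (rule norm_bound_by_reflection[OF oS holomorphic_on_imp_continuous_on[OF Khol] _ _ that])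
    show "cnj z \<in> S \<and> norm (K (cnj z)) = norm (K z)" if z: "z \<in> S" for z
    proof -
      have "K (cnj z) = cnj (K z)"
        using holomorphic_real_on_reals_symmetric[of K x0 r z] Khol Kr z unfolding S_def by blast
      then show ?thesis using cnj_in_real_ball z unfolding S_def by simp
    qed
    show "norm (K z) \<le> B" if "z \<in> S \<inter> upper_hp" for z using bd[OF that] Kk[OF that] by simp
  qed
  show ?thesis by (rule that[OF Khol Kk Kr Kb])
qed

text \<open>
  If the real part of \<open>F\<close> is bounded and vanishes on the real axis, then \<open>F'\<close> continues across it. The
  imaginary part of \<open>F\<close> need not be bounded, so the previous principle does not apply to \<open>F\<close> itself.
  But \<open>cosh (F/C)\<close> and \<open>\<i> sinh (F/C)\<close> are bounded, and their imaginary parts tend to \<open>0\<close> with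
  \<open>sinh (Re F/C)\<close>; and \<open>F'\<close> is \<open>C\<close> times the logarithmic derivative of \<open>exp (F/C)\<close>, the sum of
  \<open>cosh\<close> and \<open>sinh\<close>. The Cauchy estimate for the two continued functions bounds the continuation of
  \<open>F'\<close>; it is what controls \<open>F'\<close> uniformly up to the boundary.
\<close>

lemma imaginary_reflection:
  fixes x0 r C :: real
  defines "S \<equiv> ball (of_real x0 :: complex) r"
  assumes F: "\<And>z. z \<in> S \<inter> upper_hp \<Longrightarrow> (F has_field_derivative f z) (at z)"
    and C: "C > 0" and bd: "\<And>z. z \<in> S \<inter> upper_hp \<Longrightarrow> \<bar>Re (F z)\<bar> \<le> C"
    and lim: "\<And>x. of_real x \<in> S \<Longrightarrow> ((\<lambda>z. Re (F z)) \<longlongrightarrow> 0) (at (of_real x) within upper_hp)"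
  obtains f' where "f' holomorphic_on S" "\<And>z. z \<in> S \<inter> upper_hp \<Longrightarrow> f' z = f z"
    "\<And>x. of_real x \<in> S \<Longrightarrow> Re (f' (of_real x)) = 0"
    "\<And>w \<rho>. \<rho> > 0 \<Longrightarrow> cball w \<rho> \<subseteq> S \<Longrightarrow> norm (f' w) \<le> 36 * C / \<rho>"
proof -
  define u where "u z = F z / of_real C" for z
  \<comment> \<open>\<open>cosh u\<close> and \<open>\<i> sinh u\<close>; the factor \<open>\<i>\<close> makes both real where \<open>Re u = 0\<close>.\<close>
  define k1 k2 where "k1 z = (exp (u z) + exp (- u z)) / 2"
    and "k2 z = \<i> * (exp (u z) - exp (- u z)) / 2" for z
  define \<eta> where "\<eta> z = \<bar>exp (Re (u z)) - exp (- Re (u z))\<bar>" for z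
  have oT: "open (S \<inter> upper_hp)" and oS: "open S" by (auto simp: S_def open_upper_hp)
  have "F holomorphic_on S \<inter> upper_hp"
    using F oT holomorphic_on_open by blast
  then have hu: "u holomorphic_on S \<inter> upper_hp"
    unfolding u_def by (intro holomorphic_intros) (use C in auto)
  have hk: "k1 holomorphic_on S \<inter> upper_hp" "k2 holomorphic_on S \<inter> upper_hp"
    unfolding k1_def k2_def using hu by (auto intro!: holomorphic_intros)
  have ex3: "norm (exp (u z)) \<le> 3" "norm (exp (- u z)) \<le> 3" if "z \<in> S \<inter> upper_hp" for z
  proof -
    have "\<bar>Re (u z)\<bar> \<le> 1" using bd[OF that] C by (simp add: u_def Re_divide_of_real)
    then have "exp (Re (u z)) \<le> exp 1" "exp (- Re (u z)) \<le> exp 1" by auto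
    then have "exp (Re (u z)) \<le> 3" "exp (- Re (u z)) \<le> 3" using exp_le by linarith+
    then show "norm (exp (u z)) \<le> 3" "norm (exp (- u z)) \<le> 3" by auto
  qed
  have kb: "norm (k1 z) \<le> 3" "norm (k2 z) \<le> 3" if "z \<in> S \<inter> upper_hp" for z
  proof -
    have "norm (exp (u z) + exp (- u z)) \<le> 6" "norm (exp (u z) - exp (- u z)) \<le> 6"
      using norm_triangle_ineq[of "exp (u z)" "exp (- u z)"] norm_triangle_ineq4[of "exp (u z)" "exp (- u z)"]
        ex3[OF that] by linarith+
    then show "norm (k1 z) \<le> 3" "norm (k2 z) \<le> 3"
      by (auto simp: k1_def k2_def norm_divide norm_mult)
  qed
  have Imk: "\<bar>Im (k1 z)\<bar> \<le> \<eta> z" "\<bar>Im (k2 z)\<bar> \<le> \<eta> z" for z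
  proof -
    have "Im (k1 z) * 2 = (exp (Re (u z)) - exp (- Re (u z))) * sin (Im (u z))"
      "Im (k2 z) * 2 = (exp (Re (u z)) - exp (- Re (u z))) * cos (Im (u z))"
      by (simp_all add: k1_def k2_def Im_exp Re_exp field_simps)
    then have "\<bar>Im (k1 z) * 2\<bar> \<le> \<eta> z" "\<bar>Im (k2 z) * 2\<bar> \<le> \<eta> z"
      unfolding \<eta>_def by (simp_all only: abs_mult mult_left_le[OF abs_sin_le_one abs_ge_zero]
          mult_left_le[OF abs_cos_le_one abs_ge_zero])
    then show "\<bar>Im (k1 z)\<bar> \<le> \<eta> z" "\<bar>Im (k2 z)\<bar> \<le> \<eta> z" by linarith+
  qed
  have \<eta>lim: "(\<eta> \<longlongrightarrow> 0) (at (of_real x) within upper_hp)" if "of_real x \<in> S" for x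
  proof -
    have "((\<lambda>z. Re (u z)) \<longlongrightarrow> 0 / C) (at (of_real x) within upper_hp)"
      unfolding u_def Re_divide_of_real using lim[OF that] C by (intro tendsto_intros) auto
    then have "(\<eta> \<longlongrightarrow> \<bar>exp (0/C) - exp (- (0/C))\<bar>) (at (of_real x) within upper_hp)"
      unfolding \<eta>_def by (intro tendsto_intros)
    then show ?thesis by simp
  qed
  have klim: "((\<lambda>z. Im (k1 z)) \<longlongrightarrow> 0) (at (of_real x) within upper_hp)"
    "((\<lambda>z. Im (k2 z)) \<longlongrightarrow> 0) (at (of_real x) within upper_hp)" if "of_real x \<in> S" for x
    by (rule Lim_null_comparison[OF _ \<eta>lim[OF that]]; use Imk in simp)+
  obtain K1 where K1: "K1 holomorphic_on S" "\<And>z. z \<in> S \<inter> upper_hp \<Longrightarrow> K1 z = k1 z"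
    "\<And>x. of_real x \<in> S \<Longrightarrow> K1 (of_real x) \<in> \<real>" "\<And>z. z \<in> S \<Longrightarrow> norm (K1 z) \<le> 3"
    using schwarz_reflection_bounded[of k1 x0 r 3] hk(1) kb(1) klim(1) unfolding S_def by blast
  obtain K2 where K2: "K2 holomorphic_on S" "\<And>z. z \<in> S \<inter> upper_hp \<Longrightarrow> K2 z = k2 z"
    "\<And>x. of_real x \<in> S \<Longrightarrow> K2 (of_real x) \<in> \<real>" "\<And>z. z \<in> S \<Longrightarrow> norm (K2 z) \<le> 3"
    using schwarz_reflection_bounded[of k2 x0 r 3] hk(2) kb(2) klim(2) unfolding S_def by blast
  define f' where "f' z = of_real C * ((deriv K1 z - \<i> * deriv K2 z) * (K1 z + \<i> * K2 z))" for z
  have dK: "(K1 has_field_derivative deriv K1 z) (at z)" "(K2 has_field_derivative deriv K2 z) (at z)"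
    if "z \<in> S" for z
    using K1(1) K2(1) oS that holomorphic_derivI by blast+
  have hol: "f' holomorphic_on S"
    unfolding f'_def by (intro holomorphic_intros holomorphic_deriv K1 K2 oS)
  have eq: "f' z = f z" if z: "z \<in> S \<inter> upper_hp" for z
  proof -
    have "((\<lambda>w. K1 w - \<i> * K2 w) has_field_derivative deriv K1 z - \<i> * deriv K2 z) (at z)"
      using dK[of z] z by (auto intro!: derivative_eq_intros)
    moreover have "((\<lambda>w. exp (u w)) has_field_derivative exp (u z) * (f z / of_real C)) (at z)"
      unfolding u_def using F[OF z] C by (auto intro!: derivative_eq_intros)
    moreover have "\<forall>\<^sub>F w in nhds z. K1 w - \<i> * K2 w = exp (u w)"
      using eventually_nhds_in_open[OF oT z]
      by eventually_elim (auto simp: K1(2) K2(2) k1_def k2_def field_simps)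
    ultimately have e1: "deriv K1 z - \<i> * deriv K2 z = exp (u z) * (f z / of_real C)"
      by (metis DERIV_cong_ev DERIV_unique)
    have e2: "K1 z + \<i> * K2 z = exp (- u z)"
      using z by (auto simp: K1(2) K2(2) k1_def k2_def field_simps)
    have "f' z = of_real C * (f z / of_real C) * (exp (u z) * exp (- u z))"
      unfolding f'_def e1 e2 by (simp only: mult_ac)
    then show ?thesis using C by (simp add: exp_minus)
  qed
  have re: "Re (f' (of_real x)) = 0" if x: "of_real x \<in> S" for x
  proof -
    have r: "r > 0" using x unfolding S_def by (metis ball_empty empty_iff not_le)
    \<comment> \<open>This is \<open>cosh\<^sup>2 - sinh\<^sup>2 = 1\<close>, continued; its derivative on the real axis kills the real part of \<open>f'\<close>.\<close>
    have one: "K1 z ^ 2 + K2 z ^ 2 = 1" if "z \<in> S" for z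
    proof (rule analytic_continuation_open[where s = "S \<inter> upper_hp" and s' = S and f = "\<lambda>z. K1 z ^ 2 + K2 z ^ 2" and g = "\<lambda>_. 1"])
      show "S \<inter> upper_hp \<noteq> {}" unfolding S_def using upper_point_in_ball[OF r] by blast
      show "K1 z ^ 2 + K2 z ^ 2 = 1" if "z \<in> S \<inter> upper_hp" for z
      proof -
        have "exp (u z) * exp (- u z) = 1" by (simp flip: exp_add)
        then show ?thesis
          by (simp add: K1(2)[OF that] K2(2)[OF that] k1_def k2_def power2_eq_square field_simps)
      qed
      show "connected S" by (simp add: S_def)
    qed (use oT oS that K1(1) K2(1) in \<open>auto intro!: holomorphic_intros\<close>)
    have "((\<lambda>z. K1 z ^ 2 + K2 z ^ 2) has_field_derivative
        2 * (K1 (of_real x) * deriv K1 (of_real x)) + 2 * (K2 (of_real x) * deriv K2 (of_real x))) (at (of_real x))"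
      using dK[OF x] by (auto intro!: derivative_eq_intros)
    moreover have "((\<lambda>z. K1 z ^ 2 + K2 z ^ 2) has_field_derivative 0) (at (of_real x))"
      using eventually_nhds_in_open[OF oS x] one
      by (subst DERIV_cong_ev[of _ _ _ "\<lambda>_. 1"]) (auto elim!: eventually_mono)
    ultimately have "2 * (K1 (of_real x) * deriv K1 (of_real x)) + 2 * (K2 (of_real x) * deriv K2 (of_real x)) = 0"
      by (rule DERIV_unique)
    then have "K1 (of_real x) * deriv K1 (of_real x) + K2 (of_real x) * deriv K2 (of_real x) = 0"
      by (metis distrib_left mult_eq_0_iff zero_neq_numeral)
    moreover have "deriv K1 (of_real x) \<in> \<real>" "deriv K2 (of_real x) \<in> \<real>"
      by (rule deriv_real_on_reals[OF K1(1) oS x K1(3)] deriv_real_on_reals[OF K2(1) oS x K2(3)]; assumption)+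
    moreover have "f' (of_real x) = of_real C * (K1 (of_real x) * deriv K1 (of_real x) + K2 (of_real x) * deriv K2 (of_real x)
       + \<i> * (deriv K1 (of_real x) * K2 (of_real x) - deriv K2 (of_real x) * K1 (of_real x)))"
      by (simp add: f'_def algebra_simps)
    ultimately show ?thesis
      using K1(3)[OF x] K2(3)[OF x] by (simp add: complex_is_Real_iff)
  qed
  have bound: "norm (f' w) \<le> 36 * C / \<rho>" if \<rho>: "\<rho> > 0" "cball w \<rho> \<subseteq> S" for w \<rho>
  proof -
    have dk: "norm (deriv K w) \<le> 3 / \<rho>" if "K holomorphic_on S" "\<And>z. z \<in> S \<Longrightarrow> norm (K z) \<le> 3" for K
    proof -
      have "norm ((deriv ^^ 1) K w) \<le> fact 1 * 3 / \<rho> ^ 1"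
      proof (rule Cauchy_inequality)
        show "K holomorphic_on ball w \<rho>"
          using that(1) by (rule holomorphic_on_subset) (use \<rho>(2) ball_subset_cball in blast)
        show "continuous_on (cball w \<rho>) K"
          using holomorphic_on_imp_continuous_on[OF that(1)] \<rho>(2) by (rule continuous_on_subset)
        show "norm (K x) \<le> 3" if "norm (w - x) = \<rho>" for x
          using that \<rho> \<open>\<And>z. z \<in> S \<Longrightarrow> norm (K z) \<le> 3\<close>[of x] by (auto simp: dist_norm)
      qed fact
      then show ?thesis by simp
    qed
    have wS: "w \<in> S" using \<rho> by auto
    have "norm (deriv K1 w - \<i> * deriv K2 w) \<le> 6 / \<rho>"
      using norm_triangle_ineq4[of "deriv K1 w" "\<i> * deriv K2 w"] dk[OF K1(1,4)] dk[OF K2(1,4)]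
      by (simp add: norm_mult)
    moreover have "norm (K1 w + \<i> * K2 w) \<le> 6"
      using norm_triangle_ineq[of "K1 w" "\<i> * K2 w"] K1(4)[OF wS] K2(4)[OF wS] by (simp add: norm_mult)
    ultimately have "norm (deriv K1 w - \<i> * deriv K2 w) * norm (K1 w + \<i> * K2 w) \<le> 6 / \<rho> * 6"
      using \<rho> by (intro mult_mono) auto
    then have "C * (norm (deriv K1 w - \<i> * deriv K2 w) * norm (K1 w + \<i> * K2 w)) \<le> C * (6 / \<rho> * 6)"
      using C by (intro mult_left_mono) auto
    then show ?thesis using C by (simp add: f'_def norm_mult mult_ac)
  qed
  show ?thesis by (rule that[OF hol eq re bound])
qed

text \<open>
  The interior counterpart of the bound in \<open>imaginary_reflection\<close>, by the Cauchy estimate for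
  \<open>exp (F/C)\<close>, whose modulus lies between \<open>1/e\<close> and \<open>e\<close>.
\<close>

lemma deriv_bound_of_bounded_real_part:
  assumes F: "\<And>z. z \<in> cball w \<rho> \<Longrightarrow> (F has_field_derivative f z) (at z)"
    and "\<rho> > 0" "C > 0" and bd: "\<And>z. z \<in> cball w \<rho> \<Longrightarrow> \<bar>Re (F z)\<bar> \<le> C"
  shows "norm (f w) \<le> 9 * C / \<rho>"
proof -
  define g where "g z = exp (F z / of_real C)" for z
  have dg: "(g has_field_derivative g z * (f z / of_real C)) (at z)" if "z \<in> cball w \<rho>" for z
    unfolding g_def using F[OF that] \<open>C > 0\<close> by (auto intro!: derivative_eq_intros)
  have g3: "norm (g z) \<le> 3" "norm (1 / g z) \<le> 3" if "z \<in> cball w \<rho>" for z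
  proof -
    have "Re (F z / of_real C) \<le> 1" "- Re (F z / of_real C) \<le> 1"
      using bd[OF that] \<open>C > 0\<close> by (auto simp: Re_divide_of_real field_simps)
    then have "exp (Re (F z / of_real C)) \<le> exp 1" "exp (- Re (F z / of_real C)) \<le> exp 1" by auto
    then have "exp (Re (F z / of_real C)) \<le> 3" "exp (- Re (F z / of_real C)) \<le> 3"
      using exp_le by linarith+
    then show "norm (g z) \<le> 3" "norm (1 / g z) \<le> 3"
      by (auto simp: g_def simp flip: exp_minus inverse_eq_divide)
  qed
  have w: "w \<in> cball w \<rho>" using \<open>\<rho> > 0\<close> by simp
  have "norm ((deriv ^^ 1) g w) \<le> fact 1 * 3 / \<rho> ^ 1"
  proof (rule Cauchy_inequality)
    show "g holomorphic_on ball w \<rho>"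
      using dg ball_subset_cball by (subst holomorphic_on_open) blast+
    show "continuous_on (cball w \<rho>) g"
      using dg DERIV_isCont continuous_at_imp_continuous_on by blast
    show "norm (g x) \<le> 3" if "norm (w - x) = \<rho>" for x
      using g3(1)[of x] that by (auto simp: dist_norm)
  qed fact
  then have "norm (g w * (f w / of_real C)) \<le> 3 / \<rho>"
    using DERIV_imp_deriv[OF dg[OF w]] by simp
  then have "norm (1 / g w) * norm (g w * (f w / of_real C)) \<le> 3 * (3 / \<rho>)"
    using g3(2)[OF w] \<open>\<rho> > 0\<close> by (intro mult_mono) auto
  moreover have "norm (1 / g w) * norm (g w * (f w / of_real C)) = norm (f w) / C"
    using \<open>C > 0\<close> by (simp add: g_def norm_mult norm_divide)
  ultimately have "norm (f w) / C \<le> 3 * (3 / \<rho>)" by simp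
  then show ?thesis using \<open>C > 0\<close> by (simp add: pos_divide_le_eq mult.commute)
qed

section \<open>Orthonormal frames and the Weierstrass forms\<close>

lemma orthonormal_frame_exists:
  assumes "norm (d :: real^3) = 1" "norm b = 1" "b \<bullet> d = 0"
  shows "orthonormal_frame d b (cross3 d b)"
proof -
  have "(norm (cross3 d b))\<^sup>2 = 1\<^sup>2"
    using assms norm_cross_dot[of d b] by (simp add: inner_commute)
  then have "norm (cross3 d b) = 1" by (rule power2_eq_imp_eq) auto
  then show ?thesis
    using assms by (auto simp: orthonormal_frame_def dot_cross_self inner_commute)
qed

lemma orthonormal_frame_expand:
  assumes "orthonormal_frame a b c"
  shows "(v \<bullet> a) * (w \<bullet> a) + (v \<bullet> b) * (w \<bullet> b) + (v \<bullet> c) * (w \<bullet> c) = v \<bullet> w"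
proof -
  let ?B = "{a, b, c}"
  have o: "norm a = 1" "norm b = 1" "norm c = 1" "a \<bullet> b = 0" "a \<bullet> c = 0" "b \<bullet> c = 0"
    using assms by (auto simp: orthonormal_frame_def)
  then have ne: "a \<noteq> b" "a \<noteq> c" "b \<noteq> c" "a \<noteq> 0" "b \<noteq> 0" "c \<noteq> 0"
    by (metis inner_eq_zero_iff norm_zero zero_neq_one)+
  have po: "pairwise orthogonal ?B"
    using o by (auto simp: pairwise_def orthogonal_def inner_commute)
  have ind: "independent ?B"
    using pairwise_orthogonal_independent[OF po] ne by auto
  have "card ?B = 3" using ne by auto
  then have "span ?B = UNIV"
    using ind card_ge_dim_independent[of ?B UNIV] by (auto simp: dim_UNIV)
  then have "(\<Sum>i\<in>?B. (v \<bullet> i) *\<^sub>R i) = v"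
    by (intro orthonormal_basis_expand[OF po]) (use o in auto)
  then have "v = (v \<bullet> a) *\<^sub>R a + (v \<bullet> b) *\<^sub>R b + (v \<bullet> c) *\<^sub>R c"
    using ne by (simp add: inner_commute add.assoc)
  then have "v \<bullet> w = ((v \<bullet> a) *\<^sub>R a + (v \<bullet> b) *\<^sub>R b + (v \<bullet> c) *\<^sub>R c) \<bullet> w"
    by simp
  then show ?thesis by (simp add: inner_add_left inner_commute[of w])
qed

text \<open>
  The directions of two adjacent sides span, or lie in, a plane with orthonormal basis \<open>d, e\<close>; if they
  are collinear, any \<open>e\<close> orthogonal to \<open>d\<close> will do.
\<close>

lemma unit_vectors_in_frame:
  assumes "norm (d :: real^3) = 1" "norm d' = 1"
  obtains e \<beta> where "norm e = 1" "e \<bullet> d = 0" "d' = cos \<beta> *\<^sub>R d + sin \<beta> *\<^sub>R e"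
proof -
  define u where "u = d' - (d \<bullet> d') *\<^sub>R d"
  have ud: "u \<bullet> d = 0" using assms(1)
    by (simp add: u_def inner_diff_left norm_eq_1) (simp add: inner_commute)
  have nu: "(d \<bullet> d')\<^sup>2 + (norm u)\<^sup>2 = 1"
  proof -
    have "u \<bullet> u = u \<bullet> d'" using ud by (simp add: u_def inner_diff_right)
    also have "\<dots> = 1 - (d \<bullet> d')\<^sup>2"
      using assms(2) by (simp add: u_def inner_diff_left norm_eq_1 power2_eq_square)
    finally show ?thesis by (simp add: power2_norm_eq_inner)
  qed
  obtain e where e: "norm e = 1" "e \<bullet> d = 0" "u = norm u *\<^sub>R e"
  proof (cases "u = 0")
    case True
    obtain y where "y \<noteq> 0" "orthogonal d y"
      using orthogonal_to_vector_exists[of d] by auto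
    then show ?thesis using that[of "y /\<^sub>R norm y"] True by (auto simp: orthogonal_def inner_commute)
  next
    case False
    then show ?thesis using that[of "u /\<^sub>R norm u"] ud by auto
  qed
  obtain \<beta> where \<beta>: "d \<bullet> d' = cos \<beta>" "norm u = sin \<beta>"
    using sincos_total_2pi[OF nu] by metis
  have "d' = (d \<bullet> d') *\<^sub>R d + norm u *\<^sub>R e"
    unfolding e(3)[symmetric] by (simp add: u_def)
  then show ?thesis using that[OF e(1,2)] \<beta> by metis
qed

text \<open>
  \<open>weier_form G H v\<close> is the bilinear product of \<open>v\<close> with the vector
  \<open>(\<i>(G\<^sup>2 - H\<^sup>2), G\<^sup>2 + H\<^sup>2, 2\<i>GH)\<close> of the Weierstrass representation.
\<close>

definition weier_form :: "(complex \<Rightarrow> complex) \<Rightarrow> (complex \<Rightarrow> complex) \<Rightarrow> real^3 \<Rightarrow> complex \<Rightarrow> complex" where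
  "weier_form G H v z = of_real (v $ 1) * (\<i> * ((G z)\<^sup>2 - (H z)\<^sup>2)) +
     of_real (v $ 2) * ((G z)\<^sup>2 + (H z)\<^sup>2) + of_real (v $ 3) * (2 * \<i> * G z * H z)"

lemma weier_form_add: "weier_form G H (v + w) z = weier_form G H v z + weier_form G H w z"
  by (simp add: weier_form_def algebra_simps)

lemma weier_form_scaleR: "weier_form G H (c *\<^sub>R v) z = of_real c * weier_form G H v z"
  by (simp add: weier_form_def algebra_simps)

text \<open>
  The bilinear square of the Weierstrass vector is \<open>0\<close>, and it can be computed in any orthonormal
  frame because the frame satisfies the completeness relation \<open>orthonormal_frame_expand\<close>.
\<close>

lemma weier_form_frame:
  assumes "orthonormal_frame a b c"
  shows "(weier_form G H a z)\<^sup>2 + (weier_form G H b z)\<^sup>2 + (weier_form G H c z)\<^sup>2 = 0"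
proof -
  define g where "g j k = complex_of_real (a $ j * a $ k + b $ j * b $ k + c $ j * c $ k)" for j k
  define \<phi> where "\<phi> = (\<lambda>j::3. if j = 1 then \<i> * ((G z)\<^sup>2 - (H z)\<^sup>2) else if j = 2 then (G z)\<^sup>2 + (H z)\<^sup>2 else 2 * \<i> * G z * H z)"
  have ax: "a $ j * a $ k + b $ j * b $ k + c $ j * c $ k = (if j = k then 1 else 0)" for j k
    using orthonormal_frame_expand[OF assms, of "axis j 1" "axis k 1"]
    unfolding inner_axis' by (simp add: axis_def)
  have g: "g j k = (if j = k then 1 else 0)" for j k
    unfolding g_def ax by simp
  have "(weier_form G H a z)\<^sup>2 + (weier_form G H b z)\<^sup>2 + (weier_form G H c z)\<^sup>2 =
     g 1 1 * \<phi> 1 ^ 2 + g 2 2 * \<phi> 2 ^ 2 + g 3 3 * \<phi> 3 ^ 2 +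
     2 * g 1 2 * \<phi> 1 * \<phi> 2 + 2 * g 1 3 * \<phi> 1 * \<phi> 3 + 2 * g 2 3 * \<phi> 2 * \<phi> 3"
    unfolding g_def weier_form_def \<phi>_def by (simp add: power2_eq_square) algebra
  also have "\<dots> = \<phi> 1 ^ 2 + \<phi> 2 ^ 2 + \<phi> 3 ^ 2" by (simp add: g)
  also have "\<dots> = 0" 
    by (simp add: \<phi>_def power_mult_distrib) (simp add: power2_eq_square algebra_simps)
  finally show ?thesis .
qed

definition on_line :: "(complex \<Rightarrow> real^3) \<Rightarrow> real set \<Rightarrow> real^3 \<Rightarrow> bool" where
  "on_line X A d \<longleftrightarrow> (\<exists>p. \<forall>s\<in>A. \<exists>\<sigma>::real. X (of_real s) = p + \<sigma> *\<^sub>R d)"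

lemma on_line_subset: "on_line X A d \<Longrightarrow> B \<subseteq> A \<Longrightarrow> on_line X B d"
  unfolding on_line_def by (meson subsetD)

lemma on_line_inner_constant:
  assumes "on_line X A d" "v \<bullet> d = 0" "s \<in> A" "s' \<in> A"
  shows "X (of_real s) \<bullet> v = X (of_real s') \<bullet> v"
proof -
  obtain p where "\<forall>s\<in>A. \<exists>\<sigma>::real. X (of_real s) = p + \<sigma> *\<^sub>R d"
    using assms(1) on_line_def by blast
  then obtain \<sigma> \<sigma>' where "X (of_real s) = p + \<sigma> *\<^sub>R d" "X (of_real s') = p + \<sigma>' *\<^sub>R d"
    using assms(3,4) by meson
  then show ?thesis using assms(2) by (simp add: inner_add_left inner_commute[of d])
qed

text \<open>
  The limit exists although only \<open>g\<^sup>2\<close> is known to continue. Where \<open>g\<^sup>2\<close> tends to \<open>0\<close> so does \<open>g\<close>. Where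
  the limit is positive, \<open>g\<close> is \<open>\<plusminus>1\<close> times a holomorphic branch of the root, with a sign that is
  constant since half a disk is connected.
\<close>

lemma real_limit_of_square:
  fixes g R :: "complex \<Rightarrow> complex"
  assumes g: "g holomorphic_on upper_hp" and e: "e > 0"
    and R: "R holomorphic_on ball (of_real x) e" "\<And>z. z \<in> ball (of_real x) e \<inter> upper_hp \<Longrightarrow> (g z)\<^sup>2 = R z"
    and R0: "R (of_real x) = of_real \<rho>" "\<rho> \<ge> 0"
  shows "\<exists>L\<in>\<real>. (g \<longlongrightarrow> L) (at (of_real x) within upper_hp)"
proof -
  let ?B = "ball (of_real x :: complex) e"
  have cR: "isCont R (of_real x)"
    by (rule holomorphic_on_isCont[OF R(1)]) (use e in auto)
  have evB: "\<forall>\<^sub>F z in at (of_real x) within upper_hp. z \<in> ?B \<inter> upper_hp"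
    using e eventually_at_ball[of e "of_real x" upper_hp] by simp
  show ?thesis
  proof (cases "\<rho> = 0")
    case True
    have "(R \<longlongrightarrow> R (of_real x)) (at (of_real x) within upper_hp)"
      by (rule isCont_tendsto_within[OF cR])
    then have "((\<lambda>z. sqrt (norm (R z))) \<longlongrightarrow> sqrt (norm (R (of_real x)))) (at (of_real x) within upper_hp)"
      by (intro tendsto_intros)
    then have lim: "((\<lambda>z. sqrt (norm (R z))) \<longlongrightarrow> 0) (at (of_real x) within upper_hp)"
      using R0 True by simp
    have "\<forall>\<^sub>F z in at (of_real x) within upper_hp. norm (g z) \<le> sqrt (norm (R z))"
      using evB by eventually_elim (simp add: R(2)[symmetric] norm_power)
    from Lim_null_comparison[OF this lim] have "(g \<longlongrightarrow> 0) (at (of_real x) within upper_hp)" .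
    then show ?thesis by (intro bexI[of _ 0]) auto
  next
    case False
    then have \<rho>: "\<rho> > 0" using R0 by simp
    obtain \<delta> where \<delta>: "\<delta> > 0" "\<delta> \<le> e" "\<And>z. dist z (of_real x) < \<delta> \<Longrightarrow> norm (R z - of_real \<rho>) < \<rho>"
    proof -
      have "(R \<longlongrightarrow> R (of_real x)) (at (of_real x))" using cR by (rule isContD)
      then have "\<forall>\<^sub>F z in at (of_real x). dist (R z) (R (of_real x)) < \<rho>"
        using \<rho> by (rule tendstoD)
      then obtain \<delta> where "\<delta> > 0" "\<And>z. z \<noteq> of_real x \<Longrightarrow> dist z (of_real x) < \<delta> \<Longrightarrow> dist (R z) (R (of_real x)) < \<rho>"
        unfolding eventually_at by auto
      note \<delta> = this
      have "norm (R z - of_real \<rho>) < \<rho>" if "dist z (of_real x) < \<delta>" for z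
        using \<delta>(2)[OF _ that] \<rho> R0(1) by (cases "z = of_real x") (auto simp: dist_norm)
      with \<delta>(1)
      show ?thesis using e that[of "min \<delta> e"] by simp
    qed
    let ?W = "ball (of_real x) \<delta> \<inter> upper_hp"
    have nr: "R z \<notin> \<real>\<^sub>\<le>\<^sub>0" "R z \<noteq> 0" if "z \<in> ball (of_real x) \<delta>" for z
    proof -
      have "\<bar>Re (R z - of_real \<rho>)\<bar> < \<rho>"
        using \<delta>(3)[of z] that abs_Re_le_cmod[of "R z - of_real \<rho>"] by (simp add: dist_commute)
      then have "Re (R z) > 0" by auto
      then show "R z \<notin> \<real>\<^sub>\<le>\<^sub>0" "R z \<noteq> 0" by (auto simp: complex_nonpos_Reals_iff)
    qed
    have hs: "(\<lambda>z. csqrt (R z)) holomorphic_on ball (of_real x) \<delta>"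
      by (intro holomorphic_on_csqrt' holomorphic_on_subset[OF R(1)] subset_ball \<delta> nr)
    define q where "q z = g z / csqrt (R z)" for z
    have q2: "(q z)\<^sup>2 = 1" if "z \<in> ?W" for z
    proof -
      have "(g z)\<^sup>2 = R z" using that \<delta>(2) by (intro R(2)) auto
      then show ?thesis using nr(2)[of z] that by (simp add: q_def power_divide)
    qed
    have "q constant_on ?W"
    proof (rule continuous_finite_range_constant)
      show "connected ?W" by (intro convex_connected convex_Int convex_ball convex_upper_hp)
      show "continuous_on ?W q"
        unfolding q_def using nr(2)
        by (intro holomorphic_on_imp_continuous_on holomorphic_intros
              holomorphic_on_subset[OF g] holomorphic_on_subset[OF hs]) auto
      have "q ` ?W \<subseteq> {1, -1}"
        using q2 unfolding power2_eq_1_iff by blast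
      then show "finite (q ` ?W)" using finite_subset by blast
    qed
    then obtain c where c: "\<And>z. z \<in> ?W \<Longrightarrow> q z = c" unfolding constant_on_def by blast
    have evW: "\<forall>\<^sub>F z in at (of_real x) within upper_hp. z \<in> ?W"
      using \<delta>(1) eventually_at_ball[of \<delta> "of_real x" upper_hp] by simp
    have "\<exists>z. z \<in> ?W"
      using eventually_happens'[OF real_at_within_upper_hp_neq_bot evW] .
    then have "c \<in> \<real>" using c q2 by (metis Reals_1 Reals_minus power2_eq_1_iff)
    have "isCont (\<lambda>z. csqrt (R z)) (of_real x)"
      by (rule holomorphic_on_isCont[OF hs]) (use \<delta>(1) in auto)
    then have "((\<lambda>z. c * csqrt (R z)) \<longlongrightarrow> c * csqrt (R (of_real x))) (at (of_real x) within upper_hp)"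
      by (intro tendsto_mult tendsto_const isCont_tendsto_within)
    moreover have "\<forall>\<^sub>F z in at (of_real x) within upper_hp. c * csqrt (R z) = g z"
      using evW by eventually_elim (use c nr(2) in \<open>force simp: q_def field_simps\<close>)
    ultimately have "(g \<longlongrightarrow> c * csqrt (R (of_real x))) (at (of_real x) within upper_hp)"
      using Lim_transform_eventually by blast
    moreover have "csqrt (R (of_real x)) \<in> \<real>" using R0 by (simp add: csqrt_of_real_nonneg)
    ultimately show ?thesis
      using \<open>c \<in> \<real>\<close> by (intro bexI[of _ "c * csqrt (R (of_real x))"]) auto
  qed
qed

section \<open>Boundary behaviour along the sides\<close>

text \<open>
  The part of the assumptions on \<open>X\<close> that does not involve a polygon. The constant of
  integration of \<open>X \<bullet> v\<close> is absorbed in the primitive \<open>F\<close>.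
\<close>

locale weierstrass_surface =
  fixes X :: "complex \<Rightarrow> real^3" and G H :: "complex \<Rightarrow> complex"
  assumes holG: "G holomorphic_on upper_hp" and holH: "H holomorphic_on upper_hp"
    and contX: "continuous_on closed_upper_hp X"
    and prim: "\<And>v. \<exists>F. \<forall>z\<in>upper_hp. (F has_field_derivative weier_form G H v z) (at z) \<and> X z \<bullet> v = Re (F z)"
begin

abbreviation "\<Phi> \<equiv> weier_form G H"

lemma holomorphic_form: "\<Phi> v holomorphic_on upper_hp"
  unfolding weier_form_def[abs_def] by (intro holomorphic_intros holG holH)

lemma bounded_near_boundary_point:
  obtains M where "M > 0" "\<And>w. w \<in> cball (of_real t) \<rho> \<inter> closed_upper_hp \<Longrightarrow> norm (X w) \<le> M"
proof -
  have "closed closed_upper_hp" by (simp add: closed_upper_hp_def closed_halfspace_Im_ge)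
  then have "compact (cball (of_real t) \<rho> \<inter> closed_upper_hp)" by (intro compact_Int_closed compact_cball)
  then have "compact (X ` (cball (of_real t) \<rho> \<inter> closed_upper_hp))"
    by (intro compact_continuous_image continuous_on_subset[OF contX]) auto
  then obtain M where "\<forall>y\<in>X ` (cball (of_real t) \<rho> \<inter> closed_upper_hp). norm y \<le> M"
    using compact_imp_bounded bounded_iff by blast
  then show ?thesis using that[of "max M 1"] by (force simp: le_max_iff_disj)
qed

text \<open>
  \<open>imaginary_reflection\<close> for a primitive of \<open>\<Phi> v\<close>, normalized by the constant value that \<open>X \<bullet> v\<close>
  takes on the side. The bound on the derivative serves for the growth estimate below.
\<close>

lemma side_reflection:
  fixes x0 r M :: real and d v :: "real^3"
  defines "S \<equiv> ball (of_real x0 :: complex) r"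
  assumes line: "on_line X {x0 - r<..<x0 + r} d" and v: "v \<bullet> d = 0" "norm v \<le> 1"
    and r: "r > 0" and M: "M > 0" and bd: "\<And>z. z \<in> S \<inter> closed_upper_hp \<Longrightarrow> norm (X z) \<le> M"
  obtains f where "f holomorphic_on S" "\<And>z. z \<in> S \<inter> upper_hp \<Longrightarrow> f z = \<Phi> v z"
    "\<And>x. of_real x \<in> S \<Longrightarrow> Re (f (of_real x)) = 0"
    "\<And>w \<rho>. \<rho> > 0 \<Longrightarrow> cball w \<rho> \<subseteq> S \<Longrightarrow> norm (f w) \<le> 72 * M / \<rho>"
proof -
  obtain F where F: "\<And>z. z \<in> upper_hp \<Longrightarrow> (F has_field_derivative \<Phi> v z) (at z)"
    "\<And>z. z \<in> upper_hp \<Longrightarrow> X z \<bullet> v = Re (F z)"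
    using prim[of v] by blast
  define k where "k = X (of_real x0) \<bullet> v"
  have iv: "\<bar>X z \<bullet> v\<bar> \<le> M" if "z \<in> S \<inter> closed_upper_hp" for z
  proof -
    have "\<bar>X z \<bullet> v\<bar> \<le> norm (X z) * norm v" by (rule Cauchy_Schwarz_ineq2)
    also have "\<dots> \<le> M * 1" using bd[OF that] v M by (intro mult_mono) auto
    finally show ?thesis by simp
  qed
  have k: "\<bar>k\<bar> \<le> M" unfolding k_def using r by (intro iv) (auto simp: S_def closed_upper_hp_def)
  have Sx: "x \<in> {x0 - r<..<x0 + r}" if "of_real x \<in> S" for x
    using that by (auto simp: S_def dist_norm simp flip: of_real_diff)
  obtain f where f: "f holomorphic_on S" "\<And>z. z \<in> S \<inter> upper_hp \<Longrightarrow> f z = \<Phi> v z"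
    "\<And>x. of_real x \<in> S \<Longrightarrow> Re (f (of_real x)) = 0"
    "\<And>w \<rho>. \<rho> > 0 \<Longrightarrow> cball w \<rho> \<subseteq> S \<Longrightarrow> norm (f w) \<le> 36 * (2 * M) / \<rho>"
  proof (rule imaginary_reflection[of x0 r "\<lambda>z. F z - of_real k" "\<Phi> v" "2 * M", folded S_def])
    show "((\<lambda>z. F z - of_real k) has_field_derivative \<Phi> v z) (at z)" if "z \<in> S \<inter> upper_hp" for z
      using F(1)[of z] that by (auto intro!: derivative_eq_intros)
    show "\<bar>Re (F z - of_real k)\<bar> \<le> 2 * M" if "z \<in> S \<inter> upper_hp" for z
    proof -
      have "\<bar>X z \<bullet> v\<bar> \<le> M" using that upper_hp_subset_closed by (intro iv) auto
      then show ?thesis using k F(2)[of z] that by auto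
    qed
    show "((\<lambda>z. Re (F z - of_real k)) \<longlongrightarrow> 0) (at (of_real x) within upper_hp)" if "of_real x \<in> S" for x
    proof -
      have "(X \<longlongrightarrow> X (of_real x)) (at (of_real x) within closed_upper_hp)"
        using contX by (auto simp: continuous_on_def closed_upper_hp_def)
      then have "(X \<longlongrightarrow> X (of_real x)) (at (of_real x) within upper_hp)"
        using upper_hp_subset_closed tendsto_within_subset by blast
      then have "((\<lambda>z. X z \<bullet> v - k) \<longlongrightarrow> X (of_real x) \<bullet> v - k) (at (of_real x) within upper_hp)"
        by (intro tendsto_intros)
      moreover have "X (of_real x) \<bullet> v = k"
        unfolding k_def by (rule on_line_inner_constant[OF line v(1) Sx[OF that]]) (use r in auto)
      moreover have "\<forall>\<^sub>F z in at (of_real x) within upper_hp. X z \<bullet> v - k = Re (F z - of_real k)"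
        by (auto simp: eventually_at_filter F(2))
      ultimately show ?thesis using Lim_transform_eventually by fastforce
    qed
  qed (use M in auto)
  show ?thesis by (rule that[OF f(1-3)]) (use f(4) in auto)
qed

text \<open>
  Across the side, \<open>\<Phi> v\<close> continues for \<open>v\<close> orthogonal to \<open>d\<close>. Completing \<open>d\<close> to a frame \<open>d, e, e'\<close>
  gives \<open>(\<Phi> d)\<^sup>2 = -(\<Phi> e)\<^sup>2 - (\<Phi> e')\<^sup>2\<close>, which is \<open>\<ge> 0\<close> on the side since the forms on the
  right are imaginary there.
\<close>

lemma side_limits:
  assumes line: "on_line X {a<..<b} d" "norm d = 1" and x: "a < x" "x < b"
  shows "v \<bullet> d = 0 \<Longrightarrow> \<exists>L. Re L = 0 \<and> (\<Phi> v \<longlongrightarrow> L) (at (of_real x) within upper_hp)"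
    and "\<exists>L\<in>\<real>. (\<Phi> d \<longlongrightarrow> L) (at (of_real x) within upper_hp)"
proof -
  define r where "r = min (x - a) (b - x)"
  have r: "r > 0" using x by (simp add: r_def)
  let ?S = "ball (of_real x :: complex) r"
  have line': "on_line X {x - r<..<x + r} d"
    by (rule on_line_subset[OF line(1)]) (auto simp: r_def)
  obtain M where M: "M > 0" "\<And>z. z \<in> ?S \<inter> closed_upper_hp \<Longrightarrow> norm (X z) \<le> M"
  proof (rule bounded_near_boundary_point[of x r])
    fix M assume "M > 0" "\<And>w. w \<in> cball (of_real x) r \<inter> closed_upper_hp \<Longrightarrow> norm (X w) \<le> M"
    then show ?thesis using that[of M] by simp
  qed
  have ext: "\<exists>f. f holomorphic_on ?S \<and> (\<forall>z\<in>?S \<inter> upper_hp. f z = \<Phi> v z) \<and> Re (f (of_real x)) = 0"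
    if "v \<bullet> d = 0" "norm v \<le> 1" for v
    by (rule side_reflection[OF line' that r M]) (use r in auto)
  have evS: "\<forall>\<^sub>F z in at (of_real x) within upper_hp. z \<in> ?S \<inter> upper_hp"
    using r eventually_at_ball[of r "of_real x" upper_hp] by simp
  have lim1: "\<exists>L. Re L = 0 \<and> (\<Phi> v \<longlongrightarrow> L) (at (of_real x) within upper_hp)"
    if v: "v \<bullet> d = 0" "norm v \<le> 1" for v
  proof -
    obtain f where f: "f holomorphic_on ?S" "\<And>z. z\<in>?S \<inter> upper_hp \<Longrightarrow> f z = \<Phi> v z" "Re (f (of_real x)) = 0"
      using ext[OF v] by blast
    have "isCont f (of_real x)"
      by (rule holomorphic_on_isCont[OF f(1)]) (use r in auto)
    then have "(f \<longlongrightarrow> f (of_real x)) (at (of_real x) within upper_hp)"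
      by (rule isCont_tendsto_within)
    moreover have "\<forall>\<^sub>F z in at (of_real x) within upper_hp. f z = \<Phi> v z"
      using evS by eventually_elim (rule f(2))
    ultimately show ?thesis using f(3) Lim_transform_eventually by blast
  qed
  show "\<exists>L. Re L = 0 \<and> (\<Phi> v \<longlongrightarrow> L) (at (of_real x) within upper_hp)" if vd: "v \<bullet> d = 0"
  proof (cases "v = 0")
    case True
    then have "\<Phi> v = (\<lambda>_. 0)" by (auto simp: weier_form_def)
    then show ?thesis by (intro exI[of _ 0]) auto
  next
    case False
    obtain L where L: "Re L = 0" "(\<Phi> (v /\<^sub>R norm v) \<longlongrightarrow> L) (at (of_real x) within upper_hp)"
      using lim1[of "v /\<^sub>R norm v"] vd False by auto
    have "((\<lambda>z. of_real (norm v) * \<Phi> (v /\<^sub>R norm v) z) \<longlongrightarrow> of_real (norm v) * L) (at (of_real x) within upper_hp)"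
      by (intro tendsto_intros L)
    moreover have "(\<lambda>z. of_real (norm v) * \<Phi> (v /\<^sub>R norm v) z) = \<Phi> v"
      using False by (simp flip: weier_form_scaleR)
    ultimately show ?thesis using L(1) by (intro exI[of _ "of_real (norm v) * L"]) auto
  qed
  show "\<exists>L\<in>\<real>. (\<Phi> d \<longlongrightarrow> L) (at (of_real x) within upper_hp)"
  proof -
    obtain e where e: "norm e = 1" "e \<bullet> d = 0" using unit_vectors_in_frame[OF line(2) line(2)] by blast
    define e' where "e' = cross3 d e"
    have fr: "orthonormal_frame d e e'" unfolding e'_def by (rule orthonormal_frame_exists[OF line(2) e])
    then have e': "norm e' = 1" "e' \<bullet> d = 0" by (auto simp: orthonormal_frame_def inner_commute)
    obtain f1 where f1: "f1 holomorphic_on ?S" "\<And>z. z\<in>?S \<inter> upper_hp \<Longrightarrow> f1 z = \<Phi> e z" "Re (f1 (of_real x)) = 0"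
      using ext[of e] e by auto
    obtain f2 where f2: "f2 holomorphic_on ?S" "\<And>z. z\<in>?S \<inter> upper_hp \<Longrightarrow> f2 z = \<Phi> e' z" "Re (f2 (of_real x)) = 0"
      using ext[of e'] e' by auto
    show ?thesis
    proof (rule real_limit_of_square[OF holomorphic_form r])
      show "(\<lambda>z. - ((f1 z)\<^sup>2 + (f2 z)\<^sup>2)) holomorphic_on ?S" by (intro holomorphic_intros f1 f2)
      show "(\<Phi> d z)\<^sup>2 = - ((f1 z)\<^sup>2 + (f2 z)\<^sup>2)" if "z \<in> ?S \<inter> upper_hp" for z
        unfolding f1(2)[OF that] f2(2)[OF that] eq_neg_iff_add_eq_0
        using weier_form_frame[OF fr, of G H z] by (simp only: add.assoc)
      show "- ((f1 (of_real x))\<^sup>2 + (f2 (of_real x))\<^sup>2) = of_real ((Im (f1 (of_real x)))\<^sup>2 + (Im (f2 (of_real x)))\<^sup>2)"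
        using f1(3) f2(3) by (simp add: complex_eq_iff power2_eq_square)
    qed auto
  qed
qed

text \<open>
  The gradient estimate for the surface: on the scale \<open>\<rho> = \<bar>z - t\<bar>\<close> the form is at most a constant times
  \<open>M/\<rho>\<close>, where \<open>M\<close> bounds \<open>X\<close> on an annulus of that scale. Far from the real axis (\<open>Im z \<ge> \<rho>/4\<close>) this is
  an interior estimate. Otherwise \<open>z\<close> lies in the disk about \<open>Re z\<close> of radius \<open>3\<rho>/8\<close>, which avoids
  \<open>t\<close>, so its real points lie on a single side of \<open>t\<close> and reflection applies. It is stated for an annulus
  because it is used for \<open>z \<rightarrow> t\<close> and for \<open>z \<rightarrow> \<infinity>\<close>.
\<close>

lemma form_growth:
  fixes t :: real and z :: complex
  assumes z: "z \<in> upper_hp" and v: "norm v \<le> 1" and M: "M > 0"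
    and bd: "\<And>w. w \<in> closed_upper_hp \<Longrightarrow> norm (z - of_real t) / 4 \<le> norm (w - of_real t) \<Longrightarrow>
       norm (w - of_real t) \<le> 2 * norm (z - of_real t) \<Longrightarrow> norm (X w) \<le> M"
    and right: "norm d = 1" "on_line X {t + norm (z - of_real t) / 4<..<t + 2 * norm (z - of_real t)} d"
    and left: "norm d' = 1" "on_line X {t - 2 * norm (z - of_real t)<..<t - norm (z - of_real t) / 4} d'"
  shows "norm (\<Phi> v z) \<le> 2304 * M / norm (z - of_real t)"
proof -
  define \<rho> where "\<rho> = norm (z - of_real t)"
  have \<rho>: "\<rho> > 0" using z by (auto simp: \<rho>_def upper_hp_def)
  show ?thesis
  proof (cases "Im z \<ge> \<rho> / 4")
    case True
    obtain F where F: "\<And>z. z \<in> upper_hp \<Longrightarrow> (F has_field_derivative \<Phi> v z) (at z)"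
      "\<And>z. z \<in> upper_hp \<Longrightarrow> X z \<bullet> v = Re (F z)"
      using prim[of v] by blast
    have sub: "w \<in> upper_hp" "norm (X w) \<le> M" if "w \<in> cball z (\<rho>/8)" for w
    proof -
      have n: "norm (z - w) \<le> \<rho>/8" using that by (simp add: dist_norm)
      then have "\<bar>Im z - Im w\<bar> \<le> \<rho>/8" using abs_Im_le_cmod[of "z - w"] by simp
      then have "Im w > 0" using True \<rho> by linarith
      then show w: "w \<in> upper_hp" by (simp add: upper_hp_def)
      have "norm (z - of_real t) - norm (z - w) \<le> norm (w - of_real t)"
        "norm (w - of_real t) \<le> norm (z - of_real t) + norm (z - w)"
        using norm_triangle_ineq[of "z - w" "w - of_real t"] norm_triangle_ineq[of "w - z" "z - of_real t"]
        by (auto simp: norm_minus_commute)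
      then show "norm (X w) \<le> M"
        using n \<rho> w upper_hp_subset_closed by (intro bd) (auto simp: \<rho>_def)
    qed
    have "norm (\<Phi> v z) \<le> 9 * M / (\<rho>/8)"
    proof (rule deriv_bound_of_bounded_real_part[where F = F and f = "\<Phi> v"])
      show "(F has_field_derivative \<Phi> v w) (at w)" if "w \<in> cball z (\<rho>/8)" for w
        using F(1) sub(1) that by blast
      show "\<bar>Re (F w)\<bar> \<le> M" if "w \<in> cball z (\<rho>/8)" for w
      proof -
        have "\<bar>X w \<bullet> v\<bar> \<le> norm (X w) * norm v" by (rule Cauchy_Schwarz_ineq2)
        also have "\<dots> \<le> M * 1" using sub(2)[OF that] v M by (intro mult_mono) auto
        finally show ?thesis using F(2) sub(1) that by simp
      qed
    qed (use \<rho> M in auto)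
    also have "\<dots> \<le> 2304 * M / \<rho>" using \<rho> M by (simp add: field_simps)
    finally show ?thesis by (simp add: \<rho>_def)
  next
    case False
    define x0 where "x0 = Re z"
    define r where "r = 3 * \<rho> / 8"
    have r: "r > 0" using \<rho> by (simp add: r_def)
    have zx: "norm (z - of_real x0) = Im z"
      using z by (simp add: x0_def cmod_def upper_hp_def)
    have tx: "norm (of_real x0 - of_real t :: complex) = \<bar>x0 - t\<bar>"
      by (metis norm_of_real of_real_diff)
    have ge: "\<bar>x0 - t\<bar> \<ge> 3 * \<rho> / 4" "\<bar>x0 - t\<bar> \<le> \<rho>"
    proof -
      have "\<rho> \<le> norm (z - of_real x0) + norm (of_real x0 - of_real t :: complex)"
        using norm_triangle_ineq[of "z - of_real x0" "of_real x0 - of_real t"] by (simp add: \<rho>_def)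
      then show "\<bar>x0 - t\<bar> \<ge> 3 * \<rho> / 4" using zx tx False by simp
      show "\<bar>x0 - t\<bar> \<le> \<rho>" using abs_Re_le_cmod[of "z - of_real t"] by (simp add: \<rho>_def x0_def)
    qed
    obtain d0 where d0: "norm d0 = 1" "on_line X {x0 - r<..<x0 + r} d0"
    proof (cases "x0 > t")
      case True
      then have "{x0 - r<..<x0 + r} \<subseteq> {t + \<rho>/4<..<t + 2*\<rho>}"
        using ge \<rho> by (auto simp: r_def)
      then show ?thesis using that right on_line_subset unfolding \<rho>_def by blast
    next
      case f: False
      then have "{x0 - r<..<x0 + r} \<subseteq> {t - 2*\<rho><..<t - \<rho>/4}"
        using ge \<rho> by (auto simp: r_def)
      then show ?thesis using that left on_line_subset unfolding \<rho>_def by blast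
    qed
    have bdS: "norm (X w) \<le> M" if "w \<in> ball (of_real x0) r \<inter> closed_upper_hp" for w
    proof -
      have n: "norm (w - of_real x0) < r" using that by (simp add: dist_norm norm_minus_commute)
      have "\<bar>x0 - t\<bar> \<le> norm (w - of_real t) + norm (w - of_real x0)"
        "norm (w - of_real t) \<le> \<bar>x0 - t\<bar> + norm (w - of_real x0)"
        using norm_triangle_ineq[of "of_real x0 - w" "w - of_real t"] norm_triangle_ineq[of "w - of_real x0" "of_real x0 - of_real t"]
        unfolding tx[symmetric] by (simp_all add: norm_minus_commute)
      then show ?thesis
        using n ge \<rho> that by (intro bd) (auto simp: \<rho>_def[symmetric] r_def)
    qed
    have cb: "cball z (\<rho>/8) \<subseteq> ball (of_real x0) r"
    proof
      fix w assume "w \<in> cball z (\<rho>/8)"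
      then have "norm (w - z) \<le> \<rho>/8" by (simp add: dist_norm norm_minus_commute)
      then have "norm (w - of_real x0) < r"
        using norm_triangle_ineq[of "w - z" "z - of_real x0"] zx False by (simp add: r_def)
      then show "w \<in> ball (of_real x0) r" by (simp add: dist_norm norm_minus_commute)
    qed
    have zS: "z \<in> ball (of_real x0) r \<inter> upper_hp" using subsetD[OF cb, of z] z \<rho> by simp
    define B where "B = 576 * M / \<rho>"
    have B: "B > 0" using M \<rho> by (simp add: B_def)
    have perp: "norm (\<Phi> w z) \<le> B" if w: "w \<bullet> d0 = 0" "norm w \<le> 1" for w
    proof -
      obtain f where "\<And>z. z \<in> ball (of_real x0) r \<inter> upper_hp \<Longrightarrow> f z = \<Phi> w z"
        "\<And>w \<rho>. \<rho> > 0 \<Longrightarrow> cball w \<rho> \<subseteq> ball (of_real x0) r \<Longrightarrow> norm (f w) \<le> 72 * M / \<rho>"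
        using side_reflection[OF d0(2) w r M bdS] by metis
      from this(1)[OF zS] this(2)[OF _ cb] \<rho> show ?thesis by (simp add: B_def mult.commute)
    qed
    obtain e where e: "norm e = 1" "e \<bullet> d0 = 0" using unit_vectors_in_frame[OF d0(1) d0(1)] by blast
    define e' where "e' = cross3 d0 e"
    have fr: "orthonormal_frame d0 e e'" unfolding e'_def by (rule orthonormal_frame_exists[OF d0(1) e])
    then have e': "norm e' = 1" "e' \<bullet> d0 = 0" by (auto simp: orthonormal_frame_def inner_commute)
    have "norm (\<Phi> d0 z) \<le> 2 * B"
    proof (rule power2_le_imp_le)
      have "(\<Phi> d0 z)\<^sup>2 = - ((\<Phi> e z)\<^sup>2 + (\<Phi> e' z)\<^sup>2)"
        unfolding eq_neg_iff_add_eq_0 using weier_form_frame[OF fr, of G H z] by (simp only: add.assoc)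
      then have "(norm (\<Phi> d0 z))\<^sup>2 = norm ((\<Phi> e z)\<^sup>2 + (\<Phi> e' z)\<^sup>2)"
        by (metis norm_minus_cancel norm_power)
      also have "\<dots> \<le> (norm (\<Phi> e z))\<^sup>2 + (norm (\<Phi> e' z))\<^sup>2"
        using norm_triangle_ineq[of "(\<Phi> e z)\<^sup>2" "(\<Phi> e' z)\<^sup>2"] by (simp add: norm_power)
      also have "\<dots> \<le> B\<^sup>2 + B\<^sup>2"
        using perp[of e] perp[of e'] e e' by (intro add_mono power_mono) auto
      also have "\<dots> \<le> (2 * B)\<^sup>2" by (simp add: power_mult_distrib)
      finally show "(norm (\<Phi> d0 z))\<^sup>2 \<le> (2 * B)\<^sup>2" .
    qed (use B in simp)
    \<comment> \<open>A general \<open>v\<close> is split into its parts along \<open>d0\<close> and orthogonal to \<open>d0\<close>; the latter may have norm up to \<open>2\<close>.\<close>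
    define w where "w = v - (v \<bullet> d0) *\<^sub>R d0"
    have vd: "\<bar>v \<bullet> d0\<bar> \<le> 1"
      using Cauchy_Schwarz_ineq2[of v d0] d0(1) v by simp
    have w0: "w \<bullet> d0 = 0" using d0(1) by (simp add: w_def inner_diff_left norm_eq_1)
    have w1: "norm (w /\<^sub>R 2) \<le> 1"
      using norm_triangle_ineq4[of v "(v \<bullet> d0) *\<^sub>R d0"] vd v d0(1) by (simp add: w_def)
    have "\<Phi> v z = of_real (v \<bullet> d0) * \<Phi> d0 z + 2 * \<Phi> (w /\<^sub>R 2) z"
    proof -
      have "v = (v \<bullet> d0) *\<^sub>R d0 + 2 *\<^sub>R (w /\<^sub>R 2)" by (simp add: w_def)
      then have "\<Phi> v z = \<Phi> ((v \<bullet> d0) *\<^sub>R d0 + 2 *\<^sub>R (w /\<^sub>R 2)) z" by simp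
      then show ?thesis unfolding weier_form_add by (simp only: weier_form_scaleR) simp
    qed
    then have "norm (\<Phi> v z) \<le> \<bar>v \<bullet> d0\<bar> * norm (\<Phi> d0 z) + 2 * norm (\<Phi> (w /\<^sub>R 2) z)"
      using norm_triangle_ineq[of "of_real (v \<bullet> d0) * \<Phi> d0 z" "2 * \<Phi> (w /\<^sub>R 2) z"] by (simp add: norm_mult)
    also have "\<dots> \<le> 1 * (2 * B) + 2 * B"
      using vd \<open>norm (\<Phi> d0 z) \<le> 2 * B\<close> perp[of "w /\<^sub>R 2"] w0 w1 by (intro add_mono mult_mono) auto
    also have "\<dots> = 2304 * M / \<rho>" by (simp add: B_def)
    finally show ?thesis by (simp add: \<rho>_def)
  qed
qed

end

section \<open>Exponents at a boundary point\<close>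

lemma continuous_on_boundary_extension:
  fixes f :: "complex \<Rightarrow> complex"
  assumes S: "open S" and f: "continuous_on (S \<inter> upper_hp) f"
    and lim: "\<And>x. of_real x \<in> S \<Longrightarrow> (f \<longlongrightarrow> g (of_real x)) (at (of_real x) within upper_hp)"
    and gf: "\<And>z. z \<in> S \<inter> upper_hp \<Longrightarrow> g z = f z"
  shows "continuous_on (S \<inter> {z. 0 \<le> Im z}) g"
  unfolding continuous_on_iff
proof (intro ballI allI impI)
  fix z and e :: real assume z: "z \<in> S \<inter> {z. 0 \<le> Im z}" and e: "e > 0"
  obtain \<delta> where \<delta>: "\<delta> > 0" "ball z \<delta> \<subseteq> S" "\<And>w. w \<in> upper_hp \<Longrightarrow> dist w z < \<delta> \<Longrightarrow> dist (f w) (g z) < e/2"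
  proof -
    have "\<exists>\<delta>>0. \<forall>w\<in>upper_hp. dist w z < \<delta> \<longrightarrow> dist (f w) (g z) < e/2"
    proof (cases "Im z = 0")
      case True
      then have zr: "z = of_real (Re z)" by (simp add: complex_eq_iff)
      then have "(f \<longlongrightarrow> g z) (at z within upper_hp)" using lim[of "Re z"] z by (metis IntD1)
      then have "\<forall>\<^sub>F w in at z within upper_hp. dist (f w) (g z) < e/2" using e tendstoD half_gt_zero by blast
      then show ?thesis using True unfolding eventually_at
        by (metis less_irrefl mem_Collect_eq upper_hp_def)
    next
      case False
      then have zT: "z \<in> S \<inter> upper_hp" using z by (auto simp: upper_hp_def)
      have "isCont f z"
        using f zT continuous_on_eq_continuous_at[OF open_Int[OF S open_upper_hp]] by blast
      then have "(f \<longlongrightarrow> f z) (nhds z)" by (simp add: continuous_at_imp_continuous_at_within isCont_def tendsto_at_iff_tendsto_nhds)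
      then have "\<forall>\<^sub>F w in nhds z. dist (f w) (g z) < e/2"
        using e tendstoD[of f "f z" "nhds z" "e/2"] gf[OF zT] by simp
      then show ?thesis unfolding eventually_nhds_metric by blast
    qed
    then obtain \<delta>1 where d1: "\<delta>1 > 0" "\<forall>w\<in>upper_hp. dist w z < \<delta>1 \<longrightarrow> dist (f w) (g z) < e/2" by blast
    obtain \<delta>2 where "\<delta>2 > 0" "ball z \<delta>2 \<subseteq> S" using z S open_contains_ball by blast
    moreover from this have "ball z (min \<delta>1 \<delta>2) \<subseteq> S" by auto
    ultimately show ?thesis using that[of "min \<delta>1 \<delta>2"] d1 by simp
  qed
  show "\<exists>d>0. \<forall>w\<in>S \<inter> {z. 0 \<le> Im z}. dist w z < d \<longrightarrow> dist (g w) (g z) < e"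
  proof (intro exI[of _ \<delta>] conjI ballI impI \<delta>(1))
    fix w assume w: "w \<in> S \<inter> {z. 0 \<le> Im z}" "dist w z < \<delta>"
    show "dist (g w) (g z) < e"
    proof (cases "Im w = 0")
      case False
      then have wT: "w \<in> S \<inter> upper_hp" using w by (auto simp: upper_hp_def)
      then show ?thesis using gf[OF wT] \<delta>(3)[of w] w e by auto
    next
      case True
      then have wr: "w = of_real (Re w)" by (simp add: complex_eq_iff)
      then have l: "(f \<longlongrightarrow> g w) (at w within upper_hp)" using lim[of "Re w"] w by (metis IntD1)
      have "\<forall>\<^sub>F \<zeta> in at w within upper_hp. \<zeta> \<in> ball z \<delta> \<inter> upper_hp"
      proof -
        have "\<forall>\<^sub>F \<zeta> in nhds w. \<zeta> \<in> ball z \<delta>"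
          using w(2) by (intro eventually_nhds_in_open) (auto simp: dist_commute)
        then show ?thesis unfolding eventually_at_filter by eventually_elim auto
      qed
      then have "\<forall>\<^sub>F \<zeta> in at w within upper_hp. dist (f \<zeta>) (g z) \<le> e/2"
        by eventually_elim (use \<delta>(3) less_imp_le in \<open>auto simp: dist_commute\<close>)
      moreover have "((\<lambda>\<zeta>. dist (f \<zeta>) (g z)) \<longlongrightarrow> dist (g w) (g z)) (at w within upper_hp)"
        by (intro tendsto_intros l)
      moreover have "at w within upper_hp \<noteq> bot"
        using real_at_within_upper_hp_neq_bot[of "Re w"] wr by simp
      ultimately have "dist (g w) (g z) \<le> e/2" using tendsto_upperbound by blast
      then show ?thesis using e by simp
    qed
  qed
qed

text \<open>
  The reflection principle for a function that is given in the open half-plane only and has real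
  limits at the real points of \<open>S\<close>. In \<open>boundary_exponent\<close> the set \<open>S\<close> is a punctured disk.
\<close>

lemma schwarz_reflection_limits:
  assumes S: "open S" "cnj ` S \<subseteq> S" and f: "f holomorphic_on S \<inter> upper_hp"
    and lim: "\<And>x. of_real x \<in> S \<Longrightarrow> \<exists>L\<in>\<real>. (f \<longlongrightarrow> L) (at (of_real x) within upper_hp)"
  obtains K where "K holomorphic_on S" "\<And>z. z \<in> S \<inter> upper_hp \<Longrightarrow> K z = f z"
    "\<And>x. of_real x \<in> S \<Longrightarrow> K (of_real x) \<in> \<real>" "\<And>z. z \<in> S \<Longrightarrow> K (cnj z) = cnj (K z)"
proof -
  define g where "g z = (if Im z > 0 then f z else Lim (at z within upper_hp) f)" for z
  have lg: "(f \<longlongrightarrow> g (of_real x)) (at (of_real x) within upper_hp)" "g (of_real x) \<in> \<real>" if x: "of_real x \<in> S" for x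
  proof -
    obtain L where "L \<in> \<real>" "(f \<longlongrightarrow> L) (at (of_real x) within upper_hp)" using lim[OF x] by (rule bexE)
    moreover from this have "g (of_real x) = L"
      using tendsto_Lim[OF real_at_within_upper_hp_neq_bot] by (simp add: g_def)
    ultimately show "(f \<longlongrightarrow> g (of_real x)) (at (of_real x) within upper_hp)" "g (of_real x) \<in> \<real>" by simp_all
  qed
  have gf: "g z = f z" if "z \<in> S \<inter> upper_hp" for z using that by (simp add: g_def upper_hp_def)
  have cont: "continuous_on (S \<inter> {z. 0 \<le> Im z}) g"
    by (rule continuous_on_boundary_extension[OF S(1) holomorphic_on_imp_continuous_on[OF f] lg(1) gf])
  define K where "K z = (if 0 \<le> Im z then g z else cnj (g (cnj z)))" for z
  have greal: "g z \<in> \<real>" if "z \<in> S" "z \<in> \<real>" for z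
  proof -
    from that(2) obtain x where "z = of_real x" by (rule Reals_cases)
    then show ?thesis using lg(2) that(1) by simp
  qed
  have K: "K holomorphic_on S" unfolding K_def
  proof (rule Schwarz_reflection[OF S])
    show "g holomorphic_on S \<inter> {z. 0 < Im z}"
      by (rule holomorphic_transform[of f]) (use f gf in \<open>auto simp: upper_hp_def\<close>)
  qed (use cont greal in auto)
  show ?thesis
  proof (rule that[OF K])
    show "K z = f z" if "z \<in> S \<inter> upper_hp" for z using that by (simp add: K_def g_def upper_hp_def)
    show "K (of_real x) \<in> \<real>" if "of_real x \<in> S" for x using lg(2)[OF that] by (simp add: K_def)
    show "K (cnj z) = cnj (K z)" if "z \<in> S" for z
    proof (cases "Im z = 0")
      case True
      then have "z \<in> \<real>" by (simp add: complex_is_Real_iff)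
      then show ?thesis using greal[OF that] True by (simp add: K_def Reals_cnj_iff)
    qed (auto simp: K_def)
  qed
qed

text \<open>
  \<open>w \<kappa>'/\<kappa>\<close> is holomorphic because \<open>\<kappa> = w\<^sup>n g\<close> with \<open>g\<close> zero-free. The last conclusion is an implication
  so that the lemma covers interior points, where there is no reality, as well as boundary points.
\<close>

lemma logarithmic_derivative_simple_pole:
  assumes \<kappa>: "\<kappa> holomorphic_on ball 0 r" and r: "r > 0" and nz: "z1 \<in> ball 0 r" "\<kappa> z1 \<noteq> 0"
  obtains r' \<Lambda> where "0 < r'" "r' \<le> r" "\<Lambda> holomorphic_on ball 0 r'"
    "\<And>w. w \<in> ball 0 r' - {0} \<Longrightarrow> \<kappa> w \<noteq> 0 \<and> w * deriv \<kappa> w = \<Lambda> w * \<kappa> w"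
    "(\<forall>x. of_real x \<in> ball (0::complex) r \<longrightarrow> \<kappa> (of_real x) \<in> \<real>) \<longrightarrow>
       (\<forall>x. of_real x \<in> ball (0::complex) r' \<longrightarrow> \<Lambda> (of_real x) \<in> \<real>)"
proof -
  obtain n g s where g: "s > 0" "s \<le> r" "g holomorphic_on ball 0 s"
    "\<And>w. w \<in> ball 0 s \<Longrightarrow> \<kappa> w = w ^ n * g w \<and> g w \<noteq> 0"
  proof (cases "\<kappa> 0 = 0")
    case True
    have nc: "\<not> \<kappa> constant_on ball 0 r"
    proof
      assume "\<kappa> constant_on ball 0 r"
      then have "\<kappa> z1 = \<kappa> 0" using nz r unfolding constant_on_def by (metis centre_in_ball)
      then show False using True nz by simp
    qed
    obtain g s n where "0 < s" "ball (0::complex) s \<subseteq> ball 0 r" "g holomorphic_on ball 0 s"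
      "\<And>w. w \<in> ball 0 s \<Longrightarrow> \<kappa> w = (w - 0) ^ n * g w" "\<And>w. w \<in> ball 0 s \<Longrightarrow> g w \<noteq> 0"
    proof (rule holomorphic_factor_zero_nonconstant[OF \<kappa> open_ball connected_ball _ True nc])
      show "0 \<in> ball (0::complex) r" using r by simp
    qed blast
    then show ?thesis using that[of s g n] r by (auto simp: ball_subset_ball_iff)
  next
    case False
    have "isCont \<kappa> 0" by (rule holomorphic_on_isCont[OF \<kappa>]) (use r in auto)
    then have "\<forall>\<^sub>F w in nhds 0. \<kappa> w \<noteq> 0"
      using False by (metis continuous_at_imp_continuous_at_within isCont_def t1_space_nhds tendsto_imp_eventually_ne tendsto_at_iff_tendsto_nhds)
    then obtain s where "s > 0" "\<And>w. dist w 0 < s \<Longrightarrow> \<kappa> w \<noteq> 0" unfolding eventually_nhds_metric by blast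
    then show ?thesis using that[of "min s r" \<kappa> 0] r holomorphic_on_subset[OF \<kappa>] by (auto simp: subset_ball)
  qed
  define \<Lambda> where "\<Lambda> w = of_nat n + w * deriv g w / g w" for w
  have hol: "\<Lambda> holomorphic_on ball 0 s"
    unfolding \<Lambda>_def using g(4) by (intro holomorphic_intros g holomorphic_deriv) auto
  have eq: "\<kappa> w \<noteq> 0 \<and> w * deriv \<kappa> w = \<Lambda> w * \<kappa> w" if w: "w \<in> ball 0 s - {0}" for w
  proof -
    have dg: "(g has_field_derivative deriv g w) (at w)"
      using g(3) w by (intro holomorphic_derivI[of _ "ball 0 s"]) auto
    have "((\<lambda>w. w ^ n * g w) has_field_derivative of_nat n * w ^ (n - 1) * g w + w ^ n * deriv g w) (at w)"
      by (auto intro!: derivative_eq_intros dg)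
    moreover have "\<forall>\<^sub>F v in nhds w. \<kappa> v = v ^ n * g v"
      using eventually_nhds_in_open[of "ball 0 s" w] w by (auto elim!: eventually_mono simp: g(4))
    ultimately have "(\<kappa> has_field_derivative of_nat n * w ^ (n - 1) * g w + w ^ n * deriv g w) (at w)"
      by (subst DERIV_cong_ev[OF refl _ refl]) auto
    then have d: "deriv \<kappa> w = of_nat n * w ^ (n - 1) * g w + w ^ n * deriv g w" by (rule DERIV_imp_deriv)
    have pw: "w * (of_nat n * w ^ (n - 1)) = of_nat n * w ^ n" by (cases n) auto
    have gw: "\<kappa> w = w ^ n * g w" "g w \<noteq> 0" using g(4)[of w] w by auto
    have "w * deriv \<kappa> w = (w * (of_nat n * w ^ (n - 1))) * g w + w ^ n * (w * deriv g w)"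
      unfolding d by (simp add: algebra_simps)
    also have "\<dots> = \<Lambda> w * \<kappa> w"
      unfolding pw \<Lambda>_def gw(1) using gw(2) by (simp add: field_simps)
    finally show ?thesis using gw w by simp
  qed
  have real: "\<Lambda> (of_real x) \<in> \<real>"
    if \<kappa>r: "\<And>x. of_real x \<in> ball (0::complex) r \<Longrightarrow> \<kappa> (of_real x) \<in> \<real>" and x: "of_real x \<in> ball (0::complex) s" for x
  proof (cases "x = 0")
    case True then show ?thesis by (simp add: \<Lambda>_def)
  next
    case False
    have xr: "of_real x \<in> ball (0::complex) r" using x g(2) by auto
    have "\<Lambda> (of_real x) = of_real x * deriv \<kappa> (of_real x) / \<kappa> (of_real x)"
      using eq[of "of_real x"] x False by (simp add: field_simps)
    moreover have "deriv \<kappa> (of_real x) \<in> \<real>"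
      by (rule deriv_real_on_reals[OF \<kappa> open_ball xr \<kappa>r])
    ultimately show ?thesis using \<kappa>r[OF xr] by simp
  qed
  show ?thesis by (rule that[OF g(1,2) hol eq]) (use real in blast)+
qed

text \<open>
  The local form of \<open>h\<close> at a vertex. \<open>h\<close> is real on the right, and real up to the phase
  \<open>exp (\<i>\<beta>)\<close> on the left. Multiplying by \<open>w\<^sup>\<gamma>\<close> with \<open>\<gamma> = -\<beta>/\<pi>\<close> makes it real on both sides, so it
  reflects to a function on the punctured disk; by the growth assumption the singularity at \<open>0\<close> is at
  most a pole. The function \<open>U\<close> is \<open>w\<close> times the logarithmic derivative of \<open>h\<close>; it differs by a constant
  from that of the reflected function.
\<close>

lemma boundary_exponent:
  fixes h :: "complex \<Rightarrow> complex" and r C \<beta> :: real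
  assumes r: "r > 0" and h: "h holomorphic_on ball 0 r \<inter> upper_hp"
    and right: "\<And>x. 0 < x \<Longrightarrow> x < r \<Longrightarrow> \<exists>L\<in>\<real>. (h \<longlongrightarrow> L) (at (of_real x) within upper_hp)"
    and left: "\<And>x. - r < x \<Longrightarrow> x < 0 \<Longrightarrow> \<exists>L\<in>\<real>. ((\<lambda>z. exp (- \<i> * of_real \<beta>) * h z) \<longlongrightarrow> L) (at (of_real x) within upper_hp)"
    and growth: "\<And>w. w \<in> ball 0 r \<inter> upper_hp \<Longrightarrow> norm (h w) \<le> C / norm w ^ M"
    and nz: "z1 \<in> ball 0 r \<inter> upper_hp" "h z1 \<noteq> 0" and r1: "r \<le> 1"
  obtains r' U where "0 < r'" "r' \<le> r" "U holomorphic_on ball 0 r'"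
    "\<And>x. of_real x \<in> ball (0::complex) r' \<Longrightarrow> U (of_real x) \<in> \<real>"
    "\<And>w. w \<in> ball 0 r' \<inter> upper_hp \<Longrightarrow> h w \<noteq> 0 \<and> w * deriv h w = U w * h w"
proof -
  define \<gamma> where "\<gamma> = - \<beta> / pi"
  \<comment> \<open>The power \<open>w\<^sup>\<gamma>\<close> with argument in \<open>[0, \<pi>]\<close>; rotating by \<open>-\<i>\<close> moves the cut of \<open>Ln\<close> off the closed half-plane, except for the origin.\<close>
  define E where "E w = exp (of_real \<gamma> * (Ln (- \<i> * w) + \<i> * of_real (pi/2)))" for w
  \<comment> \<open>\<open>w\<^sup>\<gamma>\<close> is bounded by \<open>\<bar>w\<bar>\<close> to the power \<open>-N\<close> near \<open>0\<close>.\<close>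
  define N where "N = nat \<lceil>\<bar>\<gamma>\<bar>\<rceil>"
  define S where "S = ball (0::complex) r - {0}"
  define k where "k w = h w * E w" for w
  have oS: "open S" unfolding S_def by (simp add: open_delete)
  have nn: "- \<i> * w \<notin> \<real>\<^sub>\<le>\<^sub>0" if "Im w > 0 \<or> (Im w = 0 \<and> w \<noteq> 0)" for w
    using that by (auto simp: complex_nonpos_Reals_iff complex_eq_iff)
  have dE: "(E has_field_derivative of_real \<gamma> / w * E w) (at w)" if "Im w > 0 \<or> (Im w = 0 \<and> w \<noteq> 0)" for w
    unfolding E_def using nn[OF that] that by (auto intro!: derivative_eq_intros simp: field_simps)
  have Ene: "E w \<noteq> 0" for w by (simp add: E_def)
  have hk: "k holomorphic_on S \<inter> upper_hp"
    unfolding k_def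
  proof (intro holomorphic_intros)
    show "h holomorphic_on S \<inter> upper_hp" by (rule holomorphic_on_subset[OF h]) (auto simp: S_def)
    show "E holomorphic_on S \<inter> upper_hp"
      using dE by (subst holomorphic_on_open[OF open_Int[OF oS open_upper_hp]]) (auto simp: upper_hp_def)
  qed
  have klim: "\<exists>L\<in>\<real>. (k \<longlongrightarrow> L) (at (of_real x) within upper_hp)" if "of_real x \<in> S" for x
  proof -
    have x: "x \<noteq> 0" "\<bar>x\<bar> < r" using that by (auto simp: S_def)
    have "isCont E (of_real x)" using dE[of "of_real x"] x DERIV_isCont by auto
    then have El: "(E \<longlongrightarrow> E (of_real x)) (at (of_real x) within upper_hp)" by (rule isCont_tendsto_within)
    show ?thesis
    proof (cases "x > 0")
      case True
      have "Ln (- \<i> * of_real x) = of_real (ln x) - \<i> * of_real (pi/2)"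
        using Ln_times_of_real[OF True, of "- \<i>"] Ln_of_real[OF True] by (simp add: mult.commute)
      then have "E (of_real x) = of_real (exp (\<gamma> * ln x))"
        unfolding E_def by (simp add: exp_of_real[symmetric] del: exp_of_real)
      then have Er: "E (of_real x) \<in> \<real>" by simp
      obtain L where "L \<in> \<real>" "(h \<longlongrightarrow> L) (at (of_real x) within upper_hp)" using right[of x] True x by auto
      then show ?thesis unfolding k_def using Er El
        by (intro bexI[of _ "L * E (of_real x)"] tendsto_mult) auto
    next
      case False
      then have xn: "x < 0" using x by simp
      have "Ln (- \<i> * of_real x) = of_real (ln (-x)) + \<i> * of_real (pi/2)"
        using Ln_times_of_real[of "-x" "\<i>"] Ln_of_real[of "-x"] xn by (simp add: mult.commute)
      then have "E (of_real x) = exp (of_real (\<gamma> * ln (-x)) + \<i> * of_real (\<gamma> * pi))"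
        unfolding E_def by (simp add: algebra_simps)
      also have "\<dots> = of_real (exp (\<gamma> * ln (-x))) * exp (- \<i> * of_real \<beta>)"
        unfolding exp_add exp_of_real by (simp add: \<gamma>_def)
      finally have Er: "E (of_real x) = of_real (exp (\<gamma> * ln (-x))) * exp (- \<i> * of_real \<beta>)" .
      obtain L where L: "L \<in> \<real>" "((\<lambda>z. exp (- \<i> * of_real \<beta>) * h z) \<longlongrightarrow> L) (at (of_real x) within upper_hp)"
        using left[of x] xn x by auto
      have kE: "(\<lambda>z. (exp (- \<i> * of_real \<beta>) * h z) * (E z / exp (- \<i> * of_real \<beta>))) = k"
        by (auto simp: k_def fun_eq_iff)
      have Ex: "E (of_real x) / exp (- \<i> * of_real \<beta>) = of_real (exp (\<gamma> * ln (-x)))"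
        unfolding Er by simp
      have "((\<lambda>z. (exp (- \<i> * of_real \<beta>) * h z) * (E z / exp (- \<i> * of_real \<beta>))) \<longlongrightarrow>
          L * (E (of_real x) / exp (- \<i> * of_real \<beta>))) (at (of_real x) within upper_hp)"
        by (intro tendsto_intros L El) auto
      then show ?thesis unfolding kE Ex
        by (rule bexI) (use L(1) in auto)
    qed
  qed
  have cS: "cnj ` S \<subseteq> S" by (auto simp: S_def)
  obtain K where K: "K holomorphic_on S" "\<And>z. z \<in> S \<inter> upper_hp \<Longrightarrow> K z = k z"
    "\<And>x. of_real x \<in> S \<Longrightarrow> K (of_real x) \<in> \<real>" "\<And>z. z \<in> S \<Longrightarrow> K (cnj z) = cnj (K z)"
    using schwarz_reflection_limits[OF oS cS hk klim] by blast
  define m where "m = M + N"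
  have C0: "C \<ge> 0"
  proof -
    have "0 \<le> C / norm z1 ^ M" using growth[OF nz(1)] norm_ge_zero order_trans by blast
    moreover have "norm z1 ^ M > 0" using nz(1) by (intro zero_less_power) (auto simp: upper_hp_def)
    ultimately show ?thesis by (simp add: zero_le_divide_iff)
  qed
  have bup: "norm (w ^ m * K w) \<le> C" if w: "w \<in> S \<inter> upper_hp" for w
  proof -
    have w0: "w \<noteq> 0" "norm w < 1" "norm w > 0" using w r1 by (auto simp: S_def)
    have "norm (E w) = exp (\<gamma> * ln (norm w))"
      using w0 by (simp add: E_def norm_mult)
    also have "\<dots> \<le> exp (- (\<bar>\<gamma>\<bar> * ln (norm w)))"
    proof -
      have "ln (norm w) \<le> 0" using w0 by simp
      then have "\<gamma> * ln (norm w) \<le> - (\<bar>\<gamma>\<bar> * ln (norm w))"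
        by (cases "\<gamma> \<ge> 0") (auto simp: mult_nonneg_nonpos)
      then show ?thesis by simp
    qed
    also have "\<dots> \<le> exp (- (real N * ln (norm w)))"
    proof -
      have "\<bar>\<gamma>\<bar> \<le> real N" by (simp add: N_def)
      then show ?thesis using w0 by (auto intro!: mult_right_mono_neg)
    qed
    also have "\<dots> = 1 / norm w ^ N"
      using w0 by (simp add: exp_minus exp_of_nat_mult divide_inverse)
    finally have EN: "norm (E w) \<le> 1 / norm w ^ N" .
    have "norm (w ^ m * K w) = norm w ^ m * (norm (h w) * norm (E w))"
      using K(2)[OF w] by (simp add: k_def norm_mult norm_power)
    also have "\<dots> \<le> norm w ^ m * (C / norm w ^ M * (1 / norm w ^ N))"
      using growth[of w] w EN C0 by (intro mult_left_mono mult_mono) (auto simp: S_def)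
    also have "\<dots> = C" using w0 by (simp add: m_def power_add)
    finally show ?thesis .
  qed
  have contK: "continuous_on S (\<lambda>w. w ^ m * K w)"
    by (intro continuous_intros holomorphic_on_imp_continuous_on K)
  have bnd: "norm (w ^ m * K w) \<le> C" if "w \<in> S" for w
  proof (rule norm_bound_by_reflection[OF oS contK _ bup that])
    show "cnj w \<in> S \<and> norm (cnj w ^ m * K (cnj w)) = norm (w ^ m * K w)" if "w \<in> S" for w
    proof -
      have "norm (cnj w ^ m * K (cnj w)) = norm (w ^ m * K w)"
        unfolding K(4)[OF that] by (simp add: norm_mult norm_power)
      then show ?thesis using cS that by blast
    qed
  qed
  have "\<exists>\<kappa>. \<kappa> holomorphic_on ball 0 r \<and> (\<forall>w\<in>ball 0 r - {0}. \<kappa> w = w ^ m * K w)"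
  proof (subst holomorphic_on_extend_bounded)
    show "(\<lambda>w. w ^ m * K w) holomorphic_on ball 0 r - {0}"
      using K(1) unfolding S_def by (intro holomorphic_intros)
    have "\<forall>\<^sub>F w in at 0. w \<in> S"
      unfolding S_def using eventually_at_ball[of r 0 UNIV] r
      by (auto simp: eventually_at_filter elim: eventually_mono)
    then show "\<exists>B. \<forall>\<^sub>F w in at 0. norm (w ^ m * K w) \<le> B"
      by (intro exI[of _ C]) (auto elim: eventually_mono intro: bnd)
  qed (use r in auto)
  then obtain \<kappa> where \<kappa>: "\<kappa> holomorphic_on ball 0 r" "\<And>w. w \<in> S \<Longrightarrow> \<kappa> w = w ^ m * K w"
    unfolding S_def by blast
  have \<kappa>r0: "\<kappa> (of_real x) \<in> \<real>" if "of_real x \<in> ball (0::complex) r" "x \<noteq> 0" for x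
    using \<kappa>(2)[of "of_real x"] K(3)[of x] that by (auto simp: S_def)
  have \<kappa>r: "\<kappa> (of_real x) \<in> \<real>" if "of_real x \<in> ball (0::complex) r" for x
  proof (cases "x = 0")
    case True
    have "isCont \<kappa> 0" by (rule holomorphic_on_isCont[OF \<kappa>(1)]) (use r in auto)
    moreover have "((\<lambda>t. complex_of_real t) \<longlongrightarrow> of_real 0) (at (0::real))" by (intro tendsto_intros)
    ultimately have "((\<lambda>t. \<kappa> (of_real t)) \<longlongrightarrow> \<kappa> 0) (at (0::real))"
      using isCont_tendsto_compose by fastforce
    moreover have "\<forall>\<^sub>F t in at (0::real). \<kappa> (of_real t) \<in> \<real>"
      unfolding eventually_at using r \<kappa>r0 by (intro exI[of _ r]) auto
    ultimately have "\<kappa> 0 \<in> \<real>" by (intro Lim_in_closed_set[OF closed_complex_Reals, of "\<lambda>t. \<kappa> (of_real t)" "at (0::real)"]) auto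
    then show ?thesis using True by simp
  qed (use \<kappa>r0 that in blast)
  have z1S: "z1 \<in> S \<inter> upper_hp" using nz(1) by (auto simp: S_def upper_hp_def)
  have "\<kappa> z1 \<noteq> 0" using \<kappa>(2)[of z1] K(2)[OF z1S] nz(2) Ene z1S by (auto simp: k_def S_def)
  moreover have "z1 \<in> ball 0 r" using z1S by (simp add: S_def)
  ultimately obtain r' \<Lambda> where \<Lambda>': "0 < r'" "r' \<le> r" "\<Lambda> holomorphic_on ball 0 r'"
    "\<And>w. w \<in> ball 0 r' - {0} \<Longrightarrow> \<kappa> w \<noteq> 0 \<and> w * deriv \<kappa> w = \<Lambda> w * \<kappa> w"
    "(\<forall>x. of_real x \<in> ball (0::complex) r \<longrightarrow> \<kappa> (of_real x) \<in> \<real>) \<longrightarrow>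
       (\<forall>x. of_real x \<in> ball (0::complex) r' \<longrightarrow> \<Lambda> (of_real x) \<in> \<real>)"
    using logarithmic_derivative_simple_pole[OF \<kappa>(1) r] by metis
  have \<Lambda>5: "\<Lambda> (of_real x) \<in> \<real>" if "of_real x \<in> ball (0::complex) r'" for x
    using \<Lambda>'(5) \<kappa>r that by simp
  note \<Lambda> = \<Lambda>'(1-4) \<Lambda>5
  define U where "U w = \<Lambda> w - of_nat m - of_real \<gamma>" for w
  show ?thesis
  proof (rule that[of r' U])
    show "U holomorphic_on ball 0 r'" unfolding U_def by (intro holomorphic_intros \<Lambda>)
    show "U (of_real x) \<in> \<real>" if "of_real x \<in> ball (0::complex) r'" for x
      unfolding U_def using \<Lambda>(5)[OF that] by (intro Reals_diff) auto
    show "h w \<noteq> 0 \<and> w * deriv h w = U w * h w" if w: "w \<in> ball 0 r' \<inter> upper_hp" for w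
    proof -
      have wS: "w \<in> S \<inter> upper_hp" and w0: "w \<noteq> 0" and Imw: "Im w > 0"
        using w \<Lambda>(2) by (auto simp: S_def upper_hp_def)
      have oT: "open (S \<inter> upper_hp)" using oS open_upper_hp by blast
      have eqk: "\<kappa> v = v ^ m * (h v * E v)" if "v \<in> S \<inter> upper_hp" for v
        using \<kappa>(2)[of v] K(2)[OF that] that by (simp add: k_def)
      have "open (ball 0 r \<inter> upper_hp)" by (intro open_Int open_ball open_upper_hp)
      then have dh: "(h has_field_derivative deriv h w) (at w)"
        using holomorphic_derivI[OF h] wS by (auto simp: S_def)
      have "((\<lambda>v. v ^ m * (h v * E v)) has_field_derivative
          of_nat m * w ^ (m - 1) * (h w * E w) + w ^ m * (deriv h w * E w + h w * (of_real \<gamma> / w * E w))) (at w)"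
        by (rule derivative_eq_intros dh dE refl | use Imw in simp)+
      moreover have "\<forall>\<^sub>F v in nhds w. \<kappa> v = v ^ m * (h v * E v)"
        using eventually_nhds_in_open[OF oT wS] by eventually_elim (rule eqk)
      ultimately have "(\<kappa> has_field_derivative
          of_nat m * w ^ (m - 1) * (h w * E w) + w ^ m * (deriv h w * E w + h w * (of_real \<gamma> / w * E w))) (at w)"
        by (subst DERIV_cong_ev[OF refl _ refl]) auto
      then have d: "deriv \<kappa> w = of_nat m * w ^ (m - 1) * (h w * E w) + w ^ m * (deriv h w * E w + h w * (of_real \<gamma> / w * E w))"
        by (rule DERIV_imp_deriv)
      have pw: "w * (of_nat m * w ^ (m - 1)) = of_nat m * w ^ m" by (cases m) auto
      have L: "\<kappa> w \<noteq> 0" "w * deriv \<kappa> w = \<Lambda> w * \<kappa> w" using \<Lambda>(4)[of w] w w0 by auto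
      have "w * deriv \<kappa> w = (w * (of_nat m * w ^ (m - 1))) * (h w * E w) + w ^ m * ((w * deriv h w) * E w + h w * (of_real \<gamma> * E w))"
        unfolding d using w0 by (simp add: field_simps)
      then have "w ^ m * E w * (of_nat m * h w + w * deriv h w + of_real \<gamma> * h w) = w ^ m * E w * (\<Lambda> w * h w)"
        unfolding pw L(2) eqk[OF wS] by (simp add: algebra_simps)
      then have "of_nat m * h w + w * deriv h w + of_real \<gamma> * h w = \<Lambda> w * h w" using w0 Ene by simp
      moreover have "h w \<noteq> 0" using L(1) eqk[OF wS] by auto
      ultimately show ?thesis by (simp add: U_def algebra_simps)
    qed
  qed (use \<Lambda> in auto)
qed

section \<open>The equation in terms of logarithmic derivatives\<close>

definition wronskian :: "(complex \<Rightarrow> complex) \<Rightarrow> (complex \<Rightarrow> complex) \<Rightarrow> complex \<Rightarrow> complex" where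
  "wronskian G H z = G z * deriv H z - deriv G z * H z"

text \<open>
  By Cramer's rule, \<open>coeff_p\<close> and \<open>coeff_q\<close> are the only possible coefficients of an equation with solutions
  \<open>G, H\<close>, wherever the Wronskian does not vanish.
\<close>

definition coeff_p :: "(complex \<Rightarrow> complex) \<Rightarrow> (complex \<Rightarrow> complex) \<Rightarrow> complex \<Rightarrow> complex" where
  "coeff_p G H z = - (G z * deriv (deriv H) z - deriv (deriv G) z * H z) / wronskian G H z"

definition coeff_q :: "(complex \<Rightarrow> complex) \<Rightarrow> (complex \<Rightarrow> complex) \<Rightarrow> complex \<Rightarrow> complex" where
  "coeff_q G H z = (deriv G z * deriv (deriv H) z - deriv (deriv G) z * deriv H z) / wronskian G H z"

lemma holomorphic_wronskian:
  "G holomorphic_on upper_hp \<Longrightarrow> H holomorphic_on upper_hp \<Longrightarrow> wronskian G H holomorphic_on upper_hp"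
  unfolding wronskian_def[abs_def] by (intro holomorphic_intros holomorphic_deriv open_upper_hp)

lemma coeff_solves:
  assumes "wronskian G H z \<noteq> 0"
  shows "deriv (deriv G) z + coeff_p G H z * deriv G z + coeff_q G H z * G z = 0"
    and "deriv (deriv H) z + coeff_p G H z * deriv H z + coeff_q G H z * H z = 0"
proof -
  let ?W = "wronskian G H z"
  have p: "?W * coeff_p G H z = - (G z * deriv (deriv H) z - deriv (deriv G) z * H z)"
    and q: "?W * coeff_q G H z = deriv G z * deriv (deriv H) z - deriv (deriv G) z * deriv H z"
    using assms by (auto simp: coeff_p_def coeff_q_def)
  have "?W * (deriv (deriv G) z + coeff_p G H z * deriv G z + coeff_q G H z * G z) =
      ?W * deriv (deriv G) z + (?W * coeff_p G H z) * deriv G z + (?W * coeff_q G H z) * G z"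
    by (simp add: algebra_simps)
  also have "\<dots> = 0" unfolding p q by (simp add: wronskian_def algebra_simps)
  finally show "deriv (deriv G) z + coeff_p G H z * deriv G z + coeff_q G H z * G z = 0" using assms by simp
  have "?W * (deriv (deriv H) z + coeff_p G H z * deriv H z + coeff_q G H z * H z) =
      ?W * deriv (deriv H) z + (?W * coeff_p G H z) * deriv H z + (?W * coeff_q G H z) * H z"
    by (simp add: algebra_simps)
  also have "\<dots> = 0" unfolding p q by (simp add: wronskian_def algebra_simps)
  finally show "deriv (deriv H) z + coeff_p G H z * deriv H z + coeff_q G H z * H z = 0" using assms by simp
qed

lemma coeff_unique:
  assumes "wronskian G H z \<noteq> 0"
    and g: "deriv (deriv G) z + p * deriv G z + q * G z = 0"
    and h: "deriv (deriv H) z + p * deriv H z + q * H z = 0"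
  shows "p = coeff_p G H z" "q = coeff_q G H z"
proof -
  have e: "deriv (deriv G) z = - p * deriv G z - q * G z" "deriv (deriv H) z = - p * deriv H z - q * H z"
    using g h by algebra+
  have "- (G z * deriv (deriv H) z - deriv (deriv G) z * H z) = p * wronskian G H z"
    "deriv G z * deriv (deriv H) z - deriv (deriv G) z * deriv H z = q * wronskian G H z"
    unfolding wronskian_def e by (simp_all add: algebra_simps)
  then show "p = coeff_p G H z" "q = coeff_q G H z"
    using assms(1) by (simp_all add: coeff_p_def coeff_q_def)
qed

lemma nonzero_in_open_subset:
  assumes "f holomorphic_on upper_hp" "z0 \<in> upper_hp" "f z0 \<noteq> 0" "open T" "T \<subseteq> upper_hp" "T \<noteq> {}"
  obtains z where "z \<in> T" "f z \<noteq> 0"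
proof -
  have "\<exists>z\<in>T. f z \<noteq> 0"
  proof (rule ccontr)
    assume "\<not> ?thesis"
    then have 0: "f z = 0" if "z \<in> T" for z using that by blast
    have "f z0 = 0"
      by (rule analytic_continuation_open[of T upper_hp f "\<lambda>_. 0"])
         (use assms 0 open_upper_hp convex_connected[OF convex_upper_hp] in \<open>simp_all\<close>)
    then show False using assms by simp
  qed
  then show ?thesis using that by blast
qed

text \<open>
  The second derivative of a combination \<open>y\<close> of \<open>G, H\<close> in terms of \<open>V\<close>, its logarithmic derivative for the
  vector field \<open>w d/dw\<close> of the local coordinate \<open>w = \<omega> z\<close>. The assumption on \<open>\<omega>'\<close> says that this field is
  \<open>s (z - t) d/dz\<close>. It holds for \<open>w = z - t\<close> with \<open>s = 1\<close>, and for \<open>w = -1/z\<close> with \<open>s = -1\<close>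
  and \<open>t = 0\<close>.
\<close>

lemma riccati_in_local_coordinate:
  assumes G: "G holomorphic_on upper_hp" and H: "H holomorphic_on upper_hp" and z: "z \<in> upper_hp"
    and \<omega>: "(\<omega> has_field_derivative \<omega>') (at z)" "s * (z - t) * \<omega>' = \<omega> z"
    and V: "V holomorphic_on ball 0 r" and wz: "\<omega> z \<in> ball 0 r - {0}"
    and eq: "\<And>\<zeta>. \<zeta> \<in> upper_hp \<Longrightarrow> \<omega> \<zeta> \<in> ball 0 r - {0} \<Longrightarrow>
       s * (\<zeta> - t) * (a * deriv G \<zeta> + b * deriv H \<zeta>) = V (\<omega> \<zeta>) * (a * G \<zeta> + b * H \<zeta>)"
  shows "(\<omega> z * deriv V (\<omega> z) + (V (\<omega> z))\<^sup>2 - s * V (\<omega> z)) * (a * G z + b * H z) =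
     (s * (z - t))\<^sup>2 * (a * deriv (deriv G) z + b * deriv (deriv H) z)"
proof -
  have d: "(G has_field_derivative deriv G z) (at z)" "(H has_field_derivative deriv H z) (at z)"
    "(deriv G has_field_derivative deriv (deriv G) z) (at z)" "(deriv H has_field_derivative deriv (deriv H) z) (at z)"
    using holomorphic_derivI[OF _ open_upper_hp z] G H holomorphic_deriv[OF _ open_upper_hp] by blast+
  have dV: "(V has_field_derivative deriv V (\<omega> z)) (at (\<omega> z))"
    using wz by (intro holomorphic_derivI[OF V]) auto
  have dVw: "((\<lambda>\<zeta>. V (\<omega> \<zeta>)) has_field_derivative deriv V (\<omega> z) * \<omega>') (at z)"
    using DERIV_chain2[OF dV \<omega>(1)] .
  have "isCont \<omega> z" using \<omega>(1) DERIV_isCont by blast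
  then have "(\<omega> \<longlongrightarrow> \<omega> z) (nhds z)"
    by (simp add: isCont_def tendsto_at_iff_tendsto_nhds)
  then have "\<forall>\<^sub>F \<zeta> in nhds z. \<omega> \<zeta> \<in> ball 0 r - {0}"
    by (rule topological_tendstoD) (use wz in auto)
  moreover have "\<forall>\<^sub>F \<zeta> in nhds z. \<zeta> \<in> upper_hp" by (rule eventually_nhds_in_open[OF open_upper_hp z])
  ultimately have ev: "\<forall>\<^sub>F \<zeta> in nhds z. s * (\<zeta> - t) * (a * deriv G \<zeta> + b * deriv H \<zeta>) = V (\<omega> \<zeta>) * (a * G \<zeta> + b * H \<zeta>)"
    by eventually_elim (rule eq)
  have d1: "((\<lambda>\<zeta>. s * (\<zeta> - t) * (a * deriv G \<zeta> + b * deriv H \<zeta>)) has_field_derivative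
     s * (a * deriv G z + b * deriv H z) + s * (z - t) * (a * deriv (deriv G) z + b * deriv (deriv H) z)) (at z)"
    by (rule derivative_eq_intros d refl)+ simp
  have d2: "((\<lambda>\<zeta>. V (\<omega> \<zeta>) * (a * G \<zeta> + b * H \<zeta>)) has_field_derivative
     deriv V (\<omega> z) * \<omega>' * (a * G z + b * H z) + V (\<omega> z) * (a * deriv G z + b * deriv H z)) (at z)"
    by (rule derivative_eq_intros d dVw refl)+ simp
  have diff: "s * (a * deriv G z + b * deriv H z) + s * (z - t) * (a * deriv (deriv G) z + b * deriv (deriv H) z) =
      deriv V (\<omega> z) * \<omega>' * (a * G z + b * H z) + V (\<omega> z) * (a * deriv G z + b * deriv H z)"
    by (rule DERIV_unique[OF d1 iffD2[OF DERIV_cong_ev[OF refl ev refl] d2]])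
  define c where "c = s * (z - t)"
  define Y0 Y1 Y2 where "Y0 = a * G z + b * H z" and "Y1 = a * deriv G z + b * deriv H z"
    and "Y2 = a * deriv (deriv G) z + b * deriv (deriv H) z"
  have e1: "c * Y1 = V (\<omega> z) * Y0" using eq[OF z wz] by (simp add: c_def Y0_def Y1_def)
  have e2: "s * Y1 + c * Y2 = deriv V (\<omega> z) * \<omega>' * Y0 + V (\<omega> z) * Y1"
    using diff by (simp add: c_def Y0_def Y1_def Y2_def)
  have e3: "c * \<omega>' = \<omega> z" using \<omega>(2) by (simp add: c_def)
  have "c\<^sup>2 * Y2 = c * (s * Y1 + c * Y2) - s * (c * Y1)" by (simp add: algebra_simps power2_eq_square)
  also have "\<dots> = (c * \<omega>') * deriv V (\<omega> z) * Y0 + V (\<omega> z) * (c * Y1) - s * (c * Y1)"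
    unfolding e2 by (simp add: algebra_simps)
  also have "\<dots> = (\<omega> z * deriv V (\<omega> z) + (V (\<omega> z))\<^sup>2 - s * V (\<omega> z)) * Y0"
    unfolding e1 e3 by (simp add: algebra_simps power2_eq_square)
  finally show ?thesis by (simp add: c_def Y0_def Y2_def)
qed

text \<open>
  Write \<open>c = s (z - t)\<close>. Two solutions with logarithmic derivatives \<open>V1, V2\<close> satisfy the Riccati equations
  \<open>w V' + V\<^sup>2 - s V = - (c p) V - c\<^sup>2 q\<close>. Their difference expresses \<open>c p\<close> by \<open>V1 + V2\<close> and the logarithmic
  derivative of \<open>\<delta> = V1 - V2\<close>, and then one of them expresses \<open>c\<^sup>2 q\<close>. All these functions are holomorphic
  at \<open>0\<close>, which is the Fuchsian condition. \<open>\<delta>\<close> does not vanish identically because it is the Wronskian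
  of the two solutions, up to nonzero factors.
\<close>

lemma fuchsian_in_local_coordinate:
  assumes G: "G holomorphic_on upper_hp" and H: "H holomorphic_on upper_hp"
    and \<omega>: "\<And>z. z \<in> upper_hp \<Longrightarrow> \<omega> z \<noteq> 0 \<Longrightarrow> (\<omega> has_field_derivative \<omega>' z) (at z) \<and> s * (z - t) * \<omega>' z = \<omega> z"
    and r: "r > 0" and V: "V1 holomorphic_on ball 0 r" "V2 holomorphic_on ball 0 r"
    and det: "a1 * b2 - a2 * b1 \<noteq> 0"
    and y1: "\<And>z. z \<in> upper_hp \<Longrightarrow> \<omega> z \<in> ball 0 r - {0} \<Longrightarrow> a1 * G z + b1 * H z \<noteq> 0 \<and>
       s * (z - t) * (a1 * deriv G z + b1 * deriv H z) = V1 (\<omega> z) * (a1 * G z + b1 * H z)"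
    and y2: "\<And>z. z \<in> upper_hp \<Longrightarrow> \<omega> z \<in> ball 0 r - {0} \<Longrightarrow> a2 * G z + b2 * H z \<noteq> 0 \<and>
       s * (z - t) * (a2 * deriv G z + b2 * deriv H z) = V2 (\<omega> z) * (a2 * G z + b2 * H z)"
    and z1: "z1 \<in> upper_hp" "\<omega> z1 \<in> ball 0 r - {0}" "wronskian G H z1 \<noteq> 0"
  obtains r' A B where "0 < r'" "r' \<le> r" "A holomorphic_on ball 0 r'" "B holomorphic_on ball 0 r'"
    "\<And>z. z \<in> upper_hp \<Longrightarrow> \<omega> z \<in> ball 0 r' - {0} \<Longrightarrow> wronskian G H z \<noteq> 0 \<and>
       s * (z - t) * coeff_p G H z = A (\<omega> z) \<and> (s * (z - t))\<^sup>2 * coeff_q G H z = B (\<omega> z)"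
    "(\<forall>x. of_real x \<in> ball (0::complex) r \<longrightarrow> V1 (of_real x) \<in> \<real> \<and> V2 (of_real x) \<in> \<real>) \<and> s \<in> \<real> \<longrightarrow>
     (\<forall>x. of_real x \<in> ball (0::complex) r' \<longrightarrow> A (of_real x) \<in> \<real> \<and> B (of_real x) \<in> \<real>)"
proof -
  define \<delta> where "\<delta> w = V1 w - V2 w" for w
  have h\<delta>: "\<delta> holomorphic_on ball 0 r" unfolding \<delta>_def by (intro holomorphic_intros V)
  \<comment> \<open>The Wronskian of the two solutions, written in two ways.\<close>
  have wr: "s * (z - t) * ((a1 * b2 - a2 * b1) * wronskian G H z) = (a1 * G z + b1 * H z) * (a2 * G z + b2 * H z) * (- \<delta> (\<omega> z))"
    if "z \<in> upper_hp" "\<omega> z \<in> ball 0 r - {0}" for z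
  proof -
    have "s * (z - t) * ((a1 * b2 - a2 * b1) * wronskian G H z) =
       (a1 * G z + b1 * H z) * (s * (z - t) * (a2 * deriv G z + b2 * deriv H z)) -
       (s * (z - t) * (a1 * deriv G z + b1 * deriv H z)) * (a2 * G z + b2 * H z)"
      by (simp add: wronskian_def algebra_simps)
    also have "\<dots> = (a1 * G z + b1 * H z) * (V2 (\<omega> z) * (a2 * G z + b2 * H z)) -
       (V1 (\<omega> z) * (a1 * G z + b1 * H z)) * (a2 * G z + b2 * H z)"
      using y1[OF that] y2[OF that] by simp
    finally show ?thesis by (simp add: \<delta>_def algebra_simps)
  qed
  have cne: "s * (z - t) \<noteq> 0" if "z \<in> upper_hp" "\<omega> z \<in> ball 0 r - {0}" for z
    using \<omega>[of z] that by auto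
  have "s * (z1 - t) * ((a1 * b2 - a2 * b1) * wronskian G H z1) \<noteq> 0"
    using cne[OF z1(1,2)] det z1(3) by simp
  then have "\<delta> (\<omega> z1) \<noteq> 0" unfolding wr[OF z1(1,2)] by simp
  moreover have "\<omega> z1 \<in> ball 0 r" using z1 by simp
  ultimately obtain r' \<Lambda> where \<Lambda>: "0 < r'" "r' \<le> r" "\<Lambda> holomorphic_on ball 0 r'"
    "\<And>w. w \<in> ball 0 r' - {0} \<Longrightarrow> \<delta> w \<noteq> 0 \<and> w * deriv \<delta> w = \<Lambda> w * \<delta> w"
    "(\<forall>x. of_real x \<in> ball (0::complex) r \<longrightarrow> \<delta> (of_real x) \<in> \<real>) \<longrightarrow>
       (\<forall>x. of_real x \<in> ball (0::complex) r' \<longrightarrow> \<Lambda> (of_real x) \<in> \<real>)"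
    using logarithmic_derivative_simple_pole[OF h\<delta> r] by metis
  have sub: "ball 0 r' \<subseteq> ball (0::complex) r" using \<Lambda>(2) by (rule subset_ball)
  define A where "A w = s - \<Lambda> w - V1 w - V2 w" for w
  define B where "B w = - (w * deriv V1 w - s * V1 w + A w * V1 w + (V1 w)\<^sup>2)" for w
  have V': "V1 holomorphic_on ball 0 r'" "V2 holomorphic_on ball 0 r'"
    using V sub holomorphic_on_subset by blast+
  have hA: "A holomorphic_on ball 0 r'" unfolding A_def by (intro holomorphic_intros V' \<Lambda>)
  have hB: "B holomorphic_on ball 0 r'" unfolding B_def by (intro holomorphic_intros hA V' holomorphic_deriv open_ball)
  have main: "wronskian G H z \<noteq> 0 \<and> s * (z - t) * coeff_p G H z = A (\<omega> z) \<and> (s * (z - t))\<^sup>2 * coeff_q G H z = B (\<omega> z)"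
    if z: "z \<in> upper_hp" and wz': "\<omega> z \<in> ball 0 r' - {0}" for z
  proof -
    have wz: "\<omega> z \<in> ball 0 r - {0}" using wz' sub by blast
    have \<delta>: "\<delta> (\<omega> z) \<noteq> 0" "\<omega> z * deriv \<delta> (\<omega> z) = \<Lambda> (\<omega> z) * \<delta> (\<omega> z)" using \<Lambda>(4)[OF wz'] by auto
    have W: "wronskian G H z \<noteq> 0"
      using wr[OF z wz] y1[OF z wz] y2[OF z wz] \<delta>(1) by auto
    define c where "c = s * (z - t)"
    define p q where "p = coeff_p G H z" and "q = coeff_q G H z"
    have ric: "\<omega> z * deriv V (\<omega> z) + (V (\<omega> z))\<^sup>2 - s * V (\<omega> z) = - (c * p) * V (\<omega> z) - c\<^sup>2 * q"
      if V: "V holomorphic_on ball 0 r" and y: "\<And>z. z \<in> upper_hp \<Longrightarrow> \<omega> z \<in> ball 0 r - {0} \<Longrightarrow> a * G z + b * H z \<noteq> 0 \<and>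
       s * (z - t) * (a * deriv G z + b * deriv H z) = V (\<omega> z) * (a * G z + b * H z)" for V a b
    proof -
      have R: "(\<omega> z * deriv V (\<omega> z) + (V (\<omega> z))\<^sup>2 - s * V (\<omega> z)) * (a * G z + b * H z) =
          c\<^sup>2 * (a * deriv (deriv G) z + b * deriv (deriv H) z)"
        unfolding c_def using \<omega>[OF z] wz y
        by (intro riccati_in_local_coordinate[where \<omega> = \<omega> and \<omega>' = "\<omega>' z" and V = V and r = r] G H z V wz) auto
      have Y2: "a * deriv (deriv G) z + b * deriv (deriv H) z = - p * (a * deriv G z + b * deriv H z) - q * (a * G z + b * H z)"
      proof -
        have e: "deriv (deriv G) z = - p * deriv G z - q * G z" "deriv (deriv H) z = - p * deriv H z - q * H z"
          using coeff_solves[OF W, folded p_def q_def] by algebra+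
        show ?thesis unfolding e by (simp add: algebra_simps)
      qed
      have "c\<^sup>2 * (a * deriv (deriv G) z + b * deriv (deriv H) z) =
          - (c * p) * (c * (a * deriv G z + b * deriv H z)) - c\<^sup>2 * q * (a * G z + b * H z)"
        unfolding Y2 by (simp add: algebra_simps power2_eq_square)
      also have "c * (a * deriv G z + b * deriv H z) = V (\<omega> z) * (a * G z + b * H z)"
        unfolding c_def using y[OF z wz] by blast
      finally have "(\<omega> z * deriv V (\<omega> z) + (V (\<omega> z))\<^sup>2 - s * V (\<omega> z)) * (a * G z + b * H z) =
         (- (c * p) * V (\<omega> z) - c\<^sup>2 * q) * (a * G z + b * H z)"
        unfolding R by (simp add: algebra_simps)
      then show ?thesis using y[OF z wz] by simp
    qed
    have r1: "\<omega> z * deriv V1 (\<omega> z) + (V1 (\<omega> z))\<^sup>2 - s * V1 (\<omega> z) = - (c * p) * V1 (\<omega> z) - c\<^sup>2 * q"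
      by (rule ric[OF V(1) y1])
    have r2: "\<omega> z * deriv V2 (\<omega> z) + (V2 (\<omega> z))\<^sup>2 - s * V2 (\<omega> z) = - (c * p) * V2 (\<omega> z) - c\<^sup>2 * q"
      by (rule ric[OF V(2) y2])
    have d\<delta>: "deriv \<delta> (\<omega> z) = deriv V1 (\<omega> z) - deriv V2 (\<omega> z)"
      unfolding \<delta>_def using wz V holomorphic_on_imp_differentiable_at[OF _ open_ball]
      by (intro deriv_diff) auto
    have "\<omega> z * deriv V1 (\<omega> z) - \<omega> z * deriv V2 (\<omega> z) = \<Lambda> (\<omega> z) * (V1 (\<omega> z) - V2 (\<omega> z))"
      using \<delta>(2) unfolding d\<delta> by (simp only: \<delta>_def right_diff_distrib)
    then have "\<delta> (\<omega> z) * (c * p) = \<delta> (\<omega> z) * A (\<omega> z)"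
      using r1 r2 unfolding \<delta>_def A_def by algebra
    then have cp: "c * p = A (\<omega> z)" using \<delta>(1) by simp
    have "c\<^sup>2 * q = - A (\<omega> z) * V1 (\<omega> z) - (\<omega> z * deriv V1 (\<omega> z) + (V1 (\<omega> z))\<^sup>2 - s * V1 (\<omega> z))"
      unfolding r1 cp by simp
    then have "c\<^sup>2 * q = B (\<omega> z)" unfolding B_def by (simp add: algebra_simps)
    then show ?thesis using W cp by (simp add: c_def p_def q_def)
  qed
  have real: "(\<forall>x. of_real x \<in> ball (0::complex) r \<longrightarrow> V1 (of_real x) \<in> \<real> \<and> V2 (of_real x) \<in> \<real>) \<and> s \<in> \<real> \<longrightarrow>
     (\<forall>x. of_real x \<in> ball (0::complex) r' \<longrightarrow> A (of_real x) \<in> \<real> \<and> B (of_real x) \<in> \<real>)"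
  proof (intro impI allI)
    fix x
    assume v: "(\<forall>x. of_real x \<in> ball (0::complex) r \<longrightarrow> V1 (of_real x) \<in> \<real> \<and> V2 (of_real x) \<in> \<real>) \<and> s \<in> \<real>"
      and x: "of_real x \<in> ball (0::complex) r'"
    have "\<forall>x. of_real x \<in> ball (0::complex) r \<longrightarrow> \<delta> (of_real x) \<in> \<real>" using v by (simp add: \<delta>_def)
    then have l: "\<Lambda> (of_real x) \<in> \<real>" using \<Lambda>(5) x by blast
    have xr: "of_real x \<in> ball (0::complex) r" using x sub by blast
    have V12: "V1 (of_real x) \<in> \<real>" "V2 (of_real x) \<in> \<real>" "s \<in> \<real>" using v xr by auto
    have "deriv V1 (of_real x) \<in> \<real>"
      by (rule deriv_real_on_reals[OF V(1) open_ball xr]) (use v in auto)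
    moreover have "A (of_real x) \<in> \<real>" unfolding A_def using l V12 by (intro Reals_diff)
    ultimately show "A (of_real x) \<in> \<real> \<and> B (of_real x) \<in> \<real>"
      unfolding B_def using V12 by simp
  qed
  show ?thesis by (rule that[OF \<Lambda>(1,2) hA hB main real])
qed

section \<open>Fuchsian singularities on the boundary\<close>

lemma binary_quadratic_form_square:
  fixes \<alpha> \<beta> \<gamma> :: complex
  assumes "\<beta>\<^sup>2 = 4 * \<alpha> * \<gamma>"
  obtains a b where "a\<^sup>2 = \<alpha>" "2 * a * b = \<beta>" "b\<^sup>2 = \<gamma>"
proof (cases "\<alpha> = 0")
  case True
  then show ?thesis using that[of 0 "csqrt \<gamma>"] assms by simp
next
  case False
  show ?thesis
  proof (rule that[of "csqrt \<alpha>" "\<beta> / (2 * csqrt \<alpha>)"])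
    show "(\<beta> / (2 * csqrt \<alpha>))\<^sup>2 = \<gamma>"
      using False assms by (simp add: power_divide power_mult_distrib)
  qed (use False in auto)
qed

text \<open>
  The discriminant of the quadratic form \<open>\<Phi> v \<plusminus> \<i>\<Phi> w\<close> in \<open>G, H\<close> is the bilinear square of \<open>v \<plusminus> \<i>w\<close>, up
  to a factor, and vanishes because \<open>v, w\<close> are orthonormal. The determinant of the two linear forms has square \<open>4\<close>: twice the
  Hermitian square of \<open>v + \<i>w\<close>.
\<close>

lemma weier_form_isotropic_squares:
  assumes v: "norm v = 1" and w: "norm w = 1" and vw: "v \<bullet> w = 0"
  obtains a1 b1 a2 b2 where "a1 * b2 - a2 * b1 \<noteq> 0"
    "\<And>z. weier_form G H v z + \<i> * weier_form G H w z = (a1 * G z + b1 * H z)\<^sup>2"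
    "\<And>z. weier_form G H v z - \<i> * weier_form G H w z = (a2 * G z + b2 * H z)\<^sup>2"
proof -
  define x1 x2 x3 y1 y2 y3 where "x1 = complex_of_real (v $ 1)" and "x2 = complex_of_real (v $ 2)"
    and "x3 = complex_of_real (v $ 3)" and "y1 = complex_of_real (w $ 1)" and "y2 = complex_of_real (w $ 2)"
    and "y3 = complex_of_real (w $ 3)"
  note defs = x1_def x2_def x3_def y1_def y2_def y3_def
  have "v \<bullet> v = 1" "w \<bullet> w = 1" using v w by (auto simp: norm_eq_1)
  then have "v$1 * v$1 + v$2 * v$2 + v$3 * v$3 = 1" "w$1 * w$1 + w$2 * w$2 + w$3 * w$3 = 1"
    "v$1 * w$1 + v$2 * w$2 + v$3 * w$3 = 0"
    using vw by (simp_all add: inner_vec_def sum_3)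
  then have "complex_of_real (v$1 * v$1 + v$2 * v$2 + v$3 * v$3) = of_real 1"
    "complex_of_real (w$1 * w$1 + w$2 * w$2 + w$3 * w$3) = of_real 1"
    "complex_of_real (v$1 * w$1 + v$2 * w$2 + v$3 * w$3) = of_real 0" by (simp_all only:)
  then have n: "x1\<^sup>2 + x2\<^sup>2 + x3\<^sup>2 = 1" "y1\<^sup>2 + y2\<^sup>2 + y3\<^sup>2 = 1" "x1 * y1 + x2 * y2 + x3 * y3 = 0"
    by (simp_all add: defs power2_eq_square)
  have i2: "\<i>\<^sup>2 = -1" by simp
  define \<alpha>1 \<beta>1 \<gamma>1 where "\<alpha>1 = (x2 + \<i> * y2) + \<i> * (x1 + \<i> * y1)" and "\<beta>1 = 2 * \<i> * (x3 + \<i> * y3)"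
    and "\<gamma>1 = (x2 + \<i> * y2) - \<i> * (x1 + \<i> * y1)"
  define \<alpha>2 \<beta>2 \<gamma>2 where "\<alpha>2 = (x2 - \<i> * y2) + \<i> * (x1 - \<i> * y1)" and "\<beta>2 = 2 * \<i> * (x3 - \<i> * y3)"
    and "\<gamma>2 = (x2 - \<i> * y2) - \<i> * (x1 - \<i> * y1)"
  have "\<beta>1\<^sup>2 = 4 * \<alpha>1 * \<gamma>1" unfolding \<alpha>1_def \<beta>1_def \<gamma>1_def using n i2 by algebra
  then obtain a1 b1 where ab1: "a1\<^sup>2 = \<alpha>1" "2 * a1 * b1 = \<beta>1" "b1\<^sup>2 = \<gamma>1"
    by (rule binary_quadratic_form_square)
  have "\<beta>2\<^sup>2 = 4 * \<alpha>2 * \<gamma>2" unfolding \<alpha>2_def \<beta>2_def \<gamma>2_def using n i2 by algebra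
  then obtain a2 b2 where ab2: "a2\<^sup>2 = \<alpha>2" "2 * a2 * b2 = \<beta>2" "b2\<^sup>2 = \<gamma>2"
    by (rule binary_quadratic_form_square)
  have "2 * (a1 * b2 - a2 * b1)\<^sup>2 = 2 * (\<alpha>1 * \<gamma>2 + \<alpha>2 * \<gamma>1) - \<beta>1 * \<beta>2"
    unfolding ab1[symmetric] ab2[symmetric] by (simp add: power2_eq_square algebra_simps)
  also have "\<dots> = 8" unfolding \<alpha>1_def \<beta>1_def \<gamma>1_def \<alpha>2_def \<beta>2_def \<gamma>2_def using n i2 by algebra
  finally have det: "a1 * b2 - a2 * b1 \<noteq> 0" by auto
  show ?thesis
  proof (rule that[OF det])
    fix z
    have "weier_form G H v z + \<i> * weier_form G H w z = \<alpha>1 * (G z)\<^sup>2 + \<beta>1 * (G z * H z) + \<gamma>1 * (H z)\<^sup>2"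
      by (simp add: weier_form_def \<alpha>1_def \<beta>1_def \<gamma>1_def defs algebra_simps)
    also have "\<dots> = (a1 * G z + b1 * H z)\<^sup>2"
      unfolding ab1[symmetric] by (simp add: power2_eq_square algebra_simps)
    finally show "weier_form G H v z + \<i> * weier_form G H w z = (a1 * G z + b1 * H z)\<^sup>2" .
    have "weier_form G H v z - \<i> * weier_form G H w z = \<alpha>2 * (G z)\<^sup>2 + \<beta>2 * (G z * H z) + \<gamma>2 * (H z)\<^sup>2"
      by (simp add: weier_form_def \<alpha>2_def \<beta>2_def \<gamma>2_def defs algebra_simps)
    also have "\<dots> = (a2 * G z + b2 * H z)\<^sup>2"
      unfolding ab2[symmetric] by (simp add: power2_eq_square algebra_simps)
    finally show "weier_form G H v z - \<i> * weier_form G H w z = (a2 * G z + b2 * H z)\<^sup>2" .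
  qed
qed

lemma wronskian_zero_of_dependent:
  assumes G: "G holomorphic_on upper_hp" and H: "H holomorphic_on upper_hp" and z: "z \<in> upper_hp"
    and ab: "a \<noteq> 0 \<or> b \<noteq> 0" and dep: "\<And>z. z \<in> upper_hp \<Longrightarrow> a * G z + b * H z = 0"
  shows "wronskian G H z = 0"
proof -
  have d: "(G has_field_derivative deriv G z) (at z)" "(H has_field_derivative deriv H z) (at z)"
    using holomorphic_derivI[OF _ open_upper_hp z] G H by blast+
  have ev: "\<forall>\<^sub>F \<zeta> in nhds z. a * G \<zeta> + b * H \<zeta> = 0"
    using eventually_nhds_in_open[OF open_upper_hp z] by eventually_elim (rule dep)
  have d1: "((\<lambda>\<zeta>. a * G \<zeta> + b * H \<zeta>) has_field_derivative a * deriv G z + b * deriv H z) (at z)"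
    by (rule derivative_eq_intros d refl)+ simp
  have "a * deriv G z + b * deriv H z = 0"
    by (rule DERIV_unique[OF d1 iffD2[OF DERIV_cong_ev[OF refl ev refl] DERIV_const]])
  then have "a * wronskian G H z = 0" "b * wronskian G H z = 0"
    using dep[OF z] unfolding wronskian_def by algebra+
  then show ?thesis using ab by auto
qed

text \<open>
  \<open>boundary_exponent\<close> for the pullback of \<open>h = y\<^sup>2\<close> under the inverse \<open>m\<close> of a local coordinate \<open>\<omega>\<close>. Its
  logarithmic derivative is twice that of \<open>y\<close>.
\<close>

lemma exponent_of_square:
  fixes G H m dm \<omega> :: "complex \<Rightarrow> complex" and r \<beta> C :: real
  assumes G: "G holomorphic_on upper_hp" and H: "H holomorphic_on upper_hp"
    and nd: "z0 \<in> upper_hp" "wronskian G H z0 \<noteq> 0" and ab: "a \<noteq> 0 \<or> b \<noteq> 0"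
    and r: "0 < r" "r \<le> 1"
    and m: "\<And>w. w \<in> upper_hp \<Longrightarrow> m w \<in> upper_hp \<and> (m has_field_derivative dm w) (at w)"
      "\<And>w. w \<in> upper_hp \<Longrightarrow> w * dm w = s * (m w - t)"
      "\<And>z. z \<in> upper_hp \<Longrightarrow> \<omega> z \<in> upper_hp \<and> m (\<omega> z) = z" "continuous_on upper_hp \<omega>"
      "\<And>w. w \<in> upper_hp \<Longrightarrow> \<omega> (m w) = w"
    and right: "\<And>x. 0 < x \<Longrightarrow> x < r \<Longrightarrow> \<exists>L\<in>\<real>. ((\<lambda>w. (a * G (m w) + b * H (m w))\<^sup>2) \<longlongrightarrow> L) (at (of_real x) within upper_hp)"
    and left: "\<And>x. - r < x \<Longrightarrow> x < 0 \<Longrightarrow> \<exists>L\<in>\<real>. ((\<lambda>w. exp (- \<i> * of_real \<beta>) * (a * G (m w) + b * H (m w))\<^sup>2) \<longlongrightarrow> L) (at (of_real x) within upper_hp)"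
    and growth: "\<And>w. w \<in> ball 0 r \<inter> upper_hp \<Longrightarrow> norm ((a * G (m w) + b * H (m w))\<^sup>2) \<le> C / norm w ^ M"
  obtains r' V where "0 < r'" "r' \<le> r" "V holomorphic_on ball 0 r'"
    "\<And>x. of_real x \<in> ball (0::complex) r' \<Longrightarrow> V (of_real x) \<in> \<real>"
    "\<And>z. z \<in> upper_hp \<Longrightarrow> \<omega> z \<in> ball 0 r' \<Longrightarrow> a * G z + b * H z \<noteq> 0 \<and>
       s * (z - t) * (a * deriv G z + b * deriv H z) = V (\<omega> z) * (a * G z + b * H z)"
proof -
  define Y Y' where "Y z = a * G z + b * H z" and "Y' z = a * deriv G z + b * deriv H z" for z
  define h where "h w = (Y (m w))\<^sup>2" for w
  have hY: "Y holomorphic_on upper_hp" unfolding Y_def by (intro holomorphic_intros G H)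
  have dY: "(Y has_field_derivative Y' z) (at z)" if "z \<in> upper_hp" for z
    unfolding Y_def Y'_def using holomorphic_derivI[OF G open_upper_hp that] holomorphic_derivI[OF H open_upper_hp that]
    by (auto intro!: derivative_eq_intros)
  have dh: "(h has_field_derivative 2 * Y (m w) * (Y' (m w) * dm w)) (at w)" if w: "w \<in> upper_hp" for w
  proof -
    have "((\<lambda>w. Y (m w)) has_field_derivative Y' (m w) * dm w) (at w)"
      using DERIV_chain2[OF dY] m(1)[OF w] by blast
    then show ?thesis unfolding h_def by (auto intro!: derivative_eq_intros)
  qed
  have hh: "h holomorphic_on ball 0 r \<inter> upper_hp"
    using dh by (subst holomorphic_on_open) (auto intro!: open_Int open_upper_hp)
  obtain z1 where z1: "z1 \<in> upper_hp" "\<omega> z1 \<in> ball 0 r" "Y z1 \<noteq> 0"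
  proof -
    have "\<not> (\<forall>z\<in>upper_hp. Y z = 0)"
      using wronskian_zero_of_dependent[OF G H nd(1) ab] nd(2) unfolding Y_def by blast
    then obtain z2 where z2: "z2 \<in> upper_hp" "Y z2 \<noteq> 0" by blast
    have "open (upper_hp \<inter> \<omega> -` ball 0 r)"
      by (intro continuous_open_preimage m(4) open_upper_hp open_ball)
    moreover have "of_real (r/2) * \<i> \<in> upper_hp \<inter> ball 0 r" using r by (auto simp: upper_hp_def norm_mult)
    then have "m (of_real (r/2) * \<i>) \<in> upper_hp \<inter> \<omega> -` ball 0 r" using m(1,5) by auto
    ultimately obtain z where "z \<in> upper_hp \<inter> \<omega> -` ball 0 r" "Y z \<noteq> 0"
      using nonzero_in_open_subset[OF hY z2] by blast
    then show ?thesis using that by auto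
  qed
  have h1: "\<omega> z1 \<in> ball 0 r \<inter> upper_hp" "h (\<omega> z1) \<noteq> 0" using z1 m(3) by (auto simp: h_def)
  obtain r' U where U: "0 < r'" "r' \<le> r" "U holomorphic_on ball 0 r'"
    "\<And>x. of_real x \<in> ball (0::complex) r' \<Longrightarrow> U (of_real x) \<in> \<real>"
    "\<And>w. w \<in> ball 0 r' \<inter> upper_hp \<Longrightarrow> h w \<noteq> 0 \<and> w * deriv h w = U w * h w"
    using boundary_exponent[OF r(1) hh _ _ _ h1 r(2), of \<beta> C M] right left growth
    unfolding h_def Y_def by blast
  show ?thesis
  proof (rule that[of r' "\<lambda>w. U w / 2"])
    show "(\<lambda>w. U w / 2) holomorphic_on ball 0 r'" by (intro holomorphic_intros U) auto
    show "U (of_real x) / 2 \<in> \<real>" if "of_real x \<in> ball (0::complex) r'" for x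
      using U(4)[OF that] by (intro Reals_divide) auto
    show "a * G z + b * H z \<noteq> 0 \<and> s * (z - t) * (a * deriv G z + b * deriv H z) = U (\<omega> z) / 2 * (a * G z + b * H z)"
      if z: "z \<in> upper_hp" "\<omega> z \<in> ball 0 r'" for z
    proof -
      have w: "\<omega> z \<in> ball 0 r' \<inter> upper_hp" "\<omega> z \<in> upper_hp" "m (\<omega> z) = z" using z m(3) by auto
      have "deriv h (\<omega> z) = 2 * Y z * (Y' z * dm (\<omega> z))"
        using DERIV_imp_deriv[OF dh[OF w(2)]] w(3) by simp
      then have "2 * Y z * (Y' z * (\<omega> z * dm (\<omega> z))) = U (\<omega> z) * (Y z)\<^sup>2"
        using U(5)[OF w(1)] w(3) by (simp add: h_def mult_ac)
      then have e: "2 * Y z * (Y' z * (s * (z - t))) = U (\<omega> z) * (Y z)\<^sup>2" using m(2)[OF w(2)] w(3) by simp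
      have Yn: "Y z \<noteq> 0" using U(5)[OF w(1)] w(3) by (simp add: h_def)
      have "(2 * Y z) * (s * (z - t) * Y' z) = (2 * Y z) * (U (\<omega> z) / 2 * Y z)"
        using e by (simp add: power2_eq_square mult_ac)
      then have "s * (z - t) * Y' z = U (\<omega> z) / 2 * Y z"
        by (rule mult_left_cancel[THEN iffD1, rotated]) (use Yn in simp)
      then show ?thesis using Yn by (simp add: Y_def Y'_def)
    qed
  qed (use U in auto)
qed

context weierstrass_surface
begin

text \<open>
  The coordinate \<open>\<omega>\<close> sends the boundary point to \<open>0\<close> and has inverse \<open>m\<close>, whose boundary map is \<open>\<nu>\<close>; right
  and left refer to positive and negative values of \<open>\<omega>\<close>. The frame \<open>d', e'\<close> of the left side arises from
  the frame \<open>d, e\<close> of the right side by a rotation through \<open>\<beta>\<close>, so \<open>\<Phi> d \<plusminus> \<i>\<Phi> e\<close> is \<open>exp (\<plusminus>\<i>\<beta>)\<close> times the same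
  combination for \<open>d', e'\<close>.
\<close>

lemma boundary_fuchsian:
  fixes m dm \<omega> \<omega>' :: "complex \<Rightarrow> complex" and \<nu> :: "real \<Rightarrow> real" and r C :: real
  assumes nd: "z0 \<in> upper_hp" "wronskian G H z0 \<noteq> 0" and r: "0 < r" "r \<le> 1" and s: "s \<in> \<real>"
    and m: "\<And>w. w \<in> upper_hp \<Longrightarrow> m w \<in> upper_hp \<and> (m has_field_derivative dm w) (at w)"
      "\<And>w. w \<in> upper_hp \<Longrightarrow> w * dm w = s * (m w - t)"
      "\<And>z. z \<in> upper_hp \<Longrightarrow> \<omega> z \<in> upper_hp \<and> m (\<omega> z) = z"
      "\<And>w. w \<in> upper_hp \<Longrightarrow> \<omega> (m w) = w"
    and \<omega>: "\<And>z. z \<in> upper_hp \<Longrightarrow> (\<omega> has_field_derivative \<omega>' z) (at z) \<and> s * (z - t) * \<omega>' z = \<omega> z"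
    and \<nu>: "\<And>x. x \<noteq> 0 \<Longrightarrow> filterlim m (at (of_real (\<nu> x)) within upper_hp) (at (of_real x) within upper_hp)"
    and right: "norm d = 1" "\<And>x. 0 < x \<Longrightarrow> x < r \<Longrightarrow> \<exists>a b. a < \<nu> x \<and> \<nu> x < b \<and> on_line X {a<..<b} d"
    and left: "norm d' = 1" "\<And>x. - r < x \<Longrightarrow> x < 0 \<Longrightarrow> \<exists>a b. a < \<nu> x \<and> \<nu> x < b \<and> on_line X {a<..<b} d'"
    and growth: "\<And>v w. w \<in> ball 0 r \<inter> upper_hp \<Longrightarrow> norm v \<le> 1 \<Longrightarrow> norm (\<Phi> v (m w)) \<le> C / norm w ^ M"
  obtains r' A B where "0 < r'" "A holomorphic_on ball 0 r'" "B holomorphic_on ball 0 r'"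
    "\<And>x. of_real x \<in> ball (0::complex) r' \<Longrightarrow> A (of_real x) \<in> \<real>"
    "\<And>x. of_real x \<in> ball (0::complex) r' \<Longrightarrow> B (of_real x) \<in> \<real>"
    "\<And>z. z \<in> upper_hp \<Longrightarrow> \<omega> z \<in> ball 0 r' \<Longrightarrow>
       s * (z - t) * coeff_p G H z = A (\<omega> z) \<and> (s * (z - t))\<^sup>2 * coeff_q G H z = B (\<omega> z)"
proof -
  obtain e \<beta> where e: "norm e = 1" "e \<bullet> d = 0" "d' = cos \<beta> *\<^sub>R d + sin \<beta> *\<^sub>R e"
    using unit_vectors_in_frame[OF right(1) left(1)] by blast
  \<comment> \<open>\<open>e'\<close> completes \<open>d'\<close> to an orthonormal basis of the plane of \<open>d, e\<close>.\<close>
  define e' where "e' = (- sin \<beta>) *\<^sub>R d + cos \<beta> *\<^sub>R e"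
  have de: "d \<bullet> d = 1" "e \<bullet> e = 1" "d \<bullet> e = 0" using right(1) e by (auto simp: norm_eq_1 inner_commute)
  have e'd': "e' \<bullet> d' = 0"
    unfolding e'_def e(3) by (simp add: inner_add_left inner_add_right inner_diff_left de e(2))
  have cis: "exp (\<i> * of_real \<beta>) = of_real (cos \<beta>) + \<i> * of_real (sin \<beta>)"
    "exp (- \<i> * of_real \<beta>) = of_real (cos \<beta>) - \<i> * of_real (sin \<beta>)"
    using cis_conv_exp[of \<beta>] cis_conv_exp[of "-\<beta>"] by (auto simp: complex_eq_iff cis.simps simp flip: cis_conv_exp)
  have rot: "exp (- \<i> * of_real \<beta>) * (\<Phi> d z + \<i> * \<Phi> e z) = \<Phi> d' z + \<i> * \<Phi> e' z"
    "exp (\<i> * of_real \<beta>) * (\<Phi> d z - \<i> * \<Phi> e z) = \<Phi> d' z - \<i> * \<Phi> e' z" for z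
    unfolding e(3) e'_def weier_form_add weier_form_scaleR cis
    by (simp_all add: algebra_simps)
  obtain a1 b1 a2 b2 where sq: "a1 * b2 - a2 * b1 \<noteq> 0"
    "\<And>z. \<Phi> d z + \<i> * \<Phi> e z = (a1 * G z + b1 * H z)\<^sup>2"
    "\<And>z. \<Phi> d z - \<i> * \<Phi> e z = (a2 * G z + b2 * H z)\<^sup>2"
    by (rule weier_form_isotropic_squares[OF right(1) e(1) de(3), where G = G and H = H]) (rule that; assumption)
  have lim: "\<exists>L\<in>\<real>. ((\<lambda>w. \<Phi> u (m w) + \<i> * \<Phi> v (m w)) \<longlongrightarrow> L) (at (of_real x) within upper_hp)"
    "\<exists>L\<in>\<real>. ((\<lambda>w. \<Phi> u (m w) - \<i> * \<Phi> v (m w)) \<longlongrightarrow> L) (at (of_real x) within upper_hp)"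
    if x: "x \<noteq> 0" and ab: "\<exists>a b. a < \<nu> x \<and> \<nu> x < b \<and> on_line X {a<..<b} u" and u: "norm u = 1" "v \<bullet> u = 0" for x u v
  proof -
    obtain a b where ab': "a < \<nu> x" "\<nu> x < b" "on_line X {a<..<b} u" using ab by blast
    obtain L where L: "L \<in> \<real>" "(\<Phi> u \<longlongrightarrow> L) (at (of_real (\<nu> x)) within upper_hp)"
      using side_limits(2)[OF ab'(3) u(1) ab'(1,2)] by blast
    obtain K where K: "Re K = 0" "(\<Phi> v \<longlongrightarrow> K) (at (of_real (\<nu> x)) within upper_hp)"
      using side_limits(1)[OF ab'(3) u(1) ab'(1,2) u(2)] by blast
    have L': "((\<lambda>w. \<Phi> u (m w)) \<longlongrightarrow> L) (at (of_real x) within upper_hp)"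
      by (rule filterlim_compose[OF L(2) \<nu>[OF x]])
    have K': "((\<lambda>w. \<Phi> v (m w)) \<longlongrightarrow> K) (at (of_real x) within upper_hp)"
      by (rule filterlim_compose[OF K(2) \<nu>[OF x]])
    have iK: "\<i> * K \<in> \<real>" using K(1) by (simp add: complex_is_Real_iff)
    show "\<exists>L\<in>\<real>. ((\<lambda>w. \<Phi> u (m w) + \<i> * \<Phi> v (m w)) \<longlongrightarrow> L) (at (of_real x) within upper_hp)"
      using L(1) iK by (intro bexI[of _ "L + \<i> * K"] tendsto_intros L' K') auto
    show "\<exists>L\<in>\<real>. ((\<lambda>w. \<Phi> u (m w) - \<i> * \<Phi> v (m w)) \<longlongrightarrow> L) (at (of_real x) within upper_hp)"
      using L(1) iK by (intro bexI[of _ "L - \<i> * K"] tendsto_intros L' K') auto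
  qed
  have gr: "norm (\<Phi> d (m w) + \<i> * \<Phi> e (m w)) \<le> (2 * C) / norm w ^ M"
    "norm (\<Phi> d (m w) - \<i> * \<Phi> e (m w)) \<le> (2 * C) / norm w ^ M" if "w \<in> ball 0 r \<inter> upper_hp" for w
    using growth[OF that, of d] growth[OF that, of e] right(1) e(1)
      norm_triangle_ineq[of "\<Phi> d (m w)" "\<i> * \<Phi> e (m w)"] norm_triangle_ineq4[of "\<Phi> d (m w)" "\<i> * \<Phi> e (m w)"]
    by (auto simp: norm_mult)
  have cont\<omega>: "continuous_on upper_hp \<omega>"
    using \<omega> DERIV_isCont continuous_at_imp_continuous_on by blast
  have ab: "a1 \<noteq> 0 \<or> b1 \<noteq> 0" "a2 \<noteq> 0 \<or> b2 \<noteq> 0" using sq(1) by auto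
  obtain r1 V1 where V1: "0 < r1" "r1 \<le> r" "V1 holomorphic_on ball 0 r1"
    "\<And>x. of_real x \<in> ball (0::complex) r1 \<Longrightarrow> V1 (of_real x) \<in> \<real>"
    "\<And>z. z \<in> upper_hp \<Longrightarrow> \<omega> z \<in> ball 0 r1 \<Longrightarrow> a1 * G z + b1 * H z \<noteq> 0 \<and>
       s * (z - t) * (a1 * deriv G z + b1 * deriv H z) = V1 (\<omega> z) * (a1 * G z + b1 * H z)"
  proof (rule exponent_of_square[OF holG holH nd ab(1) r m(1-3) cont\<omega> m(4)])
    show "\<exists>L\<in>\<real>. ((\<lambda>w. (a1 * G (m w) + b1 * H (m w))\<^sup>2) \<longlongrightarrow> L) (at (of_real x) within upper_hp)"
      if "0 < x" "x < r" for x
      using lim(1)[OF _ right(2)[OF that] right(1) e(2)] that unfolding sq(2) by simp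
    show "\<exists>L\<in>\<real>. ((\<lambda>w. exp (- \<i> * of_real \<beta>) * (a1 * G (m w) + b1 * H (m w))\<^sup>2) \<longlongrightarrow> L) (at (of_real x) within upper_hp)"
      if "- r < x" "x < 0" for x
      using lim(1)[OF _ left(2)[OF that] left(1) e'd'] that unfolding rot(1)[symmetric] sq(2) by simp
    show "norm ((a1 * G (m w) + b1 * H (m w))\<^sup>2) \<le> (2 * C) / norm w ^ M" if "w \<in> ball 0 r \<inter> upper_hp" for w
      using gr(1)[OF that] unfolding sq(2) .
  qed (assumption | (rule that; assumption))+
  obtain r2 V2 where V2: "0 < r2" "r2 \<le> r" "V2 holomorphic_on ball 0 r2"
    "\<And>x. of_real x \<in> ball (0::complex) r2 \<Longrightarrow> V2 (of_real x) \<in> \<real>"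
    "\<And>z. z \<in> upper_hp \<Longrightarrow> \<omega> z \<in> ball 0 r2 \<Longrightarrow> a2 * G z + b2 * H z \<noteq> 0 \<and>
       s * (z - t) * (a2 * deriv G z + b2 * deriv H z) = V2 (\<omega> z) * (a2 * G z + b2 * H z)"
  proof (rule exponent_of_square[OF holG holH nd ab(2) r m(1-3) cont\<omega> m(4)])
    show "\<exists>L\<in>\<real>. ((\<lambda>w. (a2 * G (m w) + b2 * H (m w))\<^sup>2) \<longlongrightarrow> L) (at (of_real x) within upper_hp)"
      if "0 < x" "x < r" for x
      using lim(2)[OF _ right(2)[OF that] right(1) e(2)] that unfolding sq(3) by simp
    show "\<exists>L\<in>\<real>. ((\<lambda>w. exp (- \<i> * of_real (- \<beta>)) * (a2 * G (m w) + b2 * H (m w))\<^sup>2) \<longlongrightarrow> L) (at (of_real x) within upper_hp)"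
      if "- r < x" "x < 0" for x
      using lim(2)[OF _ left(2)[OF that] left(1) e'd'] that unfolding rot(2)[symmetric] sq(3) by simp
    show "norm ((a2 * G (m w) + b2 * H (m w))\<^sup>2) \<le> (2 * C) / norm w ^ M" if "w \<in> ball 0 r \<inter> upper_hp" for w
      using gr(2)[OF that] unfolding sq(3) .
  qed (assumption | (rule that; assumption))+
  define \<rho> where "\<rho> = min r1 r2"
  have \<rho>: "0 < \<rho>" "\<rho> \<le> r1" "\<rho> \<le> r2" using V1(1) V2(1) by (auto simp: \<rho>_def)
  have sub: "ball 0 \<rho> \<subseteq> ball (0::complex) r1" "ball 0 \<rho> \<subseteq> ball (0::complex) r2" using \<rho> by auto
  have hW: "wronskian G H holomorphic_on upper_hp" by (rule holomorphic_wronskian[OF holG holH])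
  obtain z1 where z1: "z1 \<in> upper_hp" "\<omega> z1 \<in> ball 0 \<rho> - {0}" "wronskian G H z1 \<noteq> 0"
  proof -
    have "open (upper_hp \<inter> \<omega> -` ball 0 \<rho>)"
      by (intro continuous_open_preimage cont\<omega> open_upper_hp open_ball)
    moreover have "of_real (\<rho>/2) * \<i> \<in> upper_hp \<inter> ball 0 \<rho>" using \<rho> by (auto simp: upper_hp_def norm_mult)
    then have "m (of_real (\<rho>/2) * \<i>) \<in> upper_hp \<inter> \<omega> -` ball 0 \<rho>" using m(1,4) by auto
    ultimately obtain z where "z \<in> upper_hp \<inter> \<omega> -` ball 0 \<rho>" "wronskian G H z \<noteq> 0"
      using nonzero_in_open_subset[OF hW nd] by blast
    moreover from this have "\<omega> z \<noteq> 0" using m(3)[of z] by (auto simp: upper_hp_def)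
    ultimately show ?thesis using that by auto
  qed
  have V\<rho>: "V1 holomorphic_on ball 0 \<rho>" "V2 holomorphic_on ball 0 \<rho>"
    using V1(3) V2(3) sub holomorphic_on_subset by blast+
  have Y1: "a1 * G z + b1 * H z \<noteq> 0 \<and>
       s * (z - t) * (a1 * deriv G z + b1 * deriv H z) = V1 (\<omega> z) * (a1 * G z + b1 * H z)"
    if "z \<in> upper_hp" "\<omega> z \<in> ball 0 \<rho> - {0}" for z
    using V1(5)[OF that(1)] that(2) sub(1) by blast
  have Y2: "a2 * G z + b2 * H z \<noteq> 0 \<and>
       s * (z - t) * (a2 * deriv G z + b2 * deriv H z) = V2 (\<omega> z) * (a2 * G z + b2 * H z)"
    if "z \<in> upper_hp" "\<omega> z \<in> ball 0 \<rho> - {0}" for z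
    using V2(5)[OF that(1)] that(2) sub(2) by blast
  obtain r' A B where AB: "0 < r'" "r' \<le> \<rho>" "A holomorphic_on ball 0 r'" "B holomorphic_on ball 0 r'"
    "\<And>z. z \<in> upper_hp \<Longrightarrow> \<omega> z \<in> ball 0 r' - {0} \<Longrightarrow> wronskian G H z \<noteq> 0 \<and>
       s * (z - t) * coeff_p G H z = A (\<omega> z) \<and> (s * (z - t))\<^sup>2 * coeff_q G H z = B (\<omega> z)"
    "(\<forall>x. of_real x \<in> ball (0::complex) \<rho> \<longrightarrow> V1 (of_real x) \<in> \<real> \<and> V2 (of_real x) \<in> \<real>) \<and> s \<in> \<real> \<longrightarrow>
     (\<forall>x. of_real x \<in> ball (0::complex) r' \<longrightarrow> A (of_real x) \<in> \<real> \<and> B (of_real x) \<in> \<real>)"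
    by (rule fuchsian_in_local_coordinate[where \<omega> = \<omega> and \<omega>' = \<omega>' and s = s and t = t, OF holG holH \<omega> \<rho>(1) V\<rho> sq(1) Y1 Y2 z1])
       (assumption | (rule that; assumption))+
  have realV: "(\<forall>x. of_real x \<in> ball (0::complex) \<rho> \<longrightarrow> V1 (of_real x) \<in> \<real> \<and> V2 (of_real x) \<in> \<real>) \<and> s \<in> \<real>"
    using V1(4) V2(4) sub s by blast
  show ?thesis
  proof (rule that[OF AB(1,3,4)])
    show "A (of_real x) \<in> \<real>" if "of_real x \<in> ball (0::complex) r'" for x using AB(6) realV that by blast
    show "B (of_real x) \<in> \<real>" if "of_real x \<in> ball (0::complex) r'" for x using AB(6) realV that by blast
    show "s * (z - t) * coeff_p G H z = A (\<omega> z) \<and> (s * (z - t))\<^sup>2 * coeff_q G H z = B (\<omega> z)"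
      if "z \<in> upper_hp" "\<omega> z \<in> ball 0 r'" for z
    proof -
      have "\<omega> z \<noteq> 0" using m(3)[OF that(1)] by (auto simp: upper_hp_def)
      then show ?thesis using AB(5)[of z] that by blast
    qed
  qed
qed

end

section \<open>Reflecting the coefficients\<close>

lemma holomorphic_on_ball_imp_analytic_at: "h holomorphic_on ball z e \<Longrightarrow> e > 0 \<Longrightarrow> h analytic_on {z}"
  unfolding analytic_at by (metis centre_in_ball open_ball)

text \<open>
  The value on the real axis is the boundary limit, so that it agrees with every
  holomorphic continuation; where there is no limit it is an arbitrary default.
\<close>

definition reflected :: "(complex \<Rightarrow> complex) \<Rightarrow> complex \<Rightarrow> complex" where
  "reflected f z = (if Im z > 0 then f z else if Im z < 0 then cnj (f (cnj z)) else Lim (at z within upper_hp) f)"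

lemma reflected_upper: "z \<in> upper_hp \<Longrightarrow> reflected f z = f z"
  by (simp add: reflected_def upper_hp_def)

text \<open>
  To recognize the reflected function on a symmetric open set it suffices to have a continuous symmetric
  function there that agrees with \<open>f\<close> in the upper half-plane.
\<close>

lemma reflected_eqI:
  assumes \<Omega>: "open \<Omega>" "cnj ` \<Omega> \<subseteq> \<Omega>" and g: "continuous_on \<Omega> g" "\<And>z. z \<in> \<Omega> \<Longrightarrow> g (cnj z) = cnj (g z)"
    and fg: "\<And>z. z \<in> \<Omega> \<Longrightarrow> z \<in> upper_hp \<Longrightarrow> f z = g z" and z: "z \<in> \<Omega>"
  shows "reflected f z = g z"
proof -
  consider "Im z > 0" | "Im z < 0" | "Im z = 0" by linarith
  then show ?thesis
  proof cases
    case 1 then show ?thesis using fg z by (simp add: reflected_def upper_hp_def)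
  next
    case 2
    have "f (cnj z) = g (cnj z)" using fg[of "cnj z"] z \<Omega>(2) 2 by (auto simp: upper_hp_def)
    then show ?thesis using 2 g(2)[OF z] by (simp add: reflected_def)
  next
    case 3
    then have zr: "of_real (Re z) = z" by (simp add: complex_eq_iff)
    have "isCont g z" using g(1) \<Omega>(1) z continuous_on_eq_continuous_at by blast
    then have "(g \<longlongrightarrow> g z) (at z within upper_hp)" by (rule isCont_tendsto_within)
    moreover have "\<forall>\<^sub>F w in at z within upper_hp. g w = f w"
      using eventually_nhds_in_open[OF \<Omega>(1) z] unfolding eventually_at_filter
      by eventually_elim (simp add: fg)
    ultimately have "(f \<longlongrightarrow> g z) (at z within upper_hp)" by (rule Lim_transform_eventually)
    moreover have "at z within upper_hp \<noteq> bot" using real_at_within_upper_hp_neq_bot[of "Re z"] unfolding zr .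
    ultimately have "Lim (at z within upper_hp) f = g z" by (intro tendsto_Lim)
    then show ?thesis using 3 by (simp add: reflected_def)
  qed
qed

text \<open>
  Where the reflected function is continuous at a real point \<open>z\<close>, its value is the limit from above and
  from below. These limits are conjugate to each other.
\<close>

lemma real_on_real_axis_reflected: "real_on_real_axis (reflected f)"
  unfolding real_on_real_axis_def
proof (intro ballI impI)
  fix z :: complex assume zr: "z \<in> \<real>" and an: "reflected f analytic_on {z}"
  have c: "isCont (reflected f) z" using an analytic_at_imp_isCont by blast
  have lim: "((\<lambda>e. reflected f (z + of_real e * \<i>)) \<longlongrightarrow> reflected f z) (at_right (0::real))"
    "((\<lambda>e. reflected f (z - of_real e * \<i>)) \<longlongrightarrow> reflected f z) (at_right (0::real))"
  proof -
    have "((\<lambda>e. z + of_real e * \<i>) \<longlongrightarrow> z + of_real 0 * \<i>) (at_right (0::real))"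
      "((\<lambda>e. z - of_real e * \<i>) \<longlongrightarrow> z - of_real 0 * \<i>) (at_right (0::real))"
      by (intro tendsto_intros)+
    then show "((\<lambda>e. reflected f (z + of_real e * \<i>)) \<longlongrightarrow> reflected f z) (at_right (0::real))"
      "((\<lambda>e. reflected f (z - of_real e * \<i>)) \<longlongrightarrow> reflected f z) (at_right (0::real))"
      by (auto intro!: isCont_tendsto_compose[OF c])
  qed
  have "((\<lambda>e. cnj (reflected f (z + of_real e * \<i>))) \<longlongrightarrow> cnj (reflected f z)) (at_right (0::real))"
    by (intro tendsto_intros lim)
  moreover have "\<forall>\<^sub>F e in at_right (0::real). cnj (reflected f (z + of_real e * \<i>)) = reflected f (z - of_real e * \<i>)"
  proof -
    have "\<forall>\<^sub>F e in at_right (0::real). e > 0" by (simp add: eventually_at_filter)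
    then show ?thesis
    proof eventually_elim
      case (elim e)
      have "cnj (z - of_real e * \<i>) = z + of_real e * \<i>" using zr by (simp add: Reals_cnj_iff)
      moreover have "Im z = 0" using zr by (simp add: complex_is_Real_iff)
      ultimately show ?case using elim by (simp add: reflected_def)
    qed
  qed
  ultimately have "((\<lambda>e. reflected f (z - of_real e * \<i>)) \<longlongrightarrow> cnj (reflected f z)) (at_right (0::real))"
    by (rule Lim_transform_eventually)
  then have "cnj (reflected f z) = reflected f z"
    using lim(2) tendsto_unique trivial_limit_at_right_real by blast
  then show "reflected f z \<in> \<real>" by (simp add: Reals_cnj_iff)
qed

lemma pole_order_le_reflected_real:
  assumes A: "A holomorphic_on ball 0 r" "r > 0" "\<And>x. of_real x \<in> ball (0::complex) r \<Longrightarrow> A (of_real x) \<in> \<real>"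
    and eq: "\<And>z. z \<in> upper_hp \<Longrightarrow> z - of_real t \<in> ball 0 r \<Longrightarrow> (z - of_real t) ^ m * f z = A (z - of_real t)"
  shows "pole_order_le (reflected f) (of_real t) m"
proof -
  let ?\<Omega> = "ball (of_real t :: complex) r - {of_real t}"
  define h where "h z = A (z - of_real t)" for z
  have hh: "h holomorphic_on ball (of_real t) r"
    unfolding h_def by (rule holomorphic_on_compose_gen[OF _ A(1), unfolded o_def])
      (auto intro!: holomorphic_intros simp: dist_norm norm_minus_commute)
  have hc: "h (cnj z) = cnj (h z)" if "z \<in> ball (of_real t) r" for z
    using holomorphic_real_on_reals_symmetric[of h t r z] hh that A(3)[of "_ - t"]
    by (auto simp: h_def dist_norm norm_minus_commute simp flip: of_real_diff)
  have eq': "(z - of_real t) ^ m * reflected f z = h z" if z: "z \<in> ?\<Omega>" for z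
  proof -
    have "reflected f z = h z / (z - of_real t) ^ m"
    proof (rule reflected_eqI[OF _ _ _ _ _ z])
      show "open ?\<Omega>" by (simp add: open_delete)
      show "cnj ` ?\<Omega> \<subseteq> ?\<Omega>"
      proof (intro image_subsetI)
        fix z assume "z \<in> ?\<Omega>"
        then have "norm (cnj (z - of_real t)) < r" "cnj z \<noteq> cnj (of_real t)"
          by (simp_all only: complex_mod_cnj complex_cnj_cancel_iff) (auto simp: dist_norm norm_minus_commute)
        then show "cnj z \<in> ?\<Omega>" by (simp add: dist_norm norm_minus_commute)
      qed
      show "continuous_on ?\<Omega> (\<lambda>z. h z / (z - of_real t) ^ m)"
        by (intro continuous_intros continuous_on_subset[OF holomorphic_on_imp_continuous_on[OF hh]]) auto
      show "h (cnj z) / (cnj z - of_real t) ^ m = cnj (h z / (z - of_real t) ^ m)" if "z \<in> ?\<Omega>" for z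
        using hc[of z] that by simp
      show "f z = h z / (z - of_real t) ^ m" if "z \<in> ?\<Omega>" "z \<in> upper_hp" for z
        using eq[OF that(2)] that(1) by (auto simp: h_def dist_norm norm_minus_commute field_simps)
    qed
    then show ?thesis using z by simp
  qed
  have "\<forall>\<^sub>F w in at (of_real t). w \<in> ?\<Omega>"
    using eventually_at_in_open[of "ball (of_real t) r" "of_real t :: complex"] A(2) by simp
  then have "\<forall>\<^sub>F w in at (of_real t). (w - of_real t) ^ m * reflected f w = h w"
    by eventually_elim (rule eq')
  moreover have "h analytic_on {of_real t}"
    using hh A(2) by (rule holomorphic_on_ball_imp_analytic_at)
  ultimately show ?thesis unfolding pole_order_le_def extends_holomorphically_at_def by blast
qed

text \<open>
  The hypotheses are in the coordinate \<open>-1/z\<close>, which preserves the half-plane, while the Fuchsian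
  condition is in the coordinate \<open>1/z\<close>. The change of sign turns \<open>A\<close> into \<open>w \<mapsto> (-1)\<^sup>m A(-w)\<close>.
\<close>

lemma extends_reflected_at_infinity:
  assumes A: "A holomorphic_on ball 0 r" "r > 0" "\<And>x. of_real x \<in> ball (0::complex) r \<Longrightarrow> A (of_real x) \<in> \<real>"
    and eq: "\<And>z. z \<in> upper_hp \<Longrightarrow> - 1 / z \<in> ball 0 r \<Longrightarrow> (- z) ^ m * f z = A (- 1 / z)"
  shows "extends_holomorphically_at (\<lambda>w. reflected f (1 / w) / w ^ m) 0"
proof -
  let ?\<Omega> = "{z::complex. 1 / r < norm z}"
  have inb: "- 1 / z \<in> ball 0 r" "z \<noteq> 0" if "z \<in> ?\<Omega>" for z
  proof -
    show z0: "z \<noteq> 0" using that A(2) by (auto simp: divide_less_0_iff)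
    show "- 1 / z \<in> ball 0 r" using that z0 A(2) by (simp add: norm_divide field_simps)
  qed
  have eq': "reflected f z = A (- 1 / z) / (- z) ^ m" if z: "z \<in> ?\<Omega>" for z
  proof (rule reflected_eqI[OF _ _ _ _ _ z])
    show "open ?\<Omega>" by (intro open_Collect_less continuous_intros)
    show "cnj ` ?\<Omega> \<subseteq> ?\<Omega>" by auto
    show "continuous_on ?\<Omega> (\<lambda>z. A (- 1 / z) / (- z) ^ m)"
      using inb by (intro continuous_intros continuous_on_compose2[OF holomorphic_on_imp_continuous_on[OF A(1)]]) auto
    show "A (- 1 / cnj z) / (- cnj z) ^ m = cnj (A (- 1 / z) / (- z) ^ m)" if "z \<in> ?\<Omega>" for z
    proof -
      have "A (cnj (- 1 / z)) = cnj (A (- 1 / z))"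
        using holomorphic_real_on_reals_symmetric[of A 0 r "-1/z"] A inb(1)[OF that] by simp
      then show ?thesis by simp
    qed
    show "f z = A (- 1 / z) / (- z) ^ m" if "z \<in> ?\<Omega>" "z \<in> upper_hp" for z
      using eq[OF that(2) inb(1)[OF that(1)]] inb(2)[OF that(1)] by (simp add: field_simps)
  qed
  define h where "h w = (- 1) ^ m * A (- w)" for w
  have "h holomorphic_on ball 0 r"
    unfolding h_def by (intro holomorphic_intros holomorphic_on_compose_gen[OF _ A(1), unfolded o_def]) auto
  then have "h analytic_on {0}" using A(2) by (rule holomorphic_on_ball_imp_analytic_at)
  moreover have "\<forall>\<^sub>F w in at 0. w \<in> ball 0 r - {0}"
    by (rule eventually_at_in_open) (use A(2) in auto)
  then have "\<forall>\<^sub>F w in at 0. reflected f (1 / w) / w ^ m = h w"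
  proof eventually_elim
    case (elim w)
    have "1 / w \<in> ?\<Omega>" using elim A(2) by (simp add: norm_divide field_simps)
    from eq'[OF this] have "reflected f (1 / w) / w ^ m = A (- w) / ((- 1 / w) ^ m * w ^ m)" by simp
    also have "(- 1 / w) ^ m * w ^ m = (- 1) ^ m" using elim by (simp flip: power_mult_distrib)
    also have "A (- w) / (- 1) ^ m = h w" by (cases "even m") (auto simp: h_def)
    finally show ?case .
  qed
  ultimately show ?thesis unfolding extends_holomorphically_at_def by blast
qed

lemma pole_order_le_reflected_upper:
  assumes z0: "z0 \<in> upper_hp" and A: "A holomorphic_on ball 0 r" "r > 0"
    and eq: "\<And>z. z \<in> upper_hp \<Longrightarrow> z - z0 \<in> ball 0 r - {0} \<Longrightarrow> (z - z0) ^ m * f z = A (z - z0)"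
  shows "pole_order_le (reflected f) z0 m" "pole_order_le (reflected f) (cnj z0) m"
proof -
  obtain e where e: "e > 0" "ball z0 e \<subseteq> upper_hp" using open_upper_hp z0 open_contains_ball by blast
  define \<rho> where "\<rho> = min e r"
  have \<rho>: "\<rho> > 0" "\<rho> \<le> r" "ball z0 \<rho> \<subseteq> upper_hp" using e A(2) by (auto simp: \<rho>_def)
  define h where "h z = A (z - z0)" for z
  have hh: "h holomorphic_on ball z0 \<rho>"
    unfolding h_def by (rule holomorphic_on_compose_gen[OF _ A(1), unfolded o_def])
      (use \<rho>(2) in \<open>auto intro!: holomorphic_intros simp: dist_norm norm_minus_commute\<close>)
  have eq': "(z - z0) ^ m * f z = h z" if "z \<in> ball z0 \<rho> - {z0}" for z
    unfolding h_def using that \<rho> by (intro eq) (auto simp: dist_norm norm_minus_commute)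
  have "\<forall>\<^sub>F w in at z0. w \<in> ball z0 \<rho> - {z0}"
    using eventually_at_in_open[of "ball z0 \<rho>" z0] \<rho>(1) by simp
  then have "\<forall>\<^sub>F w in at z0. (w - z0) ^ m * reflected f w = h w"
  proof eventually_elim
    case (elim w)
    then have "w \<in> upper_hp" using \<rho>(3) by auto
    then show ?case using eq'[OF elim] by (simp add: reflected_upper)
  qed
  moreover have "h analytic_on {z0}" using hh \<rho>(1) by (rule holomorphic_on_ball_imp_analytic_at)
  ultimately show "pole_order_le (reflected f) z0 m" unfolding pole_order_le_def extends_holomorphically_at_def by blast
  have cb: "cnj ` ball (cnj z0) \<rho> = ball z0 \<rho>"
  proof -
    have 1: "cnj w \<in> ball z0 \<rho> \<longleftrightarrow> w \<in> ball (cnj z0) \<rho>" for w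
    proof -
      have "norm (cnj (cnj z0 - w)) = norm (cnj z0 - w)" by (rule complex_mod_cnj)
      then show ?thesis by (simp add: dist_norm)
    qed
    show ?thesis
    proof
      show "cnj ` ball (cnj z0) \<rho> \<subseteq> ball z0 \<rho>" using 1 by blast
      show "ball z0 \<rho> \<subseteq> cnj ` ball (cnj z0) \<rho>"
      proof
        fix z assume "z \<in> ball z0 \<rho>"
        then have "cnj z \<in> ball (cnj z0) \<rho>" using 1[of "cnj z"] by simp
        then show "z \<in> cnj ` ball (cnj z0) \<rho>" by (intro image_eqI[of _ _ "cnj z"]) simp_all
      qed
    qed
  qed
  have "cnj \<circ> h \<circ> cnj holomorphic_on ball (cnj z0) \<rho>"
    by (rule holomorphic_on_compose_cnj_cnj) (use hh cb in auto)
  then have "cnj \<circ> h \<circ> cnj analytic_on {cnj z0}" using \<rho>(1) by (rule holomorphic_on_ball_imp_analytic_at)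
  moreover have "\<forall>\<^sub>F w in at (cnj z0). w \<in> ball (cnj z0) \<rho> - {cnj z0}"
    using eventually_at_in_open[of "ball (cnj z0) \<rho>" "cnj z0"] \<rho>(1) by simp
  then have "\<forall>\<^sub>F w in at (cnj z0). (w - cnj z0) ^ m * reflected f w = (cnj \<circ> h \<circ> cnj) w"
  proof eventually_elim
    case (elim w)
    then have b: "cnj w \<in> ball z0 \<rho>" "cnj w \<noteq> z0" using cb by auto
    then have "Im w < 0" using \<rho>(3) by (auto simp: upper_hp_def)
    then have r: "reflected f w = cnj (f (cnj w))" by (simp add: reflected_def)
    have "cnj ((cnj w - z0) ^ m * f (cnj w)) = cnj (h (cnj w))" using eq'[of "cnj w"] b by simp
    then show ?case by (simp add: r)
  qed
  ultimately show "pole_order_le (reflected f) (cnj z0) m" unfolding pole_order_le_def extends_holomorphically_at_def by blast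
qed

lemma pole_order_le_imp_meromorphic:
  assumes "pole_order_le f z m"
  shows "f meromorphic_on {z}"
proof -
  obtain h where h: "h analytic_on {z}" "\<forall>\<^sub>F w in at z. (w - z) ^ m * f w = h w"
    using assms unfolding pole_order_le_def extends_holomorphically_at_def by blast
  have "\<forall>\<^sub>F w in at z. w \<noteq> z" by (simp add: eventually_at_filter)
  with h(2) have ev: "\<forall>\<^sub>F w in at z. f w = h w / (w - z) ^ m"
    by eventually_elim (auto simp: field_simps)
  have mero: "(\<lambda>w. h w / (w - z) ^ m) meromorphic_on {z}"
    by (intro meromorphic_intros analytic_on_imp_meromorphic_on[OF h(1)])
  show ?thesis by (rule meromorphic_on_cong[THEN iffD2, OF _ refl mero]) (use ev in simp)
qed

lemma extends_at_infinity_imp_meromorphic: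
  assumes "extends_holomorphically_at (\<lambda>w. f (1 / w) / w ^ m) 0"
  shows "(\<lambda>w. f (1 / w)) meromorphic_on {0}"
proof -
  obtain h where h: "h analytic_on {0}" "\<forall>\<^sub>F w in at 0. f (1 / w) / w ^ m = h w"
    using assms unfolding extends_holomorphically_at_def by blast
  have "\<forall>\<^sub>F w in at (0::complex). w \<noteq> 0" by (simp add: eventually_at_filter)
  with h(2) have ev: "\<forall>\<^sub>F w in at 0. f (1 / w) = w ^ m * h w"
    by eventually_elim (auto simp: field_simps)
  have mero: "(\<lambda>w. w ^ m * h w) meromorphic_on {0}"
    by (intro meromorphic_intros analytic_on_imp_meromorphic_on[OF h(1)])
  show ?thesis by (rule meromorphic_on_cong[THEN iffD2, OF _ refl mero]) (use ev in simp)
qed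

section \<open>The equation in the upper half-plane\<close>

text \<open>
  If the Wronskian vanishes, \<open>H/G\<close> is constant on a disk without zeros of \<open>G\<close>, which gives a linear
  relation on the disk, hence on the half-plane.
\<close>

lemma wronskian_nonzero_of_independent:
  assumes G: "G holomorphic_on upper_hp" and H: "H holomorphic_on upper_hp"
    and ind: "\<forall>c d. (\<forall>z\<in>upper_hp. c * G z + d * H z = 0) \<longrightarrow> c = 0 \<and> d = 0"
  shows "\<exists>z\<in>upper_hp. wronskian G H z \<noteq> 0"
proof (rule ccontr)
  assume W: "\<not> ?thesis"
  have "\<exists>z1\<in>upper_hp. G z1 \<noteq> 0" using ind[rule_format, of 1 0] by auto
  then obtain z1 where z1: "z1 \<in> upper_hp" "G z1 \<noteq> 0" by blast
  have "isCont G z1" by (rule holomorphic_on_isCont[OF G open_upper_hp z1(1)])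
  then obtain e1 where e1: "e1 > 0" "\<And>w. dist z1 w < e1 \<Longrightarrow> G w \<noteq> 0"
    using continuous_at_avoid[of z1 G 0] z1(2) by blast
  obtain e2 where e2: "e2 > 0" "ball z1 e2 \<subseteq> upper_hp" using open_upper_hp z1(1) open_contains_ball by blast
  define e where "e = min e1 e2"
  have e: "e > 0" "ball z1 e \<subseteq> upper_hp" "\<And>w. w \<in> ball z1 e \<Longrightarrow> G w \<noteq> 0" using e1 e2 by (auto simp: e_def)
  have "((\<lambda>z. H z / G z) has_field_derivative 0) (at z within ball z1 e)" if z: "z \<in> ball z1 e" for z
  proof -
    have zu: "z \<in> upper_hp" using e(2) z by blast
    have "((\<lambda>z. H z / G z) has_field_derivative (deriv H z * G z - H z * deriv G z) / (G z * G z)) (at z)"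
      by (rule DERIV_divide[OF holomorphic_derivI[OF H open_upper_hp zu] holomorphic_derivI[OF G open_upper_hp zu] e(3)[OF z]])
    moreover have "deriv H z * G z - H z * deriv G z = wronskian G H z" by (simp add: wronskian_def algebra_simps)
    moreover have "wronskian G H z = 0" using W zu by blast
    ultimately have "((\<lambda>z. H z / G z) has_field_derivative 0) (at z)" by simp
    then show ?thesis by (rule has_field_derivative_at_within)
  qed
  from has_field_derivative_zero_constant[OF convex_ball this]
  obtain k where k: "\<And>z. z \<in> ball z1 e \<Longrightarrow> H z / G z = k" by blast
  have 0: "- k * G z + H z = 0" if "z \<in> ball z1 e" for z
    using k[OF that] e(3)[OF that] by (auto simp: field_simps)
  have "- k * G z + H z = 0" if "z \<in> upper_hp" for z
    by (rule analytic_continuation_open[of "ball z1 e" upper_hp "\<lambda>z. - k * G z + H z" "\<lambda>_. 0"])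
       (use e(1,2) 0 that in \<open>auto intro!: holomorphic_intros G H open_upper_hp convex_connected convex_upper_hp\<close>)
  then have "\<forall>z\<in>upper_hp. (- k) * G z + 1 * H z = 0" by simp
  then show False using ind by (metis zero_neq_one)
qed

lemma eventually_wronskian_nonzero:
  assumes G: "G holomorphic_on upper_hp" and H: "H holomorphic_on upper_hp"
    and nd: "z0 \<in> upper_hp" "wronskian G H z0 \<noteq> 0" and x: "x \<in> upper_hp"
  shows "\<forall>\<^sub>F z in at x. z \<in> upper_hp \<and> wronskian G H z \<noteq> 0"
proof -
  note hW = holomorphic_wronskian[OF G H]
  have "\<forall>\<^sub>F z in at x. wronskian G H z \<noteq> 0"
  proof (cases "wronskian G H x = 0")
    case True
    obtain r where r: "0 < r" "\<And>z. z \<in> ball x r - {x} \<Longrightarrow> wronskian G H z \<noteq> 0"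
      using isolated_zeros[OF hW open_upper_hp convex_connected[OF convex_upper_hp] x True nd] by metis
    then show ?thesis
      using eventually_at_in_open[of "ball x r" x] by (auto elim!: eventually_mono)
  next
    case False
    have "isCont (wronskian G H) x" by (rule holomorphic_on_isCont[OF hW open_upper_hp x])
    then have "(wronskian G H \<longlongrightarrow> wronskian G H x) (at x)" by (rule isContD)
    then show ?thesis using False by (rule tendsto_imp_eventually_ne)
  qed
  moreover have "\<forall>\<^sub>F z in at x. z \<in> upper_hp"
    using eventually_nhds_in_open[OF open_upper_hp x] by (auto simp: eventually_at_filter elim: eventually_mono)
  ultimately show ?thesis by eventually_elim auto
qed

text \<open>
  Points at which \<open>coeff_p, coeff_q\<close> are analytic but the Wronskian vanishes need an argument, since the
  coefficients have the value of a division by \<open>0\<close> there: the equation holds in a punctured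
  neighbourhood, and its left side is continuous.
\<close>

lemma fundamental_system_coeff:
  assumes G: "G holomorphic_on upper_hp" and H: "H holomorphic_on upper_hp"
    and ind: "\<forall>c d. (\<forall>z\<in>upper_hp. c * G z + d * H z = 0) \<longrightarrow> c = 0 \<and> d = 0"
    and nd: "z0 \<in> upper_hp" "wronskian G H z0 \<noteq> 0"
  shows "fundamental_system upper_hp (coeff_p G H) (coeff_q G H) G H"
proof -
  have an: "f analytic_on upper_hp" if "f holomorphic_on upper_hp" for f
    using that open_upper_hp by (simp add: analytic_on_open)
  note hd = holomorphic_deriv[OF _ open_upper_hp]
  have mero: "G meromorphic_on upper_hp" "H meromorphic_on upper_hp" "deriv G meromorphic_on upper_hp"
    "deriv H meromorphic_on upper_hp" "deriv (deriv G) meromorphic_on upper_hp" "deriv (deriv H) meromorphic_on upper_hp"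
    "wronskian G H meromorphic_on upper_hp"
    by (intro analytic_on_imp_meromorphic_on an G H hd holomorphic_wronskian)+
  have mp: "coeff_p G H meromorphic_on upper_hp" "coeff_q G H meromorphic_on upper_hp"
    unfolding coeff_p_def[abs_def] coeff_q_def[abs_def] by (intro meromorphic_intros mero)+
  have eq: "deriv (deriv y) x + coeff_p G H x * deriv y x + coeff_q G H x * y x = 0"
    if y: "y \<in> {G, H}" and x: "x \<in> upper_hp" and a: "coeff_p G H analytic_on {x}" "coeff_q G H analytic_on {x}" for y x
  proof -
    have hy: "y holomorphic_on upper_hp" using y G H by auto
    have "isCont (\<lambda>z. deriv (deriv y) z + coeff_p G H z * deriv y z + coeff_q G H z * y z) x"
      using analytic_at_imp_isCont[OF a(1)] analytic_at_imp_isCont[OF a(2)]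
        holomorphic_on_isCont[OF hy open_upper_hp x] holomorphic_on_isCont[OF hd[OF hy] open_upper_hp x]
        holomorphic_on_isCont[OF hd[OF hd[OF hy]] open_upper_hp x]
      by (intro continuous_intros)
    then have l: "((\<lambda>z. deriv (deriv y) z + coeff_p G H z * deriv y z + coeff_q G H z * y z) \<longlongrightarrow>
       deriv (deriv y) x + coeff_p G H x * deriv y x + coeff_q G H x * y x) (at x)" by (rule isContD)
    have "\<forall>\<^sub>F z in at x. 0 = deriv (deriv y) z + coeff_p G H z * deriv y z + coeff_q G H z * y z"
      using eventually_wronskian_nonzero[OF G H nd x] by eventually_elim (use y coeff_solves in auto)
    then have "((\<lambda>z. deriv (deriv y) z + coeff_p G H z * deriv y z + coeff_q G H z * y z) \<longlongrightarrow> 0) (at x)"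
      by (rule Lim_transform_eventually[OF tendsto_const])
    from tendsto_unique[OF at_neq_bot l this] show ?thesis .
  qed
  show ?thesis unfolding fundamental_system_def using mp G H ind eq by blast
qed

lemma fundamental_system_unique:
  assumes G: "G holomorphic_on upper_hp" and H: "H holomorphic_on upper_hp"
    and nd: "z0 \<in> upper_hp" "wronskian G H z0 \<noteq> 0"
    and fs: "fundamental_system upper_hp p q G H"
  shows "\<forall>\<^sub>\<approx>x\<in>upper_hp. coeff_p G H x = p x \<and> coeff_q G H x = q x"
proof -
  have mp: "p meromorphic_on upper_hp" "q meromorphic_on upper_hp"
    and eq: "\<And>x. x \<in> upper_hp \<Longrightarrow> p analytic_on {x} \<Longrightarrow> q analytic_on {x} \<Longrightarrow>
      deriv (deriv G) x + p x * deriv G x + q x * G x = 0 \<and> deriv (deriv H) x + p x * deriv H x + q x * H x = 0"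
    using fs unfolding fundamental_system_def by auto
  have "\<forall>\<^sub>\<approx>x\<in>upper_hp. x \<in> upper_hp \<and> wronskian G H x \<noteq> 0"
    unfolding eventually_cosparse_open_eq[OF open_upper_hp]
    using eventually_wronskian_nonzero[OF G H nd] by blast
  with meromorphic_on_imp_analytic_cosparse[OF mp(1)] meromorphic_on_imp_analytic_cosparse[OF mp(2)]
  show ?thesis
  proof eventually_elim
    case (elim x)
    then show ?case using coeff_unique[of G H x "p x" "q x"] eq[of x] by simp
  qed
qed

text \<open>
  An interior point is treated like a boundary point, with \<open>G\<close> and \<open>H\<close> as the two solutions; there
  is no reality here.
\<close>

lemma fuchsian_at_upper_point:
  assumes G: "G holomorphic_on upper_hp" and H: "H holomorphic_on upper_hp"
    and nd: "z0 \<in> upper_hp" "wronskian G H z0 \<noteq> 0" and x: "x \<in> upper_hp"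
  obtains r A B where "0 < r" "A holomorphic_on ball 0 r" "B holomorphic_on ball 0 r"
    "\<And>z. z \<in> upper_hp \<Longrightarrow> z - x \<in> ball 0 r - {0} \<Longrightarrow>
       (z - x) * coeff_p G H z = A (z - x) \<and> (z - x)\<^sup>2 * coeff_q G H z = B (z - x)"
proof -
  obtain e where e: "e > 0" "ball x e \<subseteq> upper_hp" using open_upper_hp x open_contains_ball by blast
  have ex: "\<exists>r' V. 0 < r' \<and> r' \<le> e \<and> V holomorphic_on ball 0 r' \<and>
      (\<forall>z\<in>upper_hp. z - x \<in> ball 0 r' - {0} \<longrightarrow> y z \<noteq> 0 \<and> (z - x) * deriv y z = V (z - x) * y z)"
    if hy: "y holomorphic_on upper_hp" and ne: "\<exists>z\<in>upper_hp. y z \<noteq> 0" for y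
  proof -
    define \<kappa> where "\<kappa> w = y (x + w)" for w
    have \<kappa>: "\<kappa> holomorphic_on ball 0 e"
      unfolding \<kappa>_def by (rule holomorphic_on_compose_gen[OF _ hy, unfolded o_def])
        (use e(2) in \<open>auto intro!: holomorphic_intros simp: dist_norm\<close>)
    obtain z2 where z2: "z2 \<in> ball x e" "y z2 \<noteq> 0"
      using nonzero_in_open_subset[OF hy, of _ "ball x e"] ne e by (metis centre_in_ball empty_iff open_ball)
    have "z2 - x \<in> ball 0 e" "\<kappa> (z2 - x) \<noteq> 0" using z2 by (auto simp: \<kappa>_def dist_norm norm_minus_commute)
    then obtain r' V where V: "0 < r'" "r' \<le> e" "V holomorphic_on ball 0 r'"
      "\<And>w. w \<in> ball 0 r' - {0} \<Longrightarrow> \<kappa> w \<noteq> 0 \<and> w * deriv \<kappa> w = V w * \<kappa> w"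
      using logarithmic_derivative_simple_pole[OF \<kappa> e(1)] by metis
    have d: "deriv \<kappa> (z - x) = deriv y z" if "z \<in> upper_hp" for z
    proof -
      have "(y has_field_derivative deriv y z) (at (x + (z - x)))"
        using holomorphic_derivI[OF hy open_upper_hp that] by simp
      then have "(\<kappa> has_field_derivative deriv y z * 1) (at (z - x))"
        unfolding \<kappa>_def by (rule DERIV_chain2) (auto intro!: derivative_eq_intros)
      then show ?thesis using DERIV_imp_deriv by fastforce
    qed
    have "y z \<noteq> 0 \<and> (z - x) * deriv y z = V (z - x) * y z" if "z \<in> upper_hp" "z - x \<in> ball 0 r' - {0}" for z
      using V(4)[OF that(2)] unfolding d[OF that(1)] by (simp add: \<kappa>_def)
    then show ?thesis using V(1-3) by blast
  qed
  have GH: "\<exists>z\<in>upper_hp. G z \<noteq> 0" "\<exists>z\<in>upper_hp. H z \<noteq> 0"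
    using wronskian_zero_of_dependent[OF G H nd(1), of 1 0] wronskian_zero_of_dependent[OF G H nd(1), of 0 1] nd(2)
    by auto
  obtain r1 V1 where V1: "0 < r1" "r1 \<le> e" "V1 holomorphic_on ball 0 r1"
    "\<And>z. z \<in> upper_hp \<Longrightarrow> z - x \<in> ball 0 r1 - {0} \<Longrightarrow> G z \<noteq> 0 \<and> (z - x) * deriv G z = V1 (z - x) * G z"
    using ex[OF G GH(1)] by metis
  obtain r2 V2 where V2: "0 < r2" "r2 \<le> e" "V2 holomorphic_on ball 0 r2"
    "\<And>z. z \<in> upper_hp \<Longrightarrow> z - x \<in> ball 0 r2 - {0} \<Longrightarrow> H z \<noteq> 0 \<and> (z - x) * deriv H z = V2 (z - x) * H z"
    using ex[OF H GH(2)] by metis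
  define \<rho> where "\<rho> = min r1 r2"
  have \<rho>: "0 < \<rho>" using V1(1) V2(1) by (simp add: \<rho>_def)
  have sub: "ball 0 \<rho> \<subseteq> ball (0::complex) r1" "ball 0 \<rho> \<subseteq> ball (0::complex) r2" by (auto simp: \<rho>_def)
  have V\<rho>: "V1 holomorphic_on ball 0 \<rho>" "V2 holomorphic_on ball 0 \<rho>"
    using V1(3) V2(3) sub holomorphic_on_subset by blast+
  have "open (ball x \<rho> - {x})" by (simp add: open_delete)
  moreover have "ball x \<rho> \<subseteq> ball x e" using V1(2) by (intro subset_ball) (simp add: \<rho>_def)
  then have "ball x \<rho> - {x} \<subseteq> upper_hp" using e(2) by blast
  moreover have "ball x \<rho> - {x} \<noteq> {}"
  proof -
    have "x + of_real (\<rho>/2) \<in> ball x \<rho> - {x}" using \<rho> by (auto simp: dist_norm)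
    then show ?thesis by blast
  qed
  ultimately obtain z1 where z1: "z1 \<in> ball x \<rho> - {x}" "wronskian G H z1 \<noteq> 0"
    using nonzero_in_open_subset[OF holomorphic_wronskian[OF G H] nd] by metis
  have z1': "z1 \<in> upper_hp" "z1 - x \<in> ball 0 \<rho> - {0}"
    using z1(1) \<open>ball x \<rho> - {x} \<subseteq> upper_hp\<close> by (auto simp: dist_norm norm_minus_commute)
  obtain r' A B where AB: "0 < r'" "A holomorphic_on ball 0 r'" "B holomorphic_on ball 0 r'"
    "\<And>z. z \<in> upper_hp \<Longrightarrow> z - x \<in> ball 0 r' - {0} \<Longrightarrow> wronskian G H z \<noteq> 0 \<and>
       1 * (z - x) * coeff_p G H z = A (z - x) \<and> (1 * (z - x))\<^sup>2 * coeff_q G H z = B (z - x)"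
  proof (rule fuchsian_in_local_coordinate[where \<omega> = "\<lambda>z. z - x" and \<omega>' = "\<lambda>_. 1" and s = 1 and t = x
        and ?a1.0 = 1 and ?b1.0 = 0 and ?a2.0 = 0 and ?b2.0 = 1, OF G H _ \<rho> V\<rho> _ _ _ z1' z1(2)])
    show "((\<lambda>z. z - x) has_field_derivative 1) (at z) \<and> 1 * (z - x) * 1 = z - x" for z
      by (auto intro!: derivative_eq_intros)
    show "1 * G z + 0 * H z \<noteq> 0 \<and> 1 * (z - x) * (1 * deriv G z + 0 * deriv H z) = V1 (z - x) * (1 * G z + 0 * H z)"
      if "z \<in> upper_hp" "z - x \<in> ball 0 \<rho> - {0}" for z using V1(4)[OF that(1)] that(2) sub(1) by auto
    show "0 * G z + 1 * H z \<noteq> 0 \<and> 1 * (z - x) * (0 * deriv G z + 1 * deriv H z) = V2 (z - x) * (0 * G z + 1 * H z)"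
      if "z \<in> upper_hp" "z - x \<in> ball 0 \<rho> - {0}" for z using V2(4)[OF that(1)] that(2) sub(2) by auto
  qed (simp | (rule that; assumption))+
  show ?thesis by (rule that[OF AB(1-3)]) (use AB(4) in simp)
qed

section \<open>The Fuchsian conditions on the sphere\<close>

lemma filterlim_within_upper_hp:
  assumes "isCont m (of_real x)" "\<And>w. w \<in> upper_hp \<Longrightarrow> m w \<in> upper_hp" "m (of_real x) = of_real y"
  shows "filterlim m (at (of_real y) within upper_hp) (at (of_real x) within upper_hp)"
  unfolding filterlim_at
proof
  show "\<forall>\<^sub>F w in at (of_real x) within upper_hp. m w \<in> upper_hp \<and> m w \<noteq> of_real y"
    unfolding eventually_at_filter
  proof (intro always_eventually allI impI)
    fix w assume "w \<in> upper_hp"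
    then have "m w \<in> upper_hp" by (rule assms(2))
    then show "m w \<in> upper_hp \<and> m w \<noteq> of_real y" by (auto simp: upper_hp_def)
  qed
  show "(m \<longlongrightarrow> of_real y) (at (of_real x) within upper_hp)"
    using isCont_tendsto_within[OF assms(1), of upper_hp] unfolding assms(3) .
qed

context weierstrass_surface
begin

text \<open>
  Vertices and interior points of sides are treated alike; in the latter case both sides have the same
  direction.
\<close>

lemma fuchsian_at_real_point:
  assumes nd: "z0 \<in> upper_hp" "wronskian G H z0 \<noteq> 0" and \<delta>: "\<delta> > 0"
    and right: "norm d = 1" "on_line X {t<..<t + \<delta>} d" and left: "norm d' = 1" "on_line X {t - \<delta><..<t} d'"
  shows "pole_order_le (reflected (coeff_p G H)) (of_real t) 1 \<and> pole_order_le (reflected (coeff_q G H)) (of_real t) 2"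
proof -
  define r where "r = min 1 (\<delta> / 2)"
  have r: "0 < r" "r \<le> 1" "2 * r \<le> \<delta>" using \<delta> by (auto simp: r_def)
  obtain M where M: "M > 0" "\<And>w. w \<in> cball (of_real t) (2 * r) \<inter> closed_upper_hp \<Longrightarrow> norm (X w) \<le> M"
    by (rule bounded_near_boundary_point[of t "2 * r"]) (rule that)
  have m: "of_real t + w \<in> upper_hp \<and> ((\<lambda>w. of_real t + w) has_field_derivative 1) (at w)"
    "w * 1 = 1 * ((of_real t + w) - of_real t)" "of_real t + w - of_real t = w" if "w \<in> upper_hp" for w
    using that by (auto simp: upper_hp_def intro!: derivative_eq_intros)
  have m3: "z - of_real t \<in> upper_hp \<and> of_real t + (z - of_real t) = z"
    "((\<lambda>z. z - of_real t) has_field_derivative 1) (at z) \<and> 1 * (z - of_real t) * 1 = z - of_real t" if "z \<in> upper_hp" for z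
    using that by (auto simp: upper_hp_def intro!: derivative_eq_intros)
  have \<nu>: "filterlim (\<lambda>w. of_real t + w) (at (of_real (t + x)) within upper_hp) (at (of_real x) within upper_hp)" for x
    by (rule filterlim_within_upper_hp) (auto simp: upper_hp_def)
  have R: "\<exists>a b. a < t + x \<and> t + x < b \<and> on_line X {a<..<b} d" if "0 < x" "x < r" for x
    using that r right by (intro exI[of _ t] exI[of _ "t + \<delta>"]) auto
  have L: "\<exists>a b. a < t + x \<and> t + x < b \<and> on_line X {a<..<b} d'" if "- r < x" "x < 0" for x
    using that r left by (intro exI[of _ "t - \<delta>"] exI[of _ t]) auto
  have growth: "norm (\<Phi> v (of_real t + w)) \<le> 2304 * M / norm w ^ 1"
    if w: "w \<in> ball 0 r \<inter> upper_hp" and v: "norm v \<le> 1" for v w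
  proof -
    let ?z = "of_real t + w"
    have n: "norm (?z - of_real t) = norm w" "0 < norm w" "norm w < r" using w by (auto simp: upper_hp_def)
    have "norm (\<Phi> v ?z) \<le> 2304 * M / norm (?z - of_real t)"
    proof (rule form_growth[OF _ v M(1) _ right(1) _ left(1)], unfold n(1))
      show "?z \<in> upper_hp" using m(1) w by blast
      show "norm (X \<zeta>) \<le> M" if "\<zeta> \<in> closed_upper_hp" "norm (\<zeta> - of_real t) \<le> 2 * norm w" for \<zeta>
        using that n by (intro M(2)) (auto simp: dist_norm norm_minus_commute)
      show "on_line X {t + norm w / 4<..<t + 2 * norm w} d"
        by (rule on_line_subset[OF right(2)]) (use n r in auto)
      show "on_line X {t - 2 * norm w<..<t - norm w / 4} d'"
        by (rule on_line_subset[OF left(2)]) (use n r in auto)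
    qed
    then show ?thesis by (simp only: n(1) power_one_right)
  qed
  obtain r' A B where AB: "0 < r'" "A holomorphic_on ball 0 r'" "B holomorphic_on ball 0 r'"
    "\<And>x. of_real x \<in> ball (0::complex) r' \<Longrightarrow> A (of_real x) \<in> \<real>"
    "\<And>x. of_real x \<in> ball (0::complex) r' \<Longrightarrow> B (of_real x) \<in> \<real>"
    "\<And>z. z \<in> upper_hp \<Longrightarrow> z - of_real t \<in> ball 0 r' \<Longrightarrow>
       1 * (z - of_real t) * coeff_p G H z = A (z - of_real t) \<and> (1 * (z - of_real t))\<^sup>2 * coeff_q G H z = B (z - of_real t)"
    by (rule boundary_fuchsian[where m = "\<lambda>w. of_real t + w" and dm = "\<lambda>_. 1" and \<omega> = "\<lambda>z. z - of_real t"
        and \<omega>' = "\<lambda>_. 1" and \<nu> = "\<lambda>x. t + x", OF nd r(1,2) Reals_1 m(1,2) m3(1) m(3) m3(2) \<nu> right(1) R left(1) L growth])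
       (assumption | (rule that; assumption))+
  show ?thesis
    using pole_order_le_reflected_real[OF AB(2,1,4), of t 1 "coeff_p G H"] pole_order_le_reflected_real[OF AB(3,1,5), of t 2 "coeff_q G H"] AB(6)
    by simp
qed

text \<open>
  In the coordinate \<open>-1/z\<close> the positive half-line near \<open>\<infinity>\<close> lies to the left of \<open>0\<close>, so the two sides change
  their roles. For a bounded end \<open>N\<close> is \<open>0\<close>; a helicoidal end grows like a power of \<open>z\<close>.
\<close>

lemma fuchsian_at_infinity:
  assumes nd: "z0 \<in> upper_hp" "wronskian G H z0 \<noteq> 0" and R: "R > 0" and C: "C > 0"
    and bd: "\<And>z. z \<in> closed_upper_hp \<Longrightarrow> R \<le> norm z \<Longrightarrow> norm (X z) \<le> C * norm z ^ N"
    and pos: "norm d = 1" "on_line X {R<..} d" and neg: "norm d' = 1" "on_line X {..<-R} d'"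
  shows "extends_holomorphically_at (\<lambda>w. reflected (coeff_p G H) (1 / w) / w) 0 \<and>
    extends_holomorphically_at (\<lambda>w. reflected (coeff_q G H) (1 / w) / w\<^sup>2) 0"
proof -
  define r where "r = min 1 (1 / (4 * R))"
  have r: "0 < r" "r \<le> 1" "r \<le> 1 / (4 * R)" using R by (auto simp: r_def)
  have inv: "- 1 / z \<in> upper_hp" "z \<noteq> 0" if "z \<in> upper_hp" for z
  proof -
    show z0: "z \<noteq> 0" using that by (auto simp: upper_hp_def)
    have "Im (- 1 / z) = Im z / (norm z)\<^sup>2"
      by (simp add: Im_divide cmod_power2)
    then show "- 1 / z \<in> upper_hp" using that z0 by (simp add: upper_hp_def)
  qed
  have dinv: "((\<lambda>w. - 1 / w) has_field_derivative 1 / z\<^sup>2) (at z)" if "z \<noteq> 0" for z :: complex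
    using that by (auto intro!: derivative_eq_intros simp: power2_eq_square)
  have m: "- 1 / w \<in> upper_hp \<and> ((\<lambda>w. - 1 / w) has_field_derivative 1 / w\<^sup>2) (at w)"
    "w * (1 / w\<^sup>2) = - 1 * (- 1 / w - 0)" "- 1 / (- 1 / w) = w" if "w \<in> upper_hp" for w
    using inv[OF that] dinv by (auto simp: power2_eq_square)
  have m3: "- 1 / z \<in> upper_hp \<and> - 1 / (- 1 / z) = z"
    "((\<lambda>z. - 1 / z) has_field_derivative 1 / z\<^sup>2) (at z) \<and> - 1 * (z - 0) * (1 / z\<^sup>2) = - 1 / z" if "z \<in> upper_hp" for z
    using inv[OF that] dinv by (auto simp: power2_eq_square)
  have \<nu>: "filterlim (\<lambda>w. - 1 / w) (at (of_real (- 1 / x)) within upper_hp) (at (of_real x) within upper_hp)"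
    if "x \<noteq> 0" for x :: real
  proof (rule filterlim_within_upper_hp)
    show "isCont (\<lambda>w. - 1 / w) (of_real x :: complex)" using that by (intro continuous_intros) auto
  qed (use inv in auto)
  have big: "4 * R < 1 / \<bar>x\<bar>" if "x \<noteq> 0" "\<bar>x\<bar> < r" for x
  proof -
    have "\<bar>x\<bar> < 1 / (4 * R)" using that r by simp
    then show ?thesis using that R by (simp add: field_simps)
  qed
  have L: "\<exists>a b. a < - 1 / x \<and> - 1 / x < b \<and> on_line X {a<..<b} d'" if "0 < x" "x < r" for x
  proof (rule exI[of _ "- 1 / x - 1"], rule exI[of _ "- R"], intro conjI)
    show "- 1 / x < - R" using big[of x] that R by auto
    show "on_line X {- 1 / x - 1<..<- R} d'" by (rule on_line_subset[OF neg(2)]) auto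
  qed simp
  have Rr: "\<exists>a b. a < - 1 / x \<and> - 1 / x < b \<and> on_line X {a<..<b} d" if "- r < x" "x < 0" for x
  proof (rule exI[of _ R], rule exI[of _ "- 1 / x + 1"], intro conjI)
    show "R < - 1 / x" using big[of x] that R by auto
    show "on_line X {R<..<- 1 / x + 1} d" by (rule on_line_subset[OF pos(2)]) auto
  qed simp
  have growth: "norm (\<Phi> v (- 1 / w)) \<le> (2304 * C * 2 ^ N) / norm w ^ N"
    if w: "w \<in> ball 0 r \<inter> upper_hp" and v: "norm v \<le> 1" for v w
  proof -
    let ?z = "- 1 / w" let ?\<rho> = "norm (- 1 / w - of_real 0)"
    have w0: "w \<noteq> 0" "norm w < r" using w by (auto simp: upper_hp_def)
    have n: "?\<rho> = 1 / norm w" by (simp add: norm_divide)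
    have \<rho>: "4 * R < ?\<rho>" unfolding n using big[of "norm w"] w0 by simp
    have \<rho>0: "?\<rho> > 0" unfolding n using w0 by simp
    have "norm (\<Phi> v ?z) \<le> 2304 * (C * (2 * ?\<rho>) ^ N) / ?\<rho>"
    proof (rule form_growth[OF _ v _ _ pos(1) _ neg(1)])
      show "?z \<in> upper_hp" using m(1) w by blast
      show "0 < C * (2 * ?\<rho>) ^ N" using C \<rho>0 by simp
      show "norm (X \<zeta>) \<le> C * (2 * ?\<rho>) ^ N"
        if \<zeta>: "\<zeta> \<in> closed_upper_hp" "?\<rho> / 4 \<le> norm (\<zeta> - of_real 0)" "norm (\<zeta> - of_real 0) \<le> 2 * ?\<rho>" for \<zeta>
      proof -
        have "norm (X \<zeta>) \<le> C * norm \<zeta> ^ N" using \<zeta>(2) \<rho> by (intro bd[OF \<zeta>(1)]) simp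
        also have "\<dots> \<le> C * (2 * ?\<rho>) ^ N" using \<zeta>(3) C by (intro mult_left_mono power_mono) auto
        finally show ?thesis .
      qed
      show "on_line X {0 + ?\<rho> / 4<..<0 + 2 * ?\<rho>} d"
        by (rule on_line_subset[OF pos(2)]) (use \<rho> in auto)
      show "on_line X {0 - 2 * ?\<rho><..<0 - ?\<rho> / 4} d'"
        by (rule on_line_subset[OF neg(2)]) (use \<rho> in auto)
    qed
    also have "\<dots> = (2304 * C * 2 ^ N / norm w ^ N) * norm w"
      unfolding n by (simp add: power_mult_distrib power_divide)
    also have "\<dots> \<le> (2304 * C * 2 ^ N / norm w ^ N) * 1"
      using w0 r C by (intro mult_left_mono) auto
    finally show ?thesis by simp
  qed
  obtain r' A B where AB: "0 < r'" "A holomorphic_on ball 0 r'" "B holomorphic_on ball 0 r'"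
    "\<And>x. of_real x \<in> ball (0::complex) r' \<Longrightarrow> A (of_real x) \<in> \<real>"
    "\<And>x. of_real x \<in> ball (0::complex) r' \<Longrightarrow> B (of_real x) \<in> \<real>"
    "\<And>z. z \<in> upper_hp \<Longrightarrow> - 1 / z \<in> ball 0 r' \<Longrightarrow>
       - 1 * (z - 0) * coeff_p G H z = A (- 1 / z) \<and> (- 1 * (z - 0))\<^sup>2 * coeff_q G H z = B (- 1 / z)"
    by (rule boundary_fuchsian[where m = "\<lambda>w. - 1 / w" and dm = "\<lambda>w. 1 / w\<^sup>2" and \<omega> = "\<lambda>z. - 1 / z"
        and \<omega>' = "\<lambda>z. 1 / z\<^sup>2" and \<nu> = "\<lambda>x. - 1 / x" and s = "- 1" and t = 0,
        OF nd r(1,2) _ m(1,2) m3(1) m(3) m3(2) \<nu> neg(1) L pos(1) Rr growth])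
       (assumption | simp | (rule that; assumption))+
  have "extends_holomorphically_at (\<lambda>w. reflected (coeff_p G H) (1 / w) / w ^ 1) 0"
    by (rule extends_reflected_at_infinity[OF AB(2,1,4)]) (use AB(6) in auto)
  moreover have "extends_holomorphically_at (\<lambda>w. reflected (coeff_q G H) (1 / w) / w ^ 2) 0"
    by (rule extends_reflected_at_infinity[OF AB(3,1,5)]) (use AB(6) in auto)
  ultimately show ?thesis by simp
qed

lemma fuchsian_reflected_coefficients:
  assumes nd: "z0 \<in> upper_hp" "wronskian G H z0 \<noteq> 0"
    and right: "\<And>x. \<exists>\<delta> d. \<delta> > 0 \<and> norm d = 1 \<and> on_line X {x<..<x + \<delta>} d"
    and left: "\<And>x. \<exists>\<delta> d. \<delta> > 0 \<and> norm d = 1 \<and> on_line X {x - \<delta><..<x} d"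
    and R: "R > 0" and C: "C > 0"
    and bd: "\<And>z. z \<in> closed_upper_hp \<Longrightarrow> R \<le> norm z \<Longrightarrow> norm (X z) \<le> C * norm z ^ N"
    and pos: "norm d = 1" "on_line X {R<..} d" and neg: "norm d' = 1" "on_line X {..<-R} d'"
  shows "fuchsian_on_sphere (reflected (coeff_p G H)) (reflected (coeff_q G H))"
proof -
  let ?p = "reflected (coeff_p G H)" and ?q = "reflected (coeff_q G H)"
  have up: "pole_order_le ?p z 1 \<and> pole_order_le ?q z 2 \<and> pole_order_le ?p (cnj z) 1 \<and> pole_order_le ?q (cnj z) 2"
    if z: "z \<in> upper_hp" for z
  proof -
    obtain r A B where AB: "0 < r" "A holomorphic_on ball 0 r" "B holomorphic_on ball 0 r"
      "\<And>w. w \<in> upper_hp \<Longrightarrow> w - z \<in> ball 0 r - {0} \<Longrightarrow>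
       (w - z) * coeff_p G H w = A (w - z) \<and> (w - z)\<^sup>2 * coeff_q G H w = B (w - z)"
      by (rule fuchsian_at_upper_point[OF holG holH nd z]) (rule that; assumption)
    show ?thesis
      using pole_order_le_reflected_upper[OF z AB(2,1), of 1 "coeff_p G H"]
        pole_order_le_reflected_upper[OF z AB(3,1), of 2 "coeff_q G H"] AB(4) by simp
  qed
  have po: "pole_order_le ?p z 1 \<and> pole_order_le ?q z 2" for z
  proof -
    consider "z \<in> upper_hp" | "cnj z \<in> upper_hp" | "Im z = 0" by (cases "Im z" "0::real" rule: linorder_cases) (auto simp: upper_hp_def)
    then show ?thesis
    proof cases
      case 2 then show ?thesis using up[of "cnj z"] by simp
    next
      case 3
      then have zr: "of_real (Re z) = z" by (simp add: complex_eq_iff)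
      obtain \<delta>1 d1 where 1: "\<delta>1 > 0" "norm d1 = 1" "on_line X {Re z<..<Re z + \<delta>1} d1" using right by blast
      obtain \<delta>2 d2 where 2: "\<delta>2 > 0" "norm d2 = 1" "on_line X {Re z - \<delta>2<..<Re z} d2" using left by blast
      define \<delta> where "\<delta> = min \<delta>1 \<delta>2"
      have "on_line X {Re z<..<Re z + \<delta>} d1" "on_line X {Re z - \<delta><..<Re z} d2"
        by (rule on_line_subset[OF 1(3)] on_line_subset[OF 2(3)]; auto simp: \<delta>_def)+
      moreover have "\<delta> > 0" using 1 2 by (simp add: \<delta>_def)
      ultimately show ?thesis using fuchsian_at_real_point[OF nd _ 1(2) _ 2(2)] zr by metis
    qed (use up in blast)
  qed
  have inf: "extends_holomorphically_at (\<lambda>w. ?p (1 / w) / w) 0" "extends_holomorphically_at (\<lambda>w. ?q (1 / w) / w\<^sup>2) 0"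
    using fuchsian_at_infinity[OF nd R C bd pos neg] by auto
  have mero: "?p meromorphic_on UNIV" "?q meromorphic_on UNIV"
    using po pole_order_le_imp_meromorphic meromorphic_on_meromorphic_at by blast+
  have meri: "(\<lambda>w. ?p (1 / w)) meromorphic_on {0}" "(\<lambda>w. ?q (1 / w)) meromorphic_on {0}"
    using extends_at_infinity_imp_meromorphic[of ?p 1] extends_at_infinity_imp_meromorphic[of ?q 2] inf by auto
  show ?thesis unfolding fuchsian_on_sphere_def using mero meri po inf by blast
qed

text \<open>
  A relation \<open>c G + d H = 0\<close> is turned into a real relation by multiplying \<open>c G + d H\<close> with
  \<open>cnj d G - cnj c H\<close>: up to the factor \<open>\<i>\<close> the product is \<open>\<Phi> e\<close> for the nonzero real vector \<open>e\<close> below.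
\<close>

lemma independent_unless_planar:
  assumes "\<And>e k. e \<noteq> 0 \<Longrightarrow> \<forall>z\<in>closed_upper_hp. X z \<bullet> e = k \<Longrightarrow> False"
  shows "\<forall>c d. (\<forall>z\<in>upper_hp. c * G z + d * H z = 0) \<longrightarrow> c = 0 \<and> d = 0"
proof (intro allI impI, rule ccontr)
  fix c d assume dep: "\<forall>z\<in>upper_hp. c * G z + d * H z = 0" and ne: "\<not> (c = 0 \<and> d = 0)"
  define \<alpha> where "\<alpha> = \<i> * c * cnj d"
  define e :: "real^3" where "e = vector [Im \<alpha>, Re \<alpha>, ((norm d)\<^sup>2 - (norm c)\<^sup>2) / 2]"
  have e123: "e $ 1 = Im \<alpha>" "e $ 2 = Re \<alpha>" "e $ 3 = ((norm d)\<^sup>2 - (norm c)\<^sup>2) / 2"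
    by (simp_all add: e_def)
  have "e \<noteq> 0"
  proof
    assume "e = 0"
    then have "Im \<alpha> = 0" "Re \<alpha> = 0" "(norm d)\<^sup>2 = (norm c)\<^sup>2" using e123 by auto
    then have "\<alpha> = 0" "norm d = norm c" by (auto simp: complex_eq_iff)
    then show False using ne by (auto simp: \<alpha>_def)
  qed
  have form0: "\<Phi> e z = 0" if z: "z \<in> upper_hp" for z
  proof -
    have a: "of_real (Re \<alpha>) + \<i> * of_real (Im \<alpha>) = \<alpha>" "of_real (Re \<alpha>) - \<i> * of_real (Im \<alpha>) = cnj \<alpha>"
      by (auto simp: complex_eq_iff)
    have n: "complex_of_real ((norm d)\<^sup>2) = d * cnj d" "complex_of_real ((norm c)\<^sup>2) = c * cnj c"
      by (rule complex_norm_square)+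
    have "\<Phi> e z = (of_real (Re \<alpha>) + \<i> * of_real (Im \<alpha>)) * (G z)\<^sup>2 + (of_real (Re \<alpha>) - \<i> * of_real (Im \<alpha>)) * (H z)\<^sup>2
       + \<i> * (of_real ((norm d)\<^sup>2) - of_real ((norm c)\<^sup>2)) * (G z * H z)"
      unfolding weier_form_def e123 by (simp add: field_simps)
    also have "\<dots> = \<i> * ((c * G z + d * H z) * (cnj d * G z - cnj c * H z))"
      unfolding a n by (simp add: \<alpha>_def algebra_simps power2_eq_square)
    finally show ?thesis using dep z by simp
  qed
  obtain F where F: "\<forall>z\<in>upper_hp. (F has_field_derivative \<Phi> e z) (at z) \<and> X z \<bullet> e = Re (F z)"
    using prim by blast
  have "\<exists>k. \<forall>z\<in>upper_hp. F z = k"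
    by (rule has_field_derivative_zero_constant[OF convex_upper_hp])
       (use F form0 has_field_derivative_at_within in fastforce)
  then obtain k where k: "\<And>z. z \<in> upper_hp \<Longrightarrow> X z \<bullet> e = Re k" using F by auto
  have "X z \<bullet> e = Re k" if z: "z \<in> closed_upper_hp" for z
  proof (cases "z \<in> upper_hp")
    case False
    then have "of_real (Re z) = z" using z by (auto simp: complex_eq_iff upper_hp_def closed_upper_hp_def)
    then have nb: "at z within upper_hp \<noteq> bot" using real_at_within_upper_hp_neq_bot by metis
    have "(X \<longlongrightarrow> X z) (at z within upper_hp)"
      using contX z upper_hp_subset_closed tendsto_within_subset unfolding continuous_on_def by blast
    then have "((\<lambda>w. X w \<bullet> e) \<longlongrightarrow> X z \<bullet> e) (at z within upper_hp)" by (intro tendsto_intros)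
    moreover have "\<forall>\<^sub>F w in at z within upper_hp. X w \<bullet> e = Re k" by (auto simp: eventually_at_filter k)
    then have "((\<lambda>w. X w \<bullet> e) \<longlongrightarrow> Re k) (at z within upper_hp)" by (rule tendsto_eventually)
    ultimately show ?thesis using tendsto_unique[OF nb] by blast
  qed (rule k)
  then show False using assms[OF \<open>e \<noteq> 0\<close>] by blast
qed

end

section \<open>Polygons and the ends of the surface\<close>

lemma coplanar_of_common_normal:
  fixes e u v w :: "real^3"
  assumes e: "e \<noteq> 0" and perp: "u \<bullet> e = 0" "v \<bullet> e = 0" "w \<bullet> e = 0" and nc: "\<not> collinear {0, v, w}"
  shows "coplanar {0, u, v, w}"
proof -
  have nc': "v \<noteq> 0" "w \<noteq> 0" "\<And>c. w \<noteq> c *\<^sub>R v" using nc by (auto simp: collinear_lemma)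
  then have vw: "v \<noteq> w" "w \<notin> span {v}" using nc'(3)[of 1] by (auto simp: span_singleton)
  have perp': "e \<bullet> u = 0" "e \<bullet> v = 0" "e \<bullet> w = 0" using perp by (auto simp: inner_commute)
  have "independent {w, v}" using nc'(1) vw by (simp add: independent_insert)
  moreover have "card {w, v} = 2" using vw by simp
  ultimately have "dim (span {w, v}) = 2" by (simp add: dim_eq_card_independent)
  moreover have "dim {x. e \<bullet> x = 0} = 2" using dim_hyperplane[OF e] by simp
  moreover have "span {w, v} \<subseteq> {x. e \<bullet> x = 0}"
    by (rule span_minimal) (use perp' in \<open>auto simp: subspace_hyperplane\<close>)
  ultimately have "span {w, v} = {x. e \<bullet> x = 0}"
    by (intro subspace_dim_equal subspace_span subspace_hyperplane) auto
  moreover have "affine hull {0, w, v} = span {0, w, v}" by (intro affine_hull_span_0 hull_inc) simp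
  ultimately have "{0, u, v, w} \<subseteq> affine hull {0, w, v}"
    using perp' by (auto simp: span_insert_0)
  then show ?thesis unfolding coplanar_def by blast
qed

text \<open>
  \<open>sinh\<close> of the real part \<open>\<alpha> ln \<bar>z\<bar> + \<mu>\<close> is of order \<open>\<bar>z\<bar>\<close> to the power \<open>\<bar>\<alpha>\<bar>\<close>, and the imaginary part, the
  height on the axis, is bounded.
\<close>

lemma polynomial_growth_of_helicoid:
  assumes "k > 0"
  shows "\<exists>C N. C > 0 \<and> (\<forall>z\<in>closed_upper_hp. 1 \<le> norm z \<longrightarrow>
     norm (helicoid c e1 e2 e3 k (of_real \<alpha> * Ln z + of_real \<mu>)) \<le> C * norm z ^ N)"
proof -
  define N where "N = nat \<lceil>\<bar>\<alpha>\<bar>\<rceil>"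
  define C where "C = norm c + k * (exp \<bar>\<mu>\<bar> * (norm e1 + norm e2) + \<bar>\<alpha>\<bar> * pi * norm e3) + 1"
  have "C > 0" using assms by (auto simp: C_def intro!: add_nonneg_pos add_nonneg_nonneg mult_nonneg_nonneg)
  moreover have "norm (helicoid c e1 e2 e3 k (of_real \<alpha> * Ln z + of_real \<mu>)) \<le> C * norm z ^ N"
    if z: "1 \<le> norm z" for z
  proof -
    have z0: "z \<noteq> 0" using z by auto
    define w where "w = of_real \<alpha> * Ln z + of_real \<mu>"
    have n1: "1 \<le> norm z ^ N" using z by simp
    have Re: "Re w = \<alpha> * ln (norm z) + \<mu>" and Im: "Im w = \<alpha> * Im (Ln z)" using z0 by (simp_all add: w_def)
    have "\<bar>Im (Ln z)\<bar> \<le> pi" using mpi_less_Im_Ln[OF z0] Im_Ln_le_pi[OF z0] by auto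
    then have Imb: "\<bar>Im w\<bar> \<le> \<bar>\<alpha>\<bar> * pi" unfolding Im abs_mult by (intro mult_left_mono) auto
    have sh: "\<bar>sinh (Re w)\<bar> \<le> exp \<bar>\<mu>\<bar> * norm z ^ N"
    proof -
      have "\<bar>sinh (Re w)\<bar> \<le> exp \<bar>Re w\<bar>"
      proof -
        have "\<bar>(x - y) / 2\<bar> \<le> E" if "x \<le> E" "y \<le> E" "0 < x" "0 < y" for x y E :: real
          using that by (simp add: abs_le_iff)
        then show ?thesis unfolding sinh_field_def by simp
      qed
      also have "\<bar>Re w\<bar> \<le> \<bar>\<mu>\<bar> + real N * ln (norm z)"
      proof -
        have "\<bar>Re w\<bar> \<le> \<bar>\<alpha>\<bar> * ln (norm z) + \<bar>\<mu>\<bar>"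
          unfolding Re using abs_triangle_ineq[of "\<alpha> * ln (norm z)" \<mu>] z by (simp add: abs_mult)
        moreover have "\<bar>\<alpha>\<bar> * ln (norm z) \<le> real N * ln (norm z)"
          using z by (intro mult_right_mono) (auto simp: N_def)
        ultimately show ?thesis by simp
      qed
      then have "exp \<bar>Re w\<bar> \<le> exp (\<bar>\<mu>\<bar> + real N * ln (norm z))" by simp
      also have "\<dots> = exp \<bar>\<mu>\<bar> * norm z ^ N"
        using z0 by (simp add: exp_add exp_of_nat_mult)
      finally show ?thesis .
    qed
    have s1: "\<bar>sinh (Re w) * cos (Im w)\<bar> \<le> exp \<bar>\<mu>\<bar> * norm z ^ N" "\<bar>sinh (Re w) * sin (Im w)\<bar> \<le> exp \<bar>\<mu>\<bar> * norm z ^ N"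
      using mult_left_le[OF abs_cos_le_one abs_ge_zero, of "sinh (Re w)" "Im w"]
        mult_left_le[OF abs_sin_le_one abs_ge_zero, of "sinh (Re w)" "Im w"] sh
      unfolding abs_mult by linarith+
    have "norm ((sinh (Re w) * cos (Im w)) *\<^sub>R e1 + (sinh (Re w) * sin (Im w)) *\<^sub>R e2 + Im w *\<^sub>R e3)
       \<le> exp \<bar>\<mu>\<bar> * norm z ^ N * norm e1 + exp \<bar>\<mu>\<bar> * norm z ^ N * norm e2 + \<bar>\<alpha>\<bar> * pi * norm e3"
      by (intro norm_triangle_le add_mono order_refl) (auto intro!: mult_right_mono s1 Imb)
    also have "\<dots> \<le> (exp \<bar>\<mu>\<bar> * (norm e1 + norm e2) + \<bar>\<alpha>\<bar> * pi * norm e3) * norm z ^ N"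
    proof -
      have "\<bar>\<alpha>\<bar> * pi * norm e3 * 1 \<le> \<bar>\<alpha>\<bar> * pi * norm e3 * norm z ^ N" using n1 by (intro mult_left_mono) auto
      then show ?thesis by (simp add: algebra_simps)
    qed
    finally have main: "norm ((sinh (Re w) * cos (Im w)) *\<^sub>R e1 + (sinh (Re w) * sin (Im w)) *\<^sub>R e2 + Im w *\<^sub>R e3)
       \<le> (exp \<bar>\<mu>\<bar> * (norm e1 + norm e2) + \<bar>\<alpha>\<bar> * pi * norm e3) * norm z ^ N" (is "norm ?V \<le> ?K * _") .
    have "norm (c + k *\<^sub>R ?V) \<le> norm c + k * norm ?V"
      using norm_triangle_ineq[of c "k *\<^sub>R ?V"] assms by simp
    also have "\<dots> \<le> norm c * norm z ^ N + k * (?K * norm z ^ N)"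
      using mult_left_mono[OF n1, of "norm c"] main assms by (intro add_mono mult_left_mono) auto
    also have "\<dots> \<le> C * norm z ^ N" using n1 by (simp add: C_def algebra_simps)
    finally show ?thesis unfolding helicoid_def w_def .
  qed
  ultimately show ?thesis by blast
qed

lemma polynomial_growth_at_infinity:
  assumes ext: "extends_continuously X v" and hel: "v = None \<Longrightarrow> has_helicoidal_end X \<alpha>"
  obtains R C N where "R > 0" "C > 0"
    "\<And>z. z \<in> closed_upper_hp \<Longrightarrow> R \<le> norm z \<Longrightarrow> norm (X z) \<le> C * norm z ^ N"
proof (cases v)
  case (Some b)
  then have "(X \<longlongrightarrow> b) at_infinity_upper" using ext by (simp add: extends_continuously_def)
  then have "\<forall>\<^sub>F z in at_infinity_upper. dist (X z) b < 1" by (rule tendstoD) simp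
  then obtain R where R: "\<And>z. R \<le> norm z \<Longrightarrow> z \<in> closed_upper_hp \<Longrightarrow> dist (X z) b < 1"
    unfolding at_infinity_upper_def eventually_inf_principal eventually_at_infinity by blast
  show ?thesis
  proof (rule that[of "max R 1" "norm b + 1" 0])
    show "norm (X z) \<le> (norm b + 1) * norm z ^ 0" if "z \<in> closed_upper_hp" "max R 1 \<le> norm z" for z
      using R[of z] that norm_triangle_ineq2[of "X z" b] by (simp add: dist_norm)
  qed (auto simp: add_nonneg_pos)
next
  case None
  then obtain c e1 e2 e3 k \<mu> where k: "k > 0"
    and lim: "((\<lambda>z. X z - helicoid c e1 e2 e3 k (of_real \<alpha> * Ln z + of_real \<mu>)) \<longlongrightarrow> 0) at_infinity_upper"
    using hel unfolding has_helicoidal_end_def by blast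
  have "\<forall>\<^sub>F z in at_infinity_upper. dist (X z - helicoid c e1 e2 e3 k (of_real \<alpha> * Ln z + of_real \<mu>)) 0 < 1"
    using lim by (rule tendstoD) simp
  then obtain R where R: "\<And>z. R \<le> norm z \<Longrightarrow> z \<in> closed_upper_hp \<Longrightarrow>
      norm (X z - helicoid c e1 e2 e3 k (of_real \<alpha> * Ln z + of_real \<mu>)) < 1"
    unfolding at_infinity_upper_def eventually_inf_principal eventually_at_infinity by auto
  obtain C N where C: "C > 0" "\<And>z. z \<in> closed_upper_hp \<Longrightarrow> 1 \<le> norm z \<Longrightarrow>
     norm (helicoid c e1 e2 e3 k (of_real \<alpha> * Ln z + of_real \<mu>)) \<le> C * norm z ^ N"
    using polynomial_growth_of_helicoid[OF k, of c e1 e2 e3 \<alpha> \<mu>] by blast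
  show ?thesis
  proof (rule that[of "max R 1" "C + 1" N])
    show "norm (X z) \<le> (C + 1) * norm z ^ N" if z: "z \<in> closed_upper_hp" "max R 1 \<le> norm z" for z
    proof -
      have "norm (X z) \<le> norm (helicoid c e1 e2 e3 k (of_real \<alpha> * Ln z + of_real \<mu>)) + 1"
        using R[of z] z norm_triangle_ineq2[of "X z" "helicoid c e1 e2 e3 k (of_real \<alpha> * Ln z + of_real \<mu>)"] by simp
      also have "\<dots> \<le> C * norm z ^ N + 1 * norm z ^ N" using C(2)[OF z(1)] z(2) by (intro add_mono) auto
      finally show ?thesis by (simp add: algebra_simps)
    qed
  qed (use C(1) in auto)
qed

lemma weierstrass_surface_of_data:
  assumes W: "weierstrass_data X G H" and c: "continuous_on closed_upper_hp X"
  shows "weierstrass_surface X G H"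
proof
  show G: "G holomorphic_on upper_hp" and H: "H holomorphic_on upper_hp"
    using W by (auto simp: weierstrass_data_def)
  show "continuous_on closed_upper_hp X" by (rule c)
  define \<phi>1 \<phi>2 \<phi>3 where "\<phi>1 \<xi> = \<i> * ((G \<xi>)\<^sup>2 - (H \<xi>)\<^sup>2)" and "\<phi>2 \<xi> = (G \<xi>)\<^sup>2 + (H \<xi>)\<^sup>2"
    and "\<phi>3 \<xi> = 2 * \<i> * G \<xi> * H \<xi>" for \<xi>
  obtain x0 k where x0: "x0 \<in> upper_hp" and X: "\<And>x. x \<in> upper_hp \<Longrightarrow> X x = k + vector
          [Re (contour_integral (linepath x0 x) \<phi>1), Re (contour_integral (linepath x0 x) \<phi>2),
           Re (contour_integral (linepath x0 x) \<phi>3)]"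
    using W unfolding weierstrass_data_def \<phi>1_def \<phi>2_def \<phi>3_def by blast
  have prim: "\<exists>P. \<forall>x\<in>upper_hp. (P has_field_derivative \<phi> x) (at x) \<and> contour_integral (linepath x0 x) \<phi> = P x"
    if \<phi>: "\<phi> holomorphic_on upper_hp" for \<phi>
  proof -
    obtain P where P: "\<And>x. x \<in> upper_hp \<Longrightarrow> (P has_field_derivative \<phi> x) (at x within upper_hp)"
      using holomorphic_convex_primitive'[OF convex_upper_hp open_upper_hp \<phi>] by blast
    have "contour_integral (linepath x0 x) \<phi> = P x - P x0" if x: "x \<in> upper_hp" for x
    proof -
      have "path_image (linepath x0 x) \<subseteq> upper_hp"
        using closed_segment_subset[OF x0 x convex_upper_hp] by simp
      from contour_integral_primitive[OF P valid_path_linepath this]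
      show ?thesis by (intro contour_integral_unique) simp
    qed
    moreover have "((\<lambda>x. P x - P x0) has_field_derivative \<phi> x) (at x)" if x: "x \<in> upper_hp" for x
      using P[OF x] at_within_open[OF x open_upper_hp] by (auto intro!: derivative_eq_intros)
    ultimately show ?thesis by (intro exI[of _ "\<lambda>x. P x - P x0"]) simp
  qed
  have h: "\<phi>1 holomorphic_on upper_hp" "\<phi>2 holomorphic_on upper_hp" "\<phi>3 holomorphic_on upper_hp"
    unfolding \<phi>1_def \<phi>2_def \<phi>3_def by (intro holomorphic_intros G H)+
  obtain P1 where P1: "\<And>x. x \<in> upper_hp \<Longrightarrow> (P1 has_field_derivative \<phi>1 x) (at x)"
    "\<And>x. x \<in> upper_hp \<Longrightarrow> contour_integral (linepath x0 x) \<phi>1 = P1 x" using prim[OF h(1)] by blast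
  obtain P2 where P2: "\<And>x. x \<in> upper_hp \<Longrightarrow> (P2 has_field_derivative \<phi>2 x) (at x)"
    "\<And>x. x \<in> upper_hp \<Longrightarrow> contour_integral (linepath x0 x) \<phi>2 = P2 x" using prim[OF h(2)] by blast
  obtain P3 where P3: "\<And>x. x \<in> upper_hp \<Longrightarrow> (P3 has_field_derivative \<phi>3 x) (at x)"
    "\<And>x. x \<in> upper_hp \<Longrightarrow> contour_integral (linepath x0 x) \<phi>3 = P3 x" using prim[OF h(3)] by blast
  fix v :: "real^3"
  let ?F = "\<lambda>z. of_real (v $ 1) * P1 z + of_real (v $ 2) * P2 z + of_real (v $ 3) * P3 z + of_real (k \<bullet> v)"
  show "\<exists>F. \<forall>z\<in>upper_hp. (F has_field_derivative weier_form G H v z) (at z) \<and> X z \<bullet> v = Re (F z)"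
  proof (intro exI[of _ ?F] ballI conjI)
    fix z assume z: "z \<in> upper_hp"
    have "weier_form G H v z = of_real (v $ 1) * \<phi>1 z + of_real (v $ 2) * \<phi>2 z + of_real (v $ 3) * \<phi>3 z"
      by (simp add: weier_form_def \<phi>1_def \<phi>2_def \<phi>3_def)
    then show "(?F has_field_derivative weier_form G H v z) (at z)"
      using P1(1)[OF z] P2(1)[OF z] P3(1)[OF z] by (auto intro!: derivative_eq_intros)
    show "X z \<bullet> v = Re (?F z)"
      unfolding X[OF z] P1(2)[OF z] P2(2)[OF z] P3(2)[OF z]
      by (simp add: inner_add_left inner_vec_def sum_3 algebra_simps)
  qed
qed

lemma on_line_half_line:
  assumes "(\<lambda>s. X (of_real s)) ` A \<subseteq> half_line p d"
  shows "on_line X A d"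
  using assms unfolding on_line_def half_line_def by blast

lemma closed_segment_on_line:
  assumes "(\<lambda>s. X (of_real s)) ` A \<subseteq> closed_segment p q" "q - p = c *\<^sub>R d"
  shows "on_line X A d"
  unfolding on_line_def
proof (intro exI[of _ p] ballI)
  fix s assume "s \<in> A"
  then have "X (of_real s) \<in> closed_segment p q" using assms(1) by blast
  then obtain u where u: "X (of_real s) = (1 - u) *\<^sub>R p + u *\<^sub>R q" unfolding closed_segment_def by blast
  have "X (of_real s) = p + u *\<^sub>R (q - p)" unfolding u by (simp add: algebra_simps)
  then show "\<exists>\<sigma>. X (of_real s) = p + \<sigma> *\<^sub>R d" unfolding assms(2) by auto
qed

text \<open>
  The last two sides are segments or half-lines according to whether the last vertex is finite; in both
  cases they lie on lines with directions \<open>D (n+2)\<close> and \<open>D (n+3)\<close>.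
\<close>

lemma polygon_sides_on_lines:
  assumes poly: "is_polygon n D a v" and rep: "represents_polygon n D X t a v"
  shows "\<And>i. i \<in> {1..n+1} \<Longrightarrow> on_line X {t i..t (i+1)} (D i)"
    and "on_line X {t (n+2)..} (D (n+2))" and "on_line X {..t 1} (D (n+3))"
    and "inj_on (\<lambda>s. X (of_real s)) {t (n+2)..}"
proof -
  fix i assume i: "i \<in> {1..n+1}"
  have "a (i+1) \<noteq> a i"
    using poly i unfolding is_polygon_def inj_on_def by fastforce
  moreover have "D i = (1 / norm (a (i+1) - a i)) *\<^sub>R (a (i+1) - a i)" using poly i by (auto simp: is_polygon_def)
  ultimately have "a (i+1) - a i = norm (a (i+1) - a i) *\<^sub>R D i" by simp
  then show "on_line X {t i..t (i+1)} (D i)"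
    by (rule closed_segment_on_line[rotated])
       (use rep i in \<open>auto simp: represents_polygon_def bij_betw_def\<close>)
next
  show "on_line X {t (n+2)..} (D (n+2))"
  proof (cases v)
    case None
    then show ?thesis using rep by (intro on_line_half_line) (auto simp: represents_polygon_def bij_betw_def)
  next
    case (Some b)
    then have "b \<in> half_line (a (n+2)) (D (n+2))" using poly by (auto simp: is_polygon_def Let_def)
    then obtain \<sigma> where "b = a (n+2) + \<sigma> *\<^sub>R D (n+2)" unfolding half_line_def by blast
    then have "b - a (n+2) = \<sigma> *\<^sub>R D (n+2)" by simp
    then show ?thesis
      by (rule closed_segment_on_line[rotated]) (use rep Some in \<open>auto simp: represents_polygon_def bij_betw_def\<close>)
  qed
  have "on_line X {..t 1} (- D (n+3))"
  proof (cases v)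
    case None
    then show ?thesis using rep by (intro on_line_half_line) (auto simp: represents_polygon_def bij_betw_def)
  next
    case (Some b)
    then have "b \<in> half_line (a 1) (- D (n+3))" using poly by (auto simp: is_polygon_def Let_def)
    then obtain \<sigma> where "b = a 1 + \<sigma> *\<^sub>R (- D (n+3))" unfolding half_line_def by blast
    then have "a 1 - b = (- \<sigma>) *\<^sub>R (- D (n+3))" by simp
    then show ?thesis
      by (rule closed_segment_on_line[rotated]) (use rep Some in \<open>auto simp: represents_polygon_def bij_betw_def\<close>)
  qed
  then show "on_line X {..t 1} (D (n+3))"
    unfolding on_line_def by (metis scaleR_minus_left scaleR_minus_right)
  show "inj_on (\<lambda>s. X (of_real s)) {t (n+2)..}"
    using rep by (cases v) (auto simp: represents_polygon_def bij_betw_def)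
qed

text \<open>
  To the right of \<open>x\<close> lies the side that starts at the last \<open>t i \<le> x\<close>, to the left the one that starts
  at the last \<open>t i < x\<close>; if there is no such \<open>i\<close>, it is the side that ends at \<open>t 1\<close>.
\<close>

lemma sides_at_every_boundary_point:
  fixes t :: "nat \<Rightarrow> real"
  assumes unit: "\<And>i. i \<in> {1..n+3} \<Longrightarrow> norm (D i) = 1"
    and mid: "\<And>i. i \<in> {1..n+1} \<Longrightarrow> on_line X {t i..t (i+1)} (D i)"
    and last: "on_line X {t (n+2)..} (D (n+2))" and first: "on_line X {..t 1} (D (n+3))"
  shows "\<exists>\<delta> d. \<delta> > 0 \<and> norm d = 1 \<and> on_line X {x<..<x + \<delta>} d"
    and "\<exists>\<delta> d. \<delta> > 0 \<and> norm d = 1 \<and> on_line X {x - \<delta><..<x} d"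
proof -
  consider "x < t 1" | "t (n+2) \<le> x" | "t 1 \<le> x" "x < t (n+2)" by linarith
  then show "\<exists>\<delta> d. \<delta> > 0 \<and> norm d = 1 \<and> on_line X {x<..<x + \<delta>} d"
  proof cases
    case 1
    have "on_line X {x<..<x + (t 1 - x)} (D (n+3))" by (rule on_line_subset[OF first]) auto
    then show ?thesis using 1 unit[of "n+3"] by (intro exI[of _ "t 1 - x"] exI[of _ "D (n+3)"]) auto
  next
    case 2
    have "on_line X {x<..<x + 1} (D (n+2))" by (rule on_line_subset[OF last]) (use 2 in auto)
    then show ?thesis using unit[of "n+2"] zero_less_one by (intro exI[of _ 1] exI[of _ "D (n+2)"]) auto
  next
    case 3
    define I where "I = {j \<in> {1..n+2}. t j \<le> x}"
    have I: "finite I" "1 \<in> I" using 3 by (auto simp: I_def)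
    define i where "i = Max I"
    have iI: "i \<in> I" unfolding i_def using I Max_in by blast
    then have i: "i \<in> {1..n+1}" "t i \<le> x"
      using 3(2) by (auto simp: I_def) (metis add_2_eq_Suc' le_SucE not_less)
    have "i + 1 \<notin> I" using Max_ge[OF I(1), of "i+1"] unfolding i_def[symmetric] by auto
    then have "x < t (i+1)" using i(1) by (auto simp: I_def)
    moreover have "on_line X {x<..<x + (t (i+1) - x)} (D i)" by (rule on_line_subset[OF mid[OF i(1)]]) (use i in auto)
    moreover have "norm (D i) = 1" using unit i(1) by auto
    ultimately show ?thesis by (intro exI[of _ "t (i+1) - x"] exI[of _ "D i"]) auto
  qed
  consider "x \<le> t 1" | "t (n+2) < x" | "t 1 < x" "x \<le> t (n+2)" by linarith
  then show "\<exists>\<delta> d. \<delta> > 0 \<and> norm d = 1 \<and> on_line X {x - \<delta><..<x} d"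
  proof cases
    case 1
    have "on_line X {x - 1<..<x} (D (n+3))" by (rule on_line_subset[OF first]) (use 1 in auto)
    then show ?thesis using unit[of "n+3"] by (intro exI[of _ 1] exI[of _ "D (n+3)"]) auto
  next
    case 2
    have "on_line X {x - (x - t (n+2))<..<x} (D (n+2))" by (rule on_line_subset[OF last]) auto
    then show ?thesis using 2 unit[of "n+2"] by (intro exI[of _ "x - t (n+2)"] exI[of _ "D (n+2)"]) auto
  next
    case 3
    define I where "I = {j \<in> {1..n+2}. t j < x}"
    have I: "finite I" "1 \<in> I" using 3 by (auto simp: I_def)
    define i where "i = Max I"
    have iI: "i \<in> I" unfolding i_def using I Max_in by blast
    then have i: "i \<in> {1..n+1}" "t i < x"
      using 3(2) by (auto simp: I_def) (metis add_2_eq_Suc' le_SucE not_less)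
    have "i + 1 \<notin> I" using Max_ge[OF I(1), of "i+1"] unfolding i_def[symmetric] by auto
    then have "x \<le> t (i+1)" using i(1) by (auto simp: I_def)
    then have "on_line X {x - (x - t i)<..<x} (D i)" by (intro on_line_subset[OF mid[OF i(1)]]) auto
    moreover have "norm (D i) = 1" using unit i(1) by auto
    ultimately show ?thesis using i(2) by (intro exI[of _ "x - t i"] exI[of _ "D i"]) auto
  qed
qed

lemma direction_orthogonal:
  assumes "on_line X A d" "s \<in> A" "s' \<in> A" "X (of_real s) \<noteq> X (of_real s')" "X (of_real s) \<bullet> e = X (of_real s') \<bullet> e"
  shows "d \<bullet> e = 0"
proof -
  obtain p where "\<forall>s\<in>A. \<exists>\<sigma>::real. X (of_real s) = p + \<sigma> *\<^sub>R d" using assms(1) on_line_def by blast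
  then obtain \<sigma> \<sigma>' where e: "X (of_real s) = p + \<sigma> *\<^sub>R d" "X (of_real s') = p + \<sigma>' *\<^sub>R d"
    using assms(2,3) by meson
  then have "\<sigma> \<noteq> \<sigma>'" using assms(4) by auto
  moreover have "(\<sigma> - \<sigma>') * (d \<bullet> e) = 0" using assms(5) unfolding e by (simp add: inner_add_left algebra_simps)
  ultimately show ?thesis by simp
qed

theorem proposition3p11:
  fixes n :: nat and D :: "nat \<Rightarrow> real^3" and X :: "complex \<Rightarrow> real^3"
    and G H :: "complex \<Rightarrow> complex"
  assumes "n \<ge> 1"
    and "D \<in> direction_tuples n"
    and "X \<in> polygonal_minimal_disks n D"
    and "weierstrass_data X G H"
  shows "(\<exists>p q. fundamental_system upper_hp p q G H) \<and>
         (\<forall>p q. fundamental_system upper_hp p q G H \<longrightarrow> is_real_fuchsian_equation upper_hp p q)"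
proof -
  obtain a v t where poly: "is_polygon n D a v" and mono: "strict_mono_on {1..n+2} t"
    and ext: "extends_continuously X v" and rep: "represents_polygon n D X t a v"
    and end': "case v of None \<Rightarrow> has_helicoidal_end X (1 - angle_coeff n D (n+3))
         | Some b \<Rightarrow> has_vertex_angle (\<lambda>w. X (- 1 / w)) 0 b (1 - angle_coeff n D (n+3)) \<and> bounded (X ` upper_hp)"
    using assms(3) unfolding polygonal_minimal_disks_def by blast
  have end_: "has_helicoidal_end X (1 - angle_coeff n D (n+3))" if "v = None" using end' that by simp
  have contX: "continuous_on closed_upper_hp X" using ext by (simp add: extends_continuously_def)
  interpret weierstrass_surface X G H by (rule weierstrass_surface_of_data[OF assms(4) contX])
  have unit: "norm (D i) = 1" if "i \<in> {1..n+3}" for i using assms(2) that by (auto simp: direction_tuples_def)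
  note lines = polygon_sides_on_lines[OF poly rep]
  note sides = sides_at_every_boundary_point[where D = D and n = n and X = X and t = t, OF unit lines(1-3)]
  have ind: "\<forall>c d. (\<forall>z\<in>upper_hp. c * G z + d * H z = 0) \<longrightarrow> c = 0 \<and> d = 0"
  proof (rule independent_unless_planar)
    fix e k assume e: "e \<noteq> 0" and k: "\<forall>z\<in>closed_upper_hp. X z \<bullet> e = k"
    have k': "X (of_real s) \<bullet> e = X (of_real s') \<bullet> e" for s s' using k by (simp add: closed_upper_hp_def)
    \<comment> \<open>A nonzero vector \<open>e\<close> with \<open>X \<bullet> e\<close> constant is orthogonal to every side, contradicting the choice of the directions.\<close>
    have mid: "D i \<bullet> e = 0" if i: "i \<in> {1..n+1}" for i
    proof (rule direction_orthogonal[OF lines(1)[OF i] _ _ _ k'])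
      have "t i < t (i+1)" using mono i by (auto simp: strict_mono_on_def)
      then show "t i \<in> {t i..t (i+1)}" "t (i+1) \<in> {t i..t (i+1)}" by auto
      have "X (of_real (t i)) = a i" "X (of_real (t (i+1))) = a (i+1)" "a i \<noteq> a (i+1)"
        using rep poly i unfolding represents_polygon_def is_polygon_def inj_on_def by fastforce+
      then show "X (of_real (t i)) \<noteq> X (of_real (t (i+1)))" by simp
    qed
    have last: "D (n+2) \<bullet> e = 0"
    proof (rule direction_orthogonal[OF lines(2) _ _ _ k'])
      show "t (n+2) \<in> {t (n+2)..}" "t (n+2) + 1 \<in> {t (n+2)..}" by auto
      then show "X (of_real (t (n+2))) \<noteq> X (of_real (t (n+2) + 1))"
        using inj_onD[OF lines(4), of "t (n+2)" "t (n+2) + 1"] by auto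
    qed
    have "coplanar {0, D 1, D (n+1), D (n+2)}"
    proof (rule coplanar_of_common_normal[OF e])
      show "\<not> collinear {0, D (n+1), D (n+2)}" using assms(2) by (auto simp: direction_tuples_def)
    qed (use mid last in auto)
    then show False using assms(1,2) by (auto simp: direction_tuples_def)
  qed
  obtain z0 where nd: "z0 \<in> upper_hp" "wronskian G H z0 \<noteq> 0"
    using wronskian_nonzero_of_independent[OF holG holH ind] by blast
  obtain R0 C N where R0: "R0 > 0" "C > 0" "\<And>z. z \<in> closed_upper_hp \<Longrightarrow> R0 \<le> norm z \<Longrightarrow> norm (X z) \<le> C * norm z ^ N"
    by (rule polynomial_growth_at_infinity[OF ext end_]) (assumption | (rule that; assumption))+
  \<comment> \<open>Beyond \<open>R\<close> the growth bound holds and the real axis belongs to the last two sides.\<close>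
  define R where "R = max R0 (max \<bar>t 1\<bar> \<bar>t (n+2)\<bar>)"
  have R: "R > 0" using R0(1) by (simp add: R_def)
  have pos: "on_line X {R<..} (D (n+2))" by (rule on_line_subset[OF lines(2)]) (auto simp: R_def)
  have neg: "on_line X {..<-R} (D (n+3))" by (rule on_line_subset[OF lines(3)]) (auto simp: R_def)
  have fu: "fuchsian_on_sphere (reflected (coeff_p G H)) (reflected (coeff_q G H))"
  proof (rule fuchsian_reflected_coefficients[OF nd sides R R0(2) _ _ pos _ neg])
    show "norm (X z) \<le> C * norm z ^ N" if "z \<in> closed_upper_hp" "R \<le> norm z" for z
      using R0(3)[OF that(1)] that(2) by (simp add: R_def)
  qed (use unit in auto)
  show ?thesis
  proof (intro conjI allI impI)
    show "\<exists>p q. fundamental_system upper_hp p q G H" using fundamental_system_coeff[OF holG holH ind nd] by blast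
    fix p q assume fs: "fundamental_system upper_hp p q G H"
    have "\<forall>\<^sub>\<approx>x\<in>upper_hp. x \<in> upper_hp" using eventually_in_cosparse[OF order_refl open_upper_hp] .
    with fundamental_system_unique[OF holG holH nd fs]
    have "\<forall>\<^sub>\<approx>x\<in>upper_hp. reflected (coeff_p G H) x = p x \<and> reflected (coeff_q G H) x = q x"
      by eventually_elim (simp add: reflected_upper)
    then show "is_real_fuchsian_equation upper_hp p q"
      unfolding is_real_fuchsian_equation_def using fu real_on_real_axis_reflected by blast
  qed
qed


end
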